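(* Let $K$ be a field, $S=K[x_1,\ldots,x_n]$ with the standard grading, and $A=K[x_1,\ldots,x_n,y_1,\ldots,y_m]$ with the bigrading $\deg x_i=(1,0)$ and $\deg y_j=(p_j,1)$, where the $p_j\ge 0$ are integers. Let $M$ be a finitely generated bigraded $A$-module and let $M_k=\bigoplus_{i\in\mathbb{Z}}M_{(i,k)}$, a finitely generated graded $S$-module. Then, for every $i\ge 0$ and for $k\gg 0$, the higher iterated Hilbert coefficient $e^i_j(M_k)$ is a polynomial in $k$, with $$\deg e^i_j(M_k)\le m+j-1\quad\text{for } j=0,\ldots,\operatorname{ldim}M+i-1,$$ and $e^i_j(M_k)=0$ for $j>\operatorname{ldim}M+i-1$.
   Context: For a finitely generated graded $S$-module $W$ of Krull dimension $d$, put $H_0(W,k)=\dim_K W_k$ and recursively $H_i(W,k)=\sum_{j\le k}H_{i-1}(W,j)$ for $i\ge1$. For $k\gg0$ one has $H_i(W,k)=P^i_W(k)$ for a unique polynomial $P^i_W(x)\in\mathbb{Q}[x]$ of degree $d+i-1$ (the $i$th Hilbert polynomial), written $$P^i_W(x)=\sum_{j=0}^{d+i-1}(-1)^j e^i_j(W)\binom{x+d+i-j-1}{d+i-j-1}.$$ The integers $e^i_j(W)$, $0\le j\le d+i-1$, are the higher iterated Hilbert coefficients of $W$; set $e^i_j(W)=0$ for $j>d+i-1$. The zero module has dimension $-\infty$, so all of its coefficients are $0$. For a finitely generated bigraded $A$-module $M$, the Krull dimension $\dim M_k$ is constant for $k\gg0$, and $\operatorname{ldim}M:=\lim_{k\to\infty}\dim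 M_k$. Convention: the zero polynomial has degree $-1$. *)

theory Defs
  imports
    "HOL-Library.Poly_Mapping"
    "HOL-Library.Product_Plus"
    "HOL-Library.Extended_Real"
    "HOL-Computational_Algebra.Polynomial"
    "HOL-Algebra.QuotRing"
    "Jordan_Normal_Form.VS_Connect"
begin

section \<open>Polynomial rings\<close>

text \<open>Exponent vectors are finitely supported functions into \<^typ>\<open>nat\<close>, polynomials are
  finitely supported functions on exponent vectors.  \<open>poly_ring V\<close> is \<open>K[V]\<close>, where the field \<open>K\<close>
  is the type \<open>'k\<close>; all these rings, for varying \<open>V\<close>, are subrings of one another.\<close>

type_synonym ('v, 'k) mpoly = "('v \<Rightarrow>\<^sub>0 nat) \<Rightarrow>\<^sub>0 'k"

definition poly_ring :: "'v set \<Rightarrow> ('v, 'k::field) mpoly ring" where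
  "poly_ring V =
    \<lparr>carrier = {f. \<forall>t\<in>Poly_Mapping.keys f. Poly_Mapping.keys t \<subseteq> V},
     mult = (*), one = 1, zero = 0, add = (+)\<rparr>"

lemma poly_ring_cring: "cring (poly_ring V :: ('v, 'k::field) mpoly ring)"
proof -
  have neg: "\<exists>g\<in>carrier (poly_ring V). f + g = 0"
    if "f \<in> carrier (poly_ring V)" for f :: "('v, 'k) mpoly"
    using that by (intro bexI[of _ "- f"]) (auto simp: poly_ring_def)
  have mult: "f * g \<in> carrier (poly_ring V)"
    if f: "f \<in> carrier (poly_ring V)" and g: "g \<in> carrier (poly_ring V)" for f g :: "('v, 'k) mpoly"
  proof -
    have "Poly_Mapping.keys t \<subseteq> V" if t: "t \<in> Poly_Mapping.keys (f * g)" for t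
    proof -
      obtain a b where ab: "t = a + b" "a \<in> Poly_Mapping.keys f" "b \<in> Poly_Mapping.keys g"
        using keys_mult[of f g] t by blast
      moreover have "Poly_Mapping.keys a \<subseteq> V" "Poly_Mapping.keys b \<subseteq> V"
        using f g ab by (auto simp: poly_ring_def)
      ultimately show ?thesis
        using keys_add[of a b] by blast
    qed
    then show ?thesis by (simp add: poly_ring_def)
  qed
  have add: "f + g \<in> carrier (poly_ring V)"
    if "f \<in> carrier (poly_ring V)" "g \<in> carrier (poly_ring V)" for f g :: "('v, 'k) mpoly"
    using that keys_add[of f g] by (auto simp: poly_ring_def)
  have zero: "0 \<in> carrier (poly_ring V :: ('v, 'k) mpoly ring)"
    and one: "1 \<in> carrier (poly_ring V :: ('v, 'k) mpoly ring)"
    by (simp_all add: poly_ring_def)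
  have ops: "x \<otimes>\<^bsub>poly_ring V\<^esub> y = x * y" "x \<oplus>\<^bsub>poly_ring V\<^esub> y = x + y"
      "\<one>\<^bsub>poly_ring V\<^esub> = 1" "\<zero>\<^bsub>poly_ring V\<^esub> = 0" for x y :: "('v, 'k) mpoly"
    by (simp_all add: poly_ring_def)
  have "abelian_group (poly_ring V :: ('v, 'k) mpoly ring)"
    by (rule abelian_groupI) (simp_all only: ops add zero neg ac_simps add_0_left add_0_right)
  moreover have "comm_monoid (poly_ring V :: ('v, 'k) mpoly ring)"
    by (rule comm_monoidI) (simp_all only: ops mult one ac_simps mult_1_left mult_1_right)
  ultimately show ?thesis
    by (rule cringI) (simp only: ops distrib_right)
qed

text \<open>\<open>x\<^sub>1, \<dots>, x\<^sub>n\<close> are \<open>Inl 0, \<dots>, Inl (n - 1)\<close> and \<open>y\<^sub>1, \<dots>, y\<^sub>m\<close> are \<open>Inr 0, \<dots>, Inr (m - 1)\<close>.\<close>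

definition ringS :: "nat \<Rightarrow> (nat + nat, 'k::field) mpoly ring" where
  "ringS n = poly_ring (Inl ` {..<n})"

definition ringA :: "nat \<Rightarrow> nat \<Rightarrow> (nat + nat, 'k::field) mpoly ring" where
  "ringA n m = poly_ring ({..<n} <+> {..<m})"

definition var_bideg :: "(nat \<Rightarrow> nat) \<Rightarrow> nat + nat \<Rightarrow> int \<times> int" where
  "var_bideg p v = (case v of Inl i \<Rightarrow> (1, 0) | Inr j \<Rightarrow> (int (p j), 1))"

definition bideg :: "(nat \<Rightarrow> nat) \<Rightarrow> (nat + nat \<Rightarrow>\<^sub>0 nat) \<Rightarrow> int \<times> int" where
  "bideg p t =
    (\<Sum>v\<in>Poly_Mapping.keys t. int (Poly_Mapping.lookup t v) * fst (var_bideg p v),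
     \<Sum>v\<in>Poly_Mapping.keys t. int (Poly_Mapping.lookup t v) * snd (var_bideg p v))"

definition bihomogeneous ::
    "nat \<Rightarrow> nat \<Rightarrow> (nat \<Rightarrow> nat) \<Rightarrow> int \<times> int \<Rightarrow> (nat + nat, 'k::field) mpoly set" where
  "bihomogeneous n m p d =
    {f \<in> carrier (ringA n m). \<forall>t\<in>Poly_Mapping.keys f. bideg p t = d}"


section \<open>Bigraded modules\<close>

definition bigraded_module ::
    "nat \<Rightarrow> nat \<Rightarrow> (nat \<Rightarrow> nat) \<Rightarrow> ((nat + nat, 'k::field) mpoly, 'b) module
      \<Rightarrow> (int \<times> int \<Rightarrow> 'b set) \<Rightarrow> bool" where
  "bigraded_module n m p M G \<longleftrightarrow>
    Module.module (ringA n m) M \<and>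
    (\<forall>d. subgroup (G d) (add_monoid M)) \<and>
    (\<forall>w\<in>carrier M. \<exists>!c. (\<forall>d. c d \<in> G d) \<and> finite {d. c d \<noteq> \<zero>\<^bsub>M\<^esub>} \<and>
        w = finsum M c {d. c d \<noteq> \<zero>\<^bsub>M\<^esub>}) \<and>
    (\<forall>d e. \<forall>f\<in>bihomogeneous n m p d. \<forall>w\<in>G e. f \<odot>\<^bsub>M\<^esub> w \<in> G (d + e))"

definition finitely_generated :: "'a ring \<Rightarrow> ('a, 'b) module \<Rightarrow> bool" where
  "finitely_generated R W \<longleftrightarrow>
    (\<exists>B. finite B \<and> B \<subseteq> carrier W \<and> LinearCombinations.module.span R W B = carrier W)"

text \<open>\<open>M\<^sub>k = \<Oplus>\<^sub>i M\<^sub>(\<^sub>i\<^sub>,\<^sub>k\<^sub>)\<close>, to be regarded as a module over the subring \<open>ringS n\<close> of \<open>ringA n m\<close>.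
  Its component of degree \<open>i\<close> is \<open>G (i, k)\<close>.\<close>

definition slice ::
    "('a, 'b) module \<Rightarrow> (int \<times> int \<Rightarrow> 'b set) \<Rightarrow> int \<Rightarrow> ('a, 'b) module" where
  "slice M G k =
    M\<lparr>carrier := {finsum M c I | c I. finite I \<and> (\<forall>i\<in>I. c i \<in> G (i, k))}\<rparr>"


section \<open>Krull dimension\<close>

text \<open>In \<^typ>\<open>ereal\<close> the supremum of the empty set is \<open>- \<infinity>\<close>, which is the dimension of the zero
  ring and hence of the zero module.\<close>

definition krull_dim_ring :: "('a, 'c) ring_scheme \<Rightarrow> ereal" where
  "krull_dim_ring R =
    Sup {ereal (real l) | l. \<exists>P. (\<forall>i\<le>l. primeideal (P i) R) \<and> (\<forall>i<l. P i \<subset> P (Suc i))}"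

definition annihilator :: "'a ring \<Rightarrow> ('a, 'b) module \<Rightarrow> 'a set" where
  "annihilator R W = {r \<in> carrier R. \<forall>w\<in>carrier W. r \<odot>\<^bsub>W\<^esub> w = \<zero>\<^bsub>W\<^esub>}"

definition krull_dim :: "'a ring \<Rightarrow> ('a, 'b) module \<Rightarrow> ereal" where
  "krull_dim R W = krull_dim_ring (R Quot annihilator R W)"

definition ldim ::
    "nat \<Rightarrow> ((nat + nat, 'k::field) mpoly, 'b) module \<Rightarrow> (int \<times> int \<Rightarrow> 'b set) \<Rightarrow> ereal" where
  "ldim n M G = Lim at_top (\<lambda>k. krull_dim (ringS n) (slice M G k))"


section \<open>Higher iterated Hilbert coefficients\<close>

text \<open>A graded \<open>S\<close>-module is given by a module \<open>W\<close> over \<open>ringS n\<close> together with its homogeneous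
  components \<open>g k\<close>.  Scalars in \<open>K\<close> act as constant polynomials.\<close>

definition component_space ::
    "(('v, 'k::field) mpoly, 'b) module \<Rightarrow> 'b set \<Rightarrow> ('k, 'b) module" where
  "component_space W U =
    \<lparr>carrier = U, mult = mult W, one = one W, zero = zero W, add = add W,
     smult = (\<lambda>c. smult W (Poly_Mapping.single 0 c))\<rparr>"

text \<open>The sum over all \<open>j \<le> k\<close> has only finitely many nonzero terms when \<open>W\<close> is finitely generated.
  It is restricted to these terms because \<^const>\<open>sum\<close> vanishes on infinite index sets.\<close>

fun iter_hilbert ::
    "(('v, 'k::field) mpoly, 'b) module \<Rightarrow> (int \<Rightarrow> 'b set) \<Rightarrow> nat \<Rightarrow> int \<Rightarrow> nat" where
  "iter_hilbert W g 0 k = vectorspace.dim (class_ring :: 'k ring) (component_space W (g k))"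
| "iter_hilbert W g (Suc i) k =
    (\<Sum>j | j \<le> k \<and> iter_hilbert W g i j \<noteq> 0. iter_hilbert W g i j)"

definition hilbert_poly ::
    "(('v, 'k::field) mpoly, 'b) module \<Rightarrow> (int \<Rightarrow> 'b set) \<Rightarrow> nat \<Rightarrow> rat poly" where
  "hilbert_poly W g i =
    (THE P. \<forall>\<^sub>F k in at_top. of_nat (iter_hilbert W g i k) = poly P (of_int k))"

text \<open>The number \<open>d + i\<close> of coefficients, where \<open>d = dim W\<close>; there are none for the zero module.\<close>

definition num_coeffs ::
    "nat \<Rightarrow> ((nat + nat, 'k::field) mpoly, 'b) module \<Rightarrow> nat \<Rightarrow> nat" where
  "num_coeffs n W i =
    (let d = krull_dim (ringS n) W
     in if d = - \<infinity> then 0 else nat \<lfloor>real_of_ereal d\<rfloor> + i)"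

definition hilbert_coeff ::
    "nat \<Rightarrow> ((nat + nat, 'k::field) mpoly, 'b) module \<Rightarrow> (int \<Rightarrow> 'b set) \<Rightarrow> nat \<Rightarrow> nat \<Rightarrow> int" where
  "hilbert_coeff n W g i =
    (THE e. let N = num_coeffs n W i in
      (\<forall>j\<ge>N. e j = 0) \<and>
      (\<forall>x. poly (hilbert_poly W g i) x =
        (\<Sum>j<N. (- 1) ^ j * of_int (e j) * ((x + of_nat (N - j - 1)) gchoose (N - j - 1)))))"

text \<open>\<^const>\<open>degree\<close> assigns degree 0 to the zero polynomial; here it has degree \<open>-1\<close>.\<close>

definition deg :: "rat poly \<Rightarrow> int" where
  "deg q = (if q = 0 then - 1 else int (degree q))"

end

theory Submission
  imports Defs "HOL-Library.Countable_Set" "HOL-Computational_Algebra.Formal_Power_Series"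
begin

text \<open>Every homogeneous component of \<open>M\<close> has a basis of monomials applied to generators.  Fix
homogeneous generators, order the terms \<open>x\<^sup>\<alpha> y\<^sup>\<beta> g\<^sub>e\<close> compatibly with multiplication, and
call a term standard if it is not the largest term of a relation.  The standard terms of bidegree
\<open>d\<close> form a basis of \<open>M\<^sub>d\<close> (\<open>dim_component\<close>), and the exponents of the standard terms at
one generator are closed under division.  By Dickson's lemma such a set is a finite disjoint union
of cones \<open>u + \<nat>\<^sup>U\<close>, \<open>U\<close> a set of variables (\<open>cone_decomposition\<close>).  As far as dimensions
are concerned, \<open>M\<close> is therefore a finite direct sum of shifted polynomial rings \<open>K[U]\<close>, and
\<open>M\<^sub>k\<close> is a direct sum of shifted polynomial rings in the \<open>r\<close> variables \<open>x\<^sub>i\<close> of \<open>U\<close>, one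
for each monomial \<open>y\<^sup>\<beta>\<close>, \<open>\<beta> \<in> \<nat>\<^sup>Y\<close>, of the right degree in the variables \<open>y\<^sub>j\<close> of \<open>U\<close>,
the shift being an affine function \<open>b = a + p \<cdot> \<beta>\<close> (\<open>iter_hilbert_slice\<close>).

A shift by \<open>b\<close> changes the Hilbert polynomial of \<open>K[x\<^sub>1, \<dots>, x\<^sub>r]\<close> according to
\<open>s\<^sup>b = (1 - (1 - s))\<^sup>b\<close>: its coefficients are the numbers \<open>(b choose l)\<close> up to sign
(\<open>gbinomial_shift_expansion\<close>).  So the coefficients of \<open>M\<^sub>k\<close> are, up to sign, sums of \<open>(a + p \<cdot> \<beta> choose l)\<close>
over all \<open>\<beta> \<in> \<nat>\<^sup>Y\<close> with \<open>|\<beta>| = k - k\<^sub>0\<close>.  Such a sum over a simplex of dimension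
\<open>|Y| - 1\<close> is a polynomial in \<open>k\<close> of degree at most \<open>|Y| - 1 + l \<le> m - 1 + l\<close>
(\<open>is_poly_fun_shifted_simplex_sum\<close>).  Cones with \<open>Y = {}\<close> do not meet \<open>M\<^sub>k\<close> for large \<open>k\<close>.

The coefficients are numbered by the Krull dimension \<open>d\<close> of \<open>M\<^sub>k\<close>, so it remains to see that
\<open>d\<close> is constant for large \<open>k\<close>, finite, and at least \<open>r\<close> for each cone with \<open>Y \<noteq> {}\<close>; then a
cone contributes to the coefficient \<open>e\<^sub>j\<close> only its term with \<open>l = j - (d - r) \<le> j\<close>.  The
annihilator of \<open>M\<^sub>k\<close> increases with \<open>k\<close> once \<open>k\<close> exceeds the degrees of the generators, hence
becomes stationary (\<open>ann_stable\<close>), and it contains no nonzero polynomial in the \<open>x\<close>-variables of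
a cone with \<open>Y \<noteq> {}\<close> (\<open>ann_no_polys_in_cone_variables\<close>).  The link with chains of primes is
the growth of the Hilbert function of \<open>S/I\<close>.  If it is not of order less than \<open>e\<close>, a
homogeneous ideal above \<open>I\<close> that is maximal with this property is prime, and adjoining one variable
to it lowers the growth by at most one; this yields a chain of \<open>e + 1\<close> primes
(\<open>prime_chain_exists\<close>).  Conversely elements picked from the steps of a chain of primes are
algebraically independent, which bounds the length of the chain by the number of variables
(\<open>prime_chain_length\<close>).\<close>

abbreviation lookup :: "('a \<Rightarrow>\<^sub>0 'b::zero) \<Rightarrow> 'a \<Rightarrow> 'b" where
  "lookup \<equiv> Poly_Mapping.lookup"

abbreviation keys :: "('a \<Rightarrow>\<^sub>0 'b::zero) \<Rightarrow> 'a set" where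
  "keys \<equiv> Poly_Mapping.keys"

abbreviation single :: "'a \<Rightarrow> 'b \<Rightarrow> 'a \<Rightarrow>\<^sub>0 'b::zero" where
  "single \<equiv> Poly_Mapping.single"

section \<open>Exponent vectors and Dickson's lemma\<close>

definition expos :: "'v set \<Rightarrow> ('v \<Rightarrow>\<^sub>0 nat) set" where
  "expos V = {t. keys t \<subseteq> V}"

lemma keys_add_nat: "keys (s + t) = keys s \<union> keys (t :: 'v \<Rightarrow>\<^sub>0 nat)"
  by (auto simp: in_keys_iff lookup_add)

lemma expos_add [simp]: "s + t \<in> expos V \<longleftrightarrow> s \<in> expos V \<and> t \<in> expos V"
  by (simp add: expos_def keys_add_nat)

lemma expos_zero [simp]: "0 \<in> expos V"
  by (simp add: expos_def)

lemma expos_single [simp]: "single v n \<in> expos V \<longleftrightarrow> v \<in> V \<or> n = 0"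
  by (simp add: expos_def)

lemma expos_mono: "U \<subseteq> V \<Longrightarrow> expos U \<subseteq> expos V"
  by (auto simp: expos_def)

lemma expos_empty [simp]: "expos {} = {0}"
  by (auto simp: expos_def)

lemma expos_lookup: "t \<in> expos V \<Longrightarrow> v \<notin> V \<Longrightarrow> lookup t v = 0"
  by (auto simp: expos_def in_keys_iff)

lemma le_imp_add:
  fixes s t :: "'v \<Rightarrow>\<^sub>0 nat"
  assumes "\<And>v. lookup s v \<le> lookup t v"
  shows "t = s + (t - s)"
  by (intro poly_mapping_eqI) (simp add: lookup_add lookup_minus le_add_diff_inverse[OF assms])

text \<open>Dickson's lemma, in terms of sequences: a sequence of natural numbers has a monotone subsequence,
and choosing one for each variable in turn makes all exponents increase.\<close>

lemma dickson:
  assumes "finite V" "\<And>i::nat. f i \<in> expos V"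
  obtains r :: "nat \<Rightarrow> nat" where "strict_mono r" "\<And>i j v. i \<le> j \<Longrightarrow> lookup (f (r i)) v \<le> lookup (f (r j)) v"
proof -
  have "\<exists>r::nat \<Rightarrow> nat. strict_mono r \<and> (\<forall>v\<in>W. \<forall>i j. i \<le> j \<longrightarrow> lookup (f (r i)) v \<le> lookup (f (r j)) v)"
    if "finite W" for W
    using that
  proof (induction W)
    case empty
    show ?case by (intro exI[of _ id]) (simp add: strict_mono_def)
  next
    case (insert w W)
    from insert.IH obtain r :: "nat \<Rightarrow> nat" where r: "strict_mono r"
      "\<forall>v\<in>W. \<forall>i j. i \<le> j \<longrightarrow> lookup (f (r i)) v \<le> lookup (f (r j)) v"
      by (elim exE conjE) (rule that)
    obtain q :: "nat \<Rightarrow> nat" where q: "strict_mono q" "monoseq (\<lambda>n. lookup (f (r (q n))) w)"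
      using seq_monosub[of "\<lambda>n. lookup (f (r n)) w"] by blast
    define a where "a n = lookup (f (r (q n))) w" for n
    obtain N where N: "\<And>i j. i \<le> j \<Longrightarrow> a (N + i) \<le> a (N + j)"
    proof (cases "\<forall>m n. m \<le> n \<longrightarrow> a m \<le> a n")
      case True
      then show ?thesis using that[of 0] by simp
    next
      case False
      then have dec: "\<And>m n. m \<le> n \<Longrightarrow> a n \<le> a m"
        using q(2) by (auto simp: monoseq_def a_def)
      obtain N where N: "\<And>n. a N \<le> a n"
        using ex_has_least_nat[of "\<lambda>_. True" 0 a] by blast
      show ?thesis
        using that[of N] N dec by (metis le_add1 order_trans)
    qed
    have sm: "strict_mono (\<lambda>i. r (q (N + i)))"
      using r(1) q(1) by (simp add: strict_mono_def)
    moreover have "\<forall>v\<in>insert w W. \<forall>i j. i \<le> j \<longrightarrow>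
        lookup (f (r (q (N + i)))) v \<le> lookup (f (r (q (N + j)))) v"
    proof (intro ballI allI impI)
      fix v and i j :: nat assume v: "v \<in> insert w W" and ij: "i \<le> j"
      have "q (N + i) \<le> q (N + j)"
        using q(1) ij by (simp add: strict_mono_less_eq)
      then show "lookup (f (r (q (N + i)))) v \<le> lookup (f (r (q (N + j)))) v"
        using v N[OF ij] r(2) by (auto simp: a_def)
    qed
    ultimately show ?case by blast
  qed
  from this[OF assms(1)] obtain r :: "nat \<Rightarrow> nat" where r: "strict_mono r"
    "\<forall>v\<in>V. \<forall>i j. i \<le> j \<longrightarrow> lookup (f (r i)) v \<le> lookup (f (r j)) v"
    by (elim exE conjE) (rule that)
  show ?thesis
  proof (rule that[OF r(1)])
    fix i j :: nat and v assume "i \<le> j"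
    then show "lookup (f (r i)) v \<le> lookup (f (r j)) v"
      using r(2) by (cases "v \<in> V") (auto simp: expos_lookup[OF assms(2)])
  qed
qed

definition downset :: "'v set \<Rightarrow> ('v \<Rightarrow>\<^sub>0 nat) set \<Rightarrow> bool" where
  "downset V D \<longleftrightarrow> D \<subseteq> expos V \<and> (\<forall>s t. s + t \<in> D \<longrightarrow> s \<in> D)"

text \<open>The complement is an increasing chain of sets of monomials closed under multiplication.  If the
chain dropped infinitely often, pick an exponent vector lost at each drop.  By Dickson's lemma an
earlier one would divide a later one, although the set from which the later one is lost no
longer contains the earlier one.\<close>

lemma downset_chain_stable:
  assumes V: "finite V" and down: "\<And>i::nat. downset V (D i)" and dec: "\<And>i. D (Suc i) \<subseteq> D i"
  obtains N where "\<And>i. N \<le> i \<Longrightarrow> D i = D N"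
proof -
  have anti: "D j \<subseteq> D i" if "i \<le> j" for i j
    using that by (induction j) (use dec le_Suc_eq in \<open>auto\<close>)
  have "\<exists>N. \<forall>i\<ge>N. D i = D N"
  proof (rule ccontr)
    assume "\<not> ?thesis"
    then have "\<forall>N. \<exists>i>N. \<exists>t. t \<in> D N - D i"
      using anti by (metis Diff_iff le_neq_implies_less subsetI subset_antisym)
    then obtain g x where g: "\<And>N. g N > N" "\<And>N. x N \<in> D N - D (g N)" by metis
    define h where "h i = (g ^^ i) 0" for i
    have h: "h (Suc i) = g (h i)" for i by (simp add: h_def)
    have "strict_mono h"
      by (simp add: strict_mono_Suc_iff h g(1))
    have "x (h i) \<in> expos V" for i
      using g(2) down by (auto simp: downset_def)
    then obtain r :: "nat \<Rightarrow> nat" where r: "strict_mono r"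
      "\<And>i j v. i \<le> j \<Longrightarrow> lookup (x (h (r i))) v \<le> lookup (x (h (r j))) v"
      using dickson[OF V, of "\<lambda>i. x (h i)"] by blast
    have "x (h (r 1)) = x (h (r 0)) + (x (h (r 1)) - x (h (r 0)))"
      by (rule le_imp_add) (simp add: r(2))
    moreover have "x (h (r 1)) \<in> D (h (Suc (r 0)))"
    proof -
      have "Suc (r 0) \<le> r 1" using r(1) by (simp add: Suc_leI strict_mono_less)
      then have "h (Suc (r 0)) \<le> h (r 1)"
        using \<open>strict_mono h\<close> by (simp add: strict_mono_less_eq)
      then show ?thesis using anti g(2) by blast
    qed
    ultimately have "x (h (r 0)) \<in> D (h (Suc (r 0)))"
      using down unfolding downset_def by metis
    then show False using g(2) by (simp add: h)
  qed
  then show ?thesis using that by blast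
qed

section \<open>Decomposition of down-closed sets into cones\<close>

text \<open>The exponents of the monomials in \<open>x\<^sup>u K[U]\<close>.\<close>

definition cone :: "('v \<Rightarrow>\<^sub>0 nat) \<times> 'v set \<Rightarrow> ('v \<Rightarrow>\<^sub>0 nat) set" where
  "cone c = (+) (fst c) ` expos (snd c)"

lemma expos_insert_split:
  assumes "v \<notin> V" "t \<in> expos (insert v V)"
  obtains s where "s \<in> expos V" "t = s + single v (lookup t v)"
proof (rule that[of "t - single v (lookup t v)"])
  show "t - single v (lookup t v) \<in> expos V"
  proof -
    have "x \<in> V" if "x \<in> keys (t - single v (lookup t v))" for x
    proof -
      have "x \<noteq> v" "x \<in> keys t" using that by (auto simp: in_keys_iff lookup_minus)
      then show ?thesis using assms by (auto simp: expos_def)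
    qed
    then show ?thesis by (auto simp: expos_def)
  qed
  show "t = (t - single v (lookup t v)) + single v (lookup t v)"
    by (intro poly_mapping_eqI) (auto simp: lookup_add lookup_minus lookup_single when_def)
qed

text \<open>The Stanley decomposition of a quotient by a monomial ideal.  Cut the set into slices according to
the exponent of one variable \<open>v\<close>.  The slices decrease, so they are equal from some level \<open>N\<close>
on; a cone of the slice at level \<open>N\<close> then extends in the direction \<open>v\<close>, while the finitely many
lower slices keep their cones.\<close>

lemma cone_decomposition:
  assumes "finite V" "downset V D"
  obtains C where "finite C" "\<And>u U. (u, U) \<in> C \<Longrightarrow> u \<in> expos V \<and> U \<subseteq> V"
    "disjoint_family_on cone C" "D = (\<Union>c\<in>C. cone c)"
proof -
  have "\<exists>C. finite C \<and> (\<forall>(u, U)\<in>C. u \<in> expos V \<and> U \<subseteq> V) \<and> disjoint_family_on cone C \<and> D = (\<Union>c\<in>C. cone c)"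
    using assms
  proof (induction V arbitrary: D)
    case empty
    then have "D = {} \<or> D = {0}" by (auto simp: downset_def)
    then show ?case
    proof
      assume "D = {0}"
      then show ?thesis by (intro exI[of _ "{(0, {})}"]) (auto simp: cone_def disjoint_family_on_def)
    qed (auto intro!: exI[of _ "{}"] simp: disjoint_family_on_def)
  next
    case (insert v V)
    define sl where "sl i = {s \<in> expos V. s + single v i \<in> D}" for i
    have sl: "downset V (sl i)" for i
    proof -
      have "s \<in> sl i" if "s + t \<in> sl i" for s t
      proof -
        have "(s + single v i) + t \<in> D" using that by (simp add: sl_def ac_simps)
        then show ?thesis using insert.prems that unfolding downset_def sl_def by auto
      qed
      then show ?thesis by (auto simp: downset_def sl_def)
    qed
    have "sl (Suc i) \<subseteq> sl i" for i
    proof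
      fix s assume s: "s \<in> sl (Suc i)"
      have "(s + single v i) + single v 1 = s + single v (Suc i)"
        using single_add[of v i 1] by (simp add: ac_simps)
      then have "(s + single v i) + single v 1 \<in> D" using s by (simp add: sl_def)
      then have "s + single v i \<in> D" using insert.prems unfolding downset_def by blast
      then show "s \<in> sl i" using s by (simp add: sl_def)
    qed
    with sl obtain N where N: "\<And>i. N \<le> i \<Longrightarrow> sl i = sl N"
      using downset_chain_stable[OF insert.hyps(1), of sl] by blast
    have "\<forall>i. \<exists>C. finite C \<and> (\<forall>(u, U)\<in>C. u \<in> expos V \<and> U \<subseteq> V) \<and> disjoint_family_on cone C \<and> sl i = (\<Union>c\<in>C. cone c)"
      using insert.IH[OF sl] by blast
    then obtain C where C: "\<And>i. finite (C i)" "\<And>i. \<forall>(u, U)\<in>C i. u \<in> expos V \<and> U \<subseteq> V"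
      "\<And>i. disjoint_family_on cone (C i)" "\<And>i. sl i = (\<Union>c\<in>C i. cone c)" by metis
    \<comment> \<open>Below the level \<open>N\<close> the slices are decomposed one at a time; from \<open>N\<close> on they are all equal.\<close>
    define F where "F i = (\<lambda>(u, U). (u + single v i, if i = N then insert v U else U))" for i
    define E where "E = (\<Union>i\<le>N. F i ` C i)"
    have lk: "lookup t v = i \<or> (i = N \<and> N \<le> lookup t v)" "t - single v (lookup t v) \<in> cone c"
      if tc: "t \<in> cone (F i c)" "c \<in> C i" for t i c
    proof -
      obtain u U where c: "c = (u, U)" by (cases c)
      have uU: "u \<in> expos V" "U \<subseteq> V" using C(2)[of i] tc(2) c by auto
      obtain s where s: "t = u + single v i + s" "s \<in> expos (if i = N then insert v U else U)"
      proof -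
        have "t \<in> (+) (u + single v i) ` expos (if i = N then insert v U else U)"
          using tc(1) by (simp only: cone_def F_def c fst_conv snd_conv split_conv)
        then show ?thesis by (rule imageE) (rule that)
      qed
      have u0: "lookup u v = 0" using uU insert.hyps by (auto intro: expos_lookup)
      have vU: "v \<notin> U" using uU insert.hyps by auto
      show "lookup t v = i \<or> (i = N \<and> N \<le> lookup t v)"
        using s u0 vU by (cases "i = N") (auto simp: lookup_add lookup_single expos_lookup)
      have "s \<in> expos (insert v U)" using s(2) expos_mono[of U "insert v U"] by (auto split: if_splits)
      then obtain s' where s': "s' \<in> expos U" "s = s' + single v (lookup s v)"
        using expos_insert_split[OF vU] by metis
      have "lookup s' v = 0" using s'(1) vU by (rule expos_lookup)
      define j where "j = lookup s v"
      have t: "t = (u + s') + single v (i + j)"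
      proof -
        have "t = (u + single v i) + (s' + single v j)" using s(1) s'(2) j_def by metis
        then show ?thesis by (simp only: single_add ac_simps)
      qed
      have "lookup t v = i + j"
        unfolding t using u0 \<open>lookup s' v = 0\<close> by (simp add: lookup_add)
      then have "t - single v (lookup t v) = u + s'"
        using t by simp
      then show "t - single v (lookup t v) \<in> cone c"
        using s'(1) by (auto simp: cone_def c)
    qed
    have mem: "t - single v (lookup t v) \<in> sl i" if "t \<in> cone (F i c)" "c \<in> C i" for t i c
      using lk(2)[OF that] C(4) that(2) by blast
    have "disjoint_family_on cone E"
    proof (unfold disjoint_family_on_def, intro ballI impI)
      fix x y assume "x \<in> E" "y \<in> E" "x \<noteq> y"
      then obtain i c j d where x: "x = F i c" "c \<in> C i" "i \<le> N" and y: "y = F j d" "d \<in> C j" "j \<le> N"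
        by (auto simp: E_def)
      show "cone x \<inter> cone y = {}"
      proof (rule ccontr)
        assume "\<not> ?thesis"
        then obtain t where t: "t \<in> cone x" "t \<in> cone y" by blast
        have "i = j" using lk(1)[of t i c] lk(1)[of t j d] t x y by auto
        moreover have "c = d"
          using lk(2)[of t i c] lk(2)[of t j d] t x y C(3)[of i] \<open>i = j\<close>
          unfolding disjoint_family_on_def by blast
        ultimately show False using x y \<open>x \<noteq> y\<close> by simp
      qed
    qed
    moreover have "D = (\<Union>c\<in>E. cone c)"
    proof
      show "D \<subseteq> (\<Union>c\<in>E. cone c)"
      proof
        fix t assume t: "t \<in> D"
        then have "t \<in> expos (insert v V)" using insert.prems by (auto simp: downset_def)
        then obtain s where s: "s \<in> expos V" "t = s + single v (lookup t v)"
          using expos_insert_split insert.hyps by metis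
        define i where "i = min (lookup t v) N"
        have "s \<in> sl (lookup t v)" using s t by (simp add: sl_def)
        then have "s \<in> sl i" using N[of "lookup t v"] by (auto simp: i_def min_def)
        then obtain u U where c: "(u, U) \<in> C i" "s \<in> cone (u, U)" using C(4) by auto
        then obtain r where r: "s = u + r" "r \<in> expos U" by (auto simp: cone_def)
        have "t = u + single v i + (r + single v (lookup t v - i))"
        proof -
          define m where "m = lookup t v"
          have "t = u + r + (single v i + single v (m - i))"
            using s(2) r(1) by (simp add: i_def m_def flip: single_add)
          then show ?thesis unfolding m_def by (simp only: ac_simps)
        qed
        moreover have "r + single v (lookup t v - i) \<in> expos (if i = N then insert v U else U)"
          using r(2) expos_mono[of U "insert v U"] by (auto simp: i_def min_def)
        ultimately have "t \<in> cone (F i (u, U))"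
          by (auto simp: cone_def F_def)
        moreover have "F i (u, U) \<in> E" using c(1) by (auto simp: E_def i_def)
        ultimately show "t \<in> (\<Union>c\<in>E. cone c)" by blast
      qed
      show "(\<Union>c\<in>E. cone c) \<subseteq> D"
      proof
        fix t assume "t \<in> (\<Union>c\<in>E. cone c)"
        then obtain i c where c: "c \<in> C i" "i \<le> N" "t \<in> cone (F i c)" by (auto simp: E_def)
        have "t - single v (lookup t v) \<in> sl i" using mem[OF c(3,1)] .
        then have "t - single v (lookup t v) \<in> sl (lookup t v)"
          using lk(1)[OF c(3,1)] N by auto
        then have "t - single v (lookup t v) + single v (lookup t v) \<in> D" by (simp add: sl_def)
        moreover have "t - single v (lookup t v) + single v (lookup t v) = t"
          by (intro poly_mapping_eqI) (auto simp: lookup_add lookup_minus lookup_single when_def)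
        ultimately show "t \<in> D" by simp
      qed
    qed
    moreover have "finite E" using C(1) by (simp add: E_def)
    moreover have "\<forall>(u, U)\<in>E. u \<in> expos (insert v V) \<and> U \<subseteq> insert v V"
    proof (rule ballI)
      fix x assume "x \<in> E"
      then obtain i u U where "(u, U) \<in> C i" "x = F i (u, U)" by (auto simp: E_def)
      moreover from this have "u \<in> expos V \<and> U \<subseteq> V" using C(2)[of i] by auto
      ultimately show "case x of (u, U) \<Rightarrow> u \<in> expos (insert v V) \<and> U \<subseteq> insert v V"
        using expos_mono[OF subset_insertI[of V v]] by (auto simp: F_def)
    qed
    ultimately show ?case by blast
  qed
  then show ?thesis using that by fast
qed

section \<open>Sums over exponent vectors of fixed degree\<close>

definition tdeg :: "('v \<Rightarrow>\<^sub>0 nat) \<Rightarrow> nat" where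
  "tdeg t = (\<Sum>v\<in>keys t. lookup t v)"

lemma tdeg_superset: "finite V \<Longrightarrow> keys t \<subseteq> V \<Longrightarrow> tdeg t = (\<Sum>v\<in>V. lookup t v)"
  unfolding tdeg_def by (rule sum.mono_neutral_left) (auto simp: in_keys_iff)

lemma tdeg_add [simp]: "tdeg (s + t) = tdeg s + tdeg t"
  by (subst (1 2 3) tdeg_superset[of "keys s \<union> keys t"]) (auto simp: keys_add_nat lookup_add sum.distrib)

lemma tdeg_single [simp]: "tdeg (single v n) = n"
  by (simp add: tdeg_def)

lemma tdeg_zero [simp]: "tdeg 0 = 0"
  by (simp add: tdeg_def)

definition expos_deg :: "'v set \<Rightarrow> nat \<Rightarrow> ('v \<Rightarrow>\<^sub>0 nat) set" where
  "expos_deg V k = {t \<in> expos V. tdeg t = k}"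

lemma expos_deg_empty: "expos_deg {} k = (if k = 0 then {0} else {})"
  by (auto simp: expos_deg_def)

lemma expos_deg_insert:
  assumes "v \<notin> V"
  shows "expos_deg (insert v V) k = (\<Union>i\<le>k. (\<lambda>s. s + single v i) ` expos_deg V (k - i))"
proof (intro equalityI subsetI)
  fix t assume t: "t \<in> expos_deg (insert v V) k"
  then obtain s where s: "s \<in> expos V" "t = s + single v (lookup t v)"
    using expos_insert_split[OF assms] by (auto simp: expos_deg_def)
  have "tdeg t = tdeg s + lookup t v" by (subst s(2)) simp
  then show "t \<in> (\<Union>i\<le>k. (\<lambda>s. s + single v i) ` expos_deg V (k - i))"
    using s t by (auto simp: expos_deg_def intro!: bexI[of _ "lookup t v"] image_eqI[of _ _ s])
next
  fix t assume "t \<in> (\<Union>i\<le>k. (\<lambda>s. s + single v i) ` expos_deg V (k - i))"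
  then show "t \<in> expos_deg (insert v V) k"
    using expos_mono[OF subset_insertI[of V v]] by (auto simp: expos_deg_def)
qed

lemma finite_expos_deg: "finite V \<Longrightarrow> finite (expos_deg V k)"
  by (induction V arbitrary: k rule: finite_induct) (auto simp: expos_deg_empty expos_deg_insert)

lemma sum_expos_deg_insert:
  assumes "finite V" "v \<notin> V"
  shows "(\<Sum>t\<in>expos_deg (insert v V) k. f t) = (\<Sum>i\<le>k. \<Sum>s\<in>expos_deg V (k - i). f (s + single v i))"
proof -
  have lk: "lookup (s + single v i) v = i" if "s \<in> expos_deg V j" for s i j
    using that assms by (auto simp: expos_deg_def lookup_add expos_lookup)
  have "(\<Sum>t\<in>expos_deg (insert v V) k. f t) = (\<Sum>i\<le>k. sum f ((\<lambda>s. s + single v i) ` expos_deg V (k - i)))"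
    unfolding expos_deg_insert[OF assms(2)]
    using assms by (intro sum.UNION_disjoint) (auto simp: finite_expos_deg, metis lk)
  also have "\<dots> = (\<Sum>i\<le>k. \<Sum>s\<in>expos_deg V (k - i). f (s + single v i))"
    by (intro sum.cong refl sum.reindex[unfolded comp_def]) (auto simp: inj_on_def)
  finally show ?thesis .
qed

lemma expos_deg_bound: "finite V \<Longrightarrow> card (\<Union>j\<le>a. expos_deg V j) \<le> (a + 1) ^ card V"
proof (induction V arbitrary: a rule: finite_induct)
  case empty
  have "(\<Union>j\<le>a. expos_deg {} j) = {0}" by (auto simp: expos_deg_empty split: if_splits)
  then have "card (\<Union>j\<le>a. expos_deg ({} :: 'a set) j) = card {0 :: 'a \<Rightarrow>\<^sub>0 nat}" by (rule arg_cong)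
  then show ?case by simp
next
  case (insert v V)
  have "(\<Union>j\<le>a. expos_deg (insert v V) j) \<subseteq> (\<lambda>(s, i). s + single v i) ` ((\<Union>j\<le>a. expos_deg V j) \<times> {..a})"
    by (fastforce simp: expos_deg_insert[OF insert.hyps(2)])
  then have "card (\<Union>j\<le>a. expos_deg (insert v V) j) \<le> card ((\<Union>j\<le>a. expos_deg V j) \<times> {..a})"
    using insert.hyps(1) by (intro surj_card_le) (auto simp: finite_expos_deg)
  also have "\<dots> \<le> (a + 1) ^ card V * (a + 1)"
    unfolding card_cartesian_product using insert.IH[of a] by (intro mult_mono) auto
  finally show ?case using insert.hyps by (simp add: mult.commute)
qed

section \<open>Graded pieces of polynomials\<close>

definition polys :: "'v set \<Rightarrow> ('v, 'k::field) mpoly set" where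
  "polys V = {f. keys f \<subseteq> expos V}"

definition polys_le :: "'v set \<Rightarrow> nat \<Rightarrow> ('v, 'k::field) mpoly set" where
  "polys_le V a = {f \<in> polys V. \<forall>t\<in>keys f. tdeg t \<le> a}"

definition homog :: "nat \<Rightarrow> ('v, 'k::field) mpoly \<Rightarrow> bool" where
  "homog c f \<longleftrightarrow> (\<forall>t\<in>keys f. tdeg t = c)"

definition hcomp :: "nat \<Rightarrow> ('v, 'k::field) mpoly \<Rightarrow> ('v, 'k) mpoly" where
  "hcomp c f = Poly_Mapping.mapp (\<lambda>t x. x when tdeg t = c) f"

lemma polys_add: "f \<in> polys V \<Longrightarrow> g \<in> polys V \<Longrightarrow> f + g \<in> polys V"
  using keys_add[of f g] by (auto simp: polys_def)

lemma polys_mult: "f \<in> polys V \<Longrightarrow> g \<in> polys V \<Longrightarrow> f * g \<in> polys V"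
  using keys_mult[of f g] by (fastforce simp: polys_def)

lemma polys_zero [simp]: "0 \<in> polys V" and polys_one [simp]: "1 \<in> polys V"
  by (auto simp: polys_def)

lemma polys_uminus [simp]: "- f \<in> polys V \<longleftrightarrow> f \<in> polys V"
  by (simp add: polys_def)

lemma polys_single [simp]: "t \<in> expos V \<Longrightarrow> single t c \<in> polys V"
  by (simp add: polys_def)

lemma polys_sum: "(\<And>i. i \<in> A \<Longrightarrow> f i \<in> polys V) \<Longrightarrow> sum f A \<in> polys V"
  by (induction A rule: infinite_finite_induct) (auto intro: polys_add)

lemma polys_power: "f \<in> polys V \<Longrightarrow> f ^ n \<in> polys V"
  by (induction n) (auto intro: polys_mult)

lemma polys_leI: "f \<in> polys V \<Longrightarrow> (\<And>t. t \<in> keys f \<Longrightarrow> tdeg t \<le> a) \<Longrightarrow> f \<in> polys_le V a"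
  by (simp add: polys_le_def)

lemma polys_le_polys: "f \<in> polys_le V a \<Longrightarrow> f \<in> polys V"
  by (simp add: polys_le_def)

lemma polys_le_mono: "a \<le> b \<Longrightarrow> polys_le V a \<subseteq> polys_le V b"
  by (fastforce simp: polys_le_def)

lemma polys_le_add: "f \<in> polys_le V a \<Longrightarrow> g \<in> polys_le V a \<Longrightarrow> f + g \<in> polys_le V a"
  using keys_add[of f g] by (auto simp: polys_le_def intro: polys_add)

lemma polys_le_mult: "f \<in> polys_le V a \<Longrightarrow> g \<in> polys_le V b \<Longrightarrow> f * g \<in> polys_le V (a + b)"
  using keys_mult[of f g] by (fastforce simp: polys_le_def intro: polys_mult add_mono)

lemma polys_le_zero [simp]: "0 \<in> polys_le V a" and polys_le_one [simp]: "1 \<in> polys_le V a"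
  by (auto simp: polys_le_def)

lemma polys_le_diff: "f \<in> polys_le V a \<Longrightarrow> g \<in> polys_le V a \<Longrightarrow> f - g \<in> polys_le V a"
  using polys_le_add[of f V a "- g"] by (simp add: polys_le_def)

lemma polys_le_power: "f \<in> polys_le V a \<Longrightarrow> f ^ n \<in> polys_le V (n * a)"
  by (induction n) (auto dest: polys_le_mult)

lemma polys_in_polys_le:
  assumes "f \<in> polys V"
  obtains a where "f \<in> polys_le V a"
proof (rule that[of "\<Sum>t\<in>keys f. tdeg t"])
  show "f \<in> polys_le V (\<Sum>t\<in>keys f. tdeg t)"
    using assms by (auto simp: polys_le_def intro: member_le_sum)
qed

lemma lookup_hcomp: "lookup (hcomp c f) t = (lookup f t when tdeg t = c)"
  by (auto simp: hcomp_def lookup_mapp when_def in_keys_iff)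

lemma hcomp_add: "hcomp c (f + g) = hcomp c f + hcomp c g"
  by (intro poly_mapping_eqI) (simp add: lookup_hcomp lookup_add when_def)

lemma hcomp_zero [simp]: "hcomp c 0 = 0"
  by (intro poly_mapping_eqI) (simp add: lookup_hcomp)

lemma hcomp_sum: "hcomp c (sum f A) = (\<Sum>i\<in>A. hcomp c (f i))"
  by (induction A rule: infinite_finite_induct) (auto simp: hcomp_add)

lemma homog_hcomp: "homog c (hcomp c f)"
  by (auto simp: homog_def in_keys_iff lookup_hcomp)

lemma hcomp_homog: "homog d f \<Longrightarrow> hcomp c f = (if c = d then f else 0)"
  by (intro poly_mapping_eqI) (auto simp: homog_def lookup_hcomp when_def in_keys_iff)

lemma homog_mult: "homog c f \<Longrightarrow> homog d g \<Longrightarrow> homog (c + d) (f * g)"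
  using keys_mult[of f g] by (fastforce simp: homog_def)

lemma hcomp_polys: "f \<in> polys V \<Longrightarrow> hcomp c f \<in> polys V"
  by (auto simp: polys_def in_keys_iff lookup_hcomp subset_iff)

lemma sum_hcomp:
  assumes "f \<in> polys_le V a"
  shows "(\<Sum>c\<le>a. hcomp c f) = f"
proof (rule poly_mapping_eqI)
  fix t
  have "lookup (\<Sum>c\<le>a. hcomp c f) t = (\<Sum>c\<le>a. if c = tdeg t then lookup f t else 0)"
    unfolding lookup_sum by (intro sum.cong) (auto simp: lookup_hcomp)
  also have "\<dots> = lookup f t"
    using assms by (auto simp: polys_le_def in_keys_iff)
  finally show "lookup (\<Sum>c\<le>a. hcomp c f) t = lookup f t" .
qed

lemma polys_UNIV: "f \<in> polys UNIV"
  by (auto simp: polys_def expos_def)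

lemma hcomp_mult: "hcomp c (f * g) = (\<Sum>i\<le>c. hcomp i f * hcomp (c - i) g)"
proof -
  obtain a where a: "f \<in> polys_le UNIV a" using polys_in_polys_le polys_UNIV by blast
  obtain b where b: "g \<in> polys_le UNIV b" using polys_in_polys_le polys_UNIV by blast
  define d where "d = max c (max a b)"
  have fg: "(\<Sum>i\<le>d. hcomp i f) = f" "(\<Sum>i\<le>d. hcomp i g) = g"
  proof -
    have "a \<le> d" "b \<le> d" by (simp_all add: d_def)
    then have "f \<in> polys_le UNIV d" "g \<in> polys_le UNIV d"
      using a b polys_le_mono[of a d UNIV] polys_le_mono[of b d UNIV] by blast+
    then show "(\<Sum>i\<le>d. hcomp i f) = f" "(\<Sum>i\<le>d. hcomp i g) = g" by (simp_all add: sum_hcomp)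
  qed
  have "hcomp c (f * g) = hcomp c ((\<Sum>i\<le>d. hcomp i f) * (\<Sum>j\<le>d. hcomp j g))"
    by (simp only: fg)
  also have "\<dots> = (\<Sum>i\<le>d. \<Sum>j\<le>d. hcomp c (hcomp i f * hcomp j g))"
    by (simp only: sum_product hcomp_sum)
  also have "\<dots> = (\<Sum>i\<le>d. \<Sum>j\<le>d. if c = i + j then hcomp i f * hcomp j g else 0)"
    by (simp only: hcomp_homog[OF homog_mult[OF homog_hcomp homog_hcomp]])
  also have "\<dots> = (\<Sum>i\<le>d. if i \<le> c then hcomp i f * hcomp (c - i) g else 0)"
  proof (intro sum.cong refl)
    fix i
    have "(\<Sum>j\<le>d. if c = i + j then hcomp i f * hcomp j g else 0) =
        (\<Sum>j\<le>d. if j = c - i then (if i \<le> c then hcomp i f * hcomp (c - i) g else 0) else 0)"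
      by (intro sum.cong) auto
    moreover have "c - i \<le> d" by (rule order_trans[of _ c]) (simp_all add: d_def)
    ultimately show "(\<Sum>j\<le>d. if c = i + j then hcomp i f * hcomp j g else 0) =
        (if i \<le> c then hcomp i f * hcomp (c - i) g else 0)"
      by simp
  qed
  also have "\<dots> = (\<Sum>i\<le>c. hcomp i f * hcomp (c - i) g)"
    by (rule sum.mono_neutral_cong_right) (auto simp: d_def)
  finally show ?thesis .
qed

lemma hcomp_mult_homog:
  assumes "homog d g"
  shows "hcomp c (f * g) = (if d \<le> c then hcomp (c - d) f * g else 0)"
proof -
  have "hcomp c (f * g) = (\<Sum>i\<le>c. if i = c - d then (if d \<le> c then hcomp (c - d) f * g else 0) else 0)"
    unfolding hcomp_mult by (intro sum.cong) (auto simp: hcomp_homog[OF assms])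
  then show ?thesis by simp
qed

section \<open>Homogeneous ideals\<close>

text \<open>Ideals of \<open>K[V]\<close> as plain sets, so that sums, products and scalars are those of the type of
polynomials; \<open>pideal_iff_ideal\<close> makes the link with rings that have a carrier.\<close>

definition pideal :: "'v set \<Rightarrow> ('v, 'k::field) mpoly set \<Rightarrow> bool" where
  "pideal V I \<longleftrightarrow> I \<subseteq> polys V \<and> 0 \<in> I \<and> (\<forall>f\<in>I. \<forall>g\<in>I. f + g \<in> I) \<and> (\<forall>f\<in>I. \<forall>g\<in>polys V. g * f \<in> I)"

definition hideal :: "'v set \<Rightarrow> ('v, 'k::field) mpoly set \<Rightarrow> bool" where
  "hideal V I \<longleftrightarrow> pideal V I \<and> (\<forall>f\<in>I. \<forall>c. hcomp c f \<in> I)"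

definition pprime :: "'v set \<Rightarrow> ('v, 'k::field) mpoly set \<Rightarrow> bool" where
  "pprime V P \<longleftrightarrow> pideal V P \<and> 1 \<notin> P \<and>
    (\<forall>f\<in>polys V. \<forall>g\<in>polys V. f * g \<in> P \<longrightarrow> f \<in> P \<or> g \<in> P)"

lemma pidealD:
  assumes "pideal V I"
  shows "f \<in> I \<Longrightarrow> f \<in> polys V" "0 \<in> I" "f \<in> I \<Longrightarrow> g \<in> I \<Longrightarrow> f + g \<in> I"
    "f \<in> I \<Longrightarrow> g \<in> polys V \<Longrightarrow> g * f \<in> I"
  using assms by (auto simp: pideal_def)

lemma pideal_uminus: "pideal V I \<Longrightarrow> f \<in> I \<Longrightarrow> - f \<in> I"
  using pidealD(4)[of V I f "- 1"] by simp

lemma pideal_diff: "pideal V I \<Longrightarrow> f \<in> I \<Longrightarrow> g \<in> I \<Longrightarrow> f - g \<in> I"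
  using pidealD(3)[of V I f "- g"] pideal_uminus by fastforce

lemma pideal_sum: "pideal V I \<Longrightarrow> (\<And>i. i \<in> A \<Longrightarrow> f i \<in> I) \<Longrightarrow> sum f A \<in> I"
  by (induction A rule: infinite_finite_induct) (auto intro: pidealD)

lemma hideal_pideal: "hideal V I \<Longrightarrow> pideal V I"
  by (simp add: hideal_def)

definition adjoin :: "'v set \<Rightarrow> ('v, 'k::field) mpoly set \<Rightarrow> ('v, 'k) mpoly \<Rightarrow> ('v, 'k) mpoly set" where
  "adjoin V I f = {i + g * f | i g. i \<in> I \<and> g \<in> polys V}"

definition colon :: "'v set \<Rightarrow> ('v, 'k::field) mpoly set \<Rightarrow> ('v, 'k) mpoly \<Rightarrow> ('v, 'k) mpoly set" where
  "colon V I f = {g \<in> polys V. g * f \<in> I}"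

lemma adjoin_hideal:
  assumes I: "hideal V I" and f: "f \<in> polys V" "homog d f"
  shows "hideal V (adjoin V I f)"
proof -
  note p = hideal_pideal[OF I]
  have "adjoin V I f \<subseteq> polys V"
    using pidealD(1)[OF p] f by (auto simp: adjoin_def intro!: polys_add polys_mult)
  moreover have "0 \<in> adjoin V I f"
    using pidealD(2)[OF p] by (auto simp: adjoin_def intro!: exI[of _ 0])
  moreover have "x + y \<in> adjoin V I f" if xy: "x \<in> adjoin V I f" "y \<in> adjoin V I f" for x y
  proof -
    obtain i g j h where "x = i + g * f" "y = j + h * f" "i \<in> I" "j \<in> I" "g \<in> polys V" "h \<in> polys V"
      using xy by (auto simp: adjoin_def)
    moreover from this have "x + y = (i + j) + (g + h) * f" by (simp add: algebra_simps)
    ultimately show ?thesis unfolding adjoin_def using pidealD(3)[OF p] polys_add by blast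
  qed
  moreover have "r * x \<in> adjoin V I f" if xr: "x \<in> adjoin V I f" "r \<in> polys V" for x r
  proof -
    obtain i g where "x = i + g * f" "i \<in> I" "g \<in> polys V"
      using xr by (auto simp: adjoin_def)
    moreover from this have "r * x = r * i + (r * g) * f" by (simp add: algebra_simps)
    ultimately show ?thesis unfolding adjoin_def using pidealD(4)[OF p] polys_mult xr(2) by blast
  qed
  moreover have "hcomp c x \<in> adjoin V I f" if x: "x \<in> adjoin V I f" for x c
  proof -
    obtain i g where "x = i + g * f" "i \<in> I" "g \<in> polys V"
      using x by (auto simp: adjoin_def)
    moreover from this have "hcomp c x = hcomp c i + (if d \<le> c then hcomp (c - d) g else 0) * f"
      by (simp add: hcomp_add hcomp_mult_homog[OF f(2)])
    moreover have "(if d \<le> c then hcomp (c - d) g else 0) \<in> polys V"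
      using \<open>g \<in> polys V\<close> by (simp add: hcomp_polys)
    ultimately show ?thesis unfolding adjoin_def using I hideal_def by blast
  qed
  ultimately show ?thesis by (simp add: hideal_def pideal_def)
qed

lemma adjoin_superset: "I \<subseteq> adjoin V I f"
  by (force simp: adjoin_def intro: exI[of _ 0])

lemma adjoin_mem: "0 \<in> I \<Longrightarrow> f \<in> adjoin V I f"
  by (force simp: adjoin_def intro: exI[of _ 1])

lemma colon_hideal:
  assumes I: "hideal V I" and f: "f \<in> polys V" "homog d f"
  shows "hideal V (colon V I f)"
proof -
  note p = hideal_pideal[OF I]
  have "hcomp c g \<in> colon V I f" if g: "g \<in> colon V I f" for g c
  proof -
    have "hcomp (c + d) (g * f) \<in> I" using I g by (auto simp: hideal_def colon_def)
    then show ?thesis using g by (simp add: hcomp_mult_homog[OF f(2)] colon_def hcomp_polys)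
  qed
  then show ?thesis
    using pidealD[OF p] by (auto simp: hideal_def pideal_def colon_def distrib_right mult.assoc polys_add polys_mult)
qed

lemma colon_superset: "pideal V I \<Longrightarrow> f \<in> polys V \<Longrightarrow> I \<subseteq> colon V I f"
  using pidealD(1,4)[of V I] by (auto simp: colon_def mult.commute)

lemma hideal_lowest_component:
  assumes I: "hideal V I" and f: "f \<in> polys V" "f \<notin> I"
  obtains a where "hcomp a f \<notin> I" "\<And>i. i < a \<Longrightarrow> hcomp i f \<in> I"
proof -
  obtain b where "f \<in> polys_le V b" using polys_in_polys_le f(1) by blast
  then have "(\<Sum>c\<le>b. hcomp c f) \<notin> I" using f(2) by (simp add: sum_hcomp)
  then have ex: "\<exists>a. hcomp a f \<notin> I" using pideal_sum[OF hideal_pideal[OF I]] by meson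
  show ?thesis
    using that[of "LEAST a. hcomp a f \<notin> I"] LeastI_ex[OF ex] not_less_Least[of _ "\<lambda>a. hcomp a f \<notin> I"] by blast
qed

text \<open>Given a product in the ideal with neither factor in it, consider the lowest components of the
factors that lie outside the ideal: modulo the ideal their product is a homogeneous component of
the whole product.\<close>

lemma hideal_primeI:
  assumes I: "hideal V I" "1 \<notin> I"
    and prime: "\<And>f g c d. f \<in> polys V \<Longrightarrow> g \<in> polys V \<Longrightarrow> homog c f \<Longrightarrow> homog d g \<Longrightarrow> f * g \<in> I \<Longrightarrow>
      f \<in> I \<or> g \<in> I"
  shows "pprime V I"
proof -
  note p = hideal_pideal[OF I(1)]
  have "f \<in> I \<or> g \<in> I" if fg: "f \<in> polys V" "g \<in> polys V" "f * g \<in> I" for f g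
  proof (rule ccontr)
    assume "\<not> ?thesis"
    then obtain a b where a: "hcomp a f \<notin> I" "\<And>i. i < a \<Longrightarrow> hcomp i f \<in> I"
      and b: "hcomp b g \<notin> I" "\<And>i. i < b \<Longrightarrow> hcomp i g \<in> I"
      using hideal_lowest_component[OF I(1)] fg by metis
    have "(\<Sum>i\<le>a + b. hcomp i f * hcomp (a + b - i) g) \<in> I"
      using I(1) fg(3) unfolding hideal_def by (simp flip: hcomp_mult)
    then have "hcomp a f * hcomp b g + (\<Sum>i\<in>{..a + b} - {a}. hcomp i f * hcomp (a + b - i) g) \<in> I"
      by (subst (asm) sum.remove[of _ a]) auto
    moreover have "(\<Sum>i\<in>{..a + b} - {a}. hcomp i f * hcomp (a + b - i) g) \<in> I"
    proof (rule pideal_sum[OF p])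
      fix i assume "i \<in> {..a + b} - {a}"
      then consider "i < a" | "a + b - i < b" by fastforce
      then show "hcomp i f * hcomp (a + b - i) g \<in> I"
      proof cases
        case 1
        then show ?thesis using pidealD(4)[OF p a(2)] fg hcomp_polys by (metis mult.commute)
      next
        case 2
        then show ?thesis using pidealD(4)[OF p b(2)] fg hcomp_polys by blast
      qed
    qed
    ultimately have "hcomp a f * hcomp b g \<in> I"
      using pideal_diff[OF p] by fastforce
    then show False using prime[OF _ _ homog_hcomp homog_hcomp] a(1) b(1) fg hcomp_polys by blast
  qed
  then show ?thesis using I p by (simp add: pprime_def)
qed

section \<open>Leading exponents\<close>

text \<open>Exponent vectors are compared through the lexicographic order of finitely supported functions on
\<open>\<nat>\<close>.  The entry at \<open>0\<close> stays free: in a module it will hold the index of a generator.\<close>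

definition monomial_key :: "'v set \<Rightarrow> ('v \<Rightarrow>\<^sub>0 nat) \<Rightarrow> (nat \<Rightarrow>\<^sub>0 nat)" where
  "monomial_key V t = (\<Sum>v\<in>V. single (Suc (to_nat_on V v)) (lookup t v))"

lemma monomial_key_add: "monomial_key V (s + t) = monomial_key V s + monomial_key V t"
  by (simp add: monomial_key_def lookup_add single_add sum.distrib)

lemma lookup_monomial_key:
  assumes "finite V" "v \<in> V"
  shows "lookup (monomial_key V t) (Suc (to_nat_on V v)) = lookup t v"
proof -
  have "lookup (monomial_key V t) (Suc (to_nat_on V v)) = (\<Sum>w\<in>V. if w = v then lookup t w else 0)"
    unfolding monomial_key_def lookup_sum
    using assms by (intro sum.cong refl) (auto simp: lookup_single when_def countable_finite)
  then show ?thesis using assms by simp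
qed

lemma lookup_monomial_key_0: "lookup (monomial_key V t) 0 = 0"
  by (simp add: monomial_key_def lookup_sum lookup_single)

lemma inj_on_monomial_key: "finite V \<Longrightarrow> inj_on (monomial_key V) (expos V)"
  by (intro inj_onI poly_mapping_eqI) (metis expos_lookup lookup_monomial_key)

text \<open>Linear combinations of the terms in \<open>T\<close> are given by their coefficient functions, of which only
the values on \<open>T\<close> matter; \<open>\<kappa>\<close> embeds the terms into a linear order.\<close>

definition leading :: "('t \<Rightarrow> 'o::linorder) \<Rightarrow> 't set \<Rightarrow> ('t \<Rightarrow> 'k::field) set \<Rightarrow> 't set" where
  "leading \<kappa> T N = {t \<in> T. \<exists>g\<in>N. g t = 1 \<and> (\<forall>s\<in>T. g s \<noteq> 0 \<longrightarrow> \<kappa> s \<le> \<kappa> t)}"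

text \<open>Gaussian elimination: modulo \<open>N\<close>, every function on \<open>T\<close> is congruent to one that vanishes on the
leading terms.  Together with the next lemma this says that the terms which are not leading form
a basis modulo \<open>N\<close>.\<close>

lemma reduce_leading:
  fixes N :: "('t \<Rightarrow> 'k::field) set" and \<kappa> :: "'t \<Rightarrow> 'o::linorder"
  assumes T: "finite T" "inj_on \<kappa> T" and N: "(\<lambda>_. 0) \<in> N" "\<And>f g c. f \<in> N \<Longrightarrow> g \<in> N \<Longrightarrow> (\<lambda>s. f s + c * g s) \<in> N"
  shows "\<exists>g\<in>N. \<forall>s\<in>leading \<kappa> T N. h s = g s"
proof -
  have "\<exists>g\<in>N. \<forall>s\<in>leading \<kappa> T N. h s = g s"
    if "A \<subseteq> T" "\<And>s t. s \<in> T \<Longrightarrow> t \<in> A \<Longrightarrow> \<kappa> s \<le> \<kappa> t \<Longrightarrow> s \<in> A" "\<forall>s\<in>leading \<kappa> T N - A. h s = 0" for A h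
    using finite_subset[OF that(1) T(1)] that
  proof (induction A arbitrary: h rule: finite_psubset_induct)
    case (psubset A)
    show ?case
    proof (cases "A = {}")
      case True
      then show ?thesis using psubset.prems(3) N(1) by (intro bexI[of _ "\<lambda>_. 0"]) auto
    next
      case False
      define m where "m = Max (\<kappa> ` A)"
      have "m \<in> \<kappa> ` A" using False psubset.hyps by (simp add: m_def)
      then obtain t where t: "t \<in> A" "\<kappa> t = m" by auto
      have max: "\<kappa> s \<le> \<kappa> t" if "s \<in> A" for s
        using that t psubset.hyps by (simp add: m_def)
      have less: "s \<in> A - {t}" if "s \<in> T" "u \<in> A - {t}" "\<kappa> s \<le> \<kappa> u" for s u
      proof -
        have "s \<in> A" using that psubset.prems(2) by auto
        moreover have "s \<noteq> t"
          using that max[of u] T(2) psubset.prems(1) by (metis DiffE antisym inj_onD insertI1 subsetD)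
        ultimately show ?thesis by simp
      qed
      obtain g where g: "g \<in> N" "t \<in> leading \<kappa> T N \<longrightarrow> g t = 1 \<and> (\<forall>s\<in>T. g s \<noteq> 0 \<longrightarrow> \<kappa> s \<le> \<kappa> t)"
        using N(1) by (cases "t \<in> leading \<kappa> T N") (auto simp: leading_def)
      define c where "c = (if t \<in> leading \<kappa> T N then h t else 0)"
      have "\<exists>g'\<in>N. \<forall>s\<in>leading \<kappa> T N. h s + - c * g s = g' s"
      proof (rule psubset.IH)
        show "A - {t} \<subset> A" using t by auto
        show "A - {t} \<subseteq> T" using psubset.prems by auto
        show "\<forall>s\<in>leading \<kappa> T N - (A - {t}). h s + - c * g s = 0"
        proof
          fix s assume s: "s \<in> leading \<kappa> T N - (A - {t})"
          show "h s + - c * g s = 0"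
          proof (cases "s = t")
            case True
            then show ?thesis using s g by (simp add: c_def)
          next
            case False
            then have "s \<notin> A" "h s = 0" using s psubset.prems(3) by auto
            moreover have "s \<in> T" using s by (simp add: leading_def)
            ultimately have "g s = 0 \<or> c = 0" using g t psubset.prems(2) by (metis c_def)
            then show ?thesis using \<open>h s = 0\<close> by auto
          qed
        qed
        show "s \<in> A - {t}" if "s \<in> T" "u \<in> A - {t}" "\<kappa> s \<le> \<kappa> u" for s u
          using that by (rule less)
      qed
      then obtain g' where g': "g' \<in> N" "\<forall>s\<in>leading \<kappa> T N. h s + - c * g s = g' s" by blast
      have "(\<lambda>s. g' s + c * g s) \<in> N" using N(2) g' g by blast
      moreover have "\<forall>s\<in>leading \<kappa> T N. h s = g' s + c * g s"
      proof
        fix s assume "s \<in> leading \<kappa> T N"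
        then have "g' s = h s + - c * g s" using g'(2) by simp
        then show "h s = g' s + c * g s" by simp
      qed
      ultimately show ?thesis by (intro bexI[of _ "\<lambda>s. g' s + c * g s"])
    qed
  qed
  moreover have "leading \<kappa> T N - T = {}" by (auto simp: leading_def)
  ultimately show ?thesis by blast
qed

lemma leading_eq_zero:
  fixes N :: "('t \<Rightarrow> 'k::field) set" and \<kappa> :: "'t \<Rightarrow> 'o::linorder"
  assumes T: "finite T" and N: "(\<lambda>_. 0) \<in> N" "\<And>f g c. f \<in> N \<Longrightarrow> g \<in> N \<Longrightarrow> (\<lambda>s. f s + c * g s) \<in> N"
    and g: "g \<in> N" "\<And>s. s \<in> leading \<kappa> T N \<Longrightarrow> g s = 0"
  shows "\<forall>s\<in>T. g s = 0"
proof (rule ccontr)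
  assume "\<not> ?thesis"
  then have ne: "{s \<in> T. g s \<noteq> 0} \<noteq> {}" (is "?A \<noteq> {}") by auto
  have "Max (\<kappa> ` ?A) \<in> \<kappa> ` ?A" using ne T by (intro Max_in) auto
  then obtain t where t: "t \<in> ?A" "\<kappa> t = Max (\<kappa> ` ?A)" by auto
  have max: "\<kappa> s \<le> \<kappa> t" if "s \<in> ?A" for s
    using that t T by simp
  have "(\<lambda>s. 0 + inverse (g t) * g s) \<in> N" by (rule N(2)[OF N(1) g(1)])
  then have "t \<in> leading \<kappa> T N"
    using t max by (auto simp: leading_def intro!: bexI[of _ "\<lambda>s. 0 + inverse (g t) * g s"])
  then show False using g(2) t by auto
qed

section \<open>Chains of homogeneous ideals\<close>

lemma lookup_single_mult:
  fixes f :: "('v, 'k::field) mpoly"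
  shows "lookup (single s c * f) (s + t) = c * lookup f t"
proof -
  have f: "f = (\<Sum>u\<in>keys f. single u (lookup f u))"
    by (intro poly_mapping_eqI) (simp add: lookup_sum lookup_single when_def in_keys_iff)
  have "lookup (single s c * f) (s + t) = (\<Sum>u\<in>keys f. lookup (single s c * single u (lookup f u)) (s + t))"
    by (subst f, simp only: sum_distrib_left lookup_sum)
  also have "\<dots> = (\<Sum>u\<in>keys f. if u = t then c * lookup f t else 0)"
    by (intro sum.cong refl) (auto simp: mult_single lookup_single when_def)
  also have "\<dots> = c * lookup f t"
    by (simp add: in_keys_iff)
  finally show ?thesis .
qed

lemma lookup_scale: "lookup (single 0 c * f) t = c * lookup (f :: ('v, 'k::field) mpoly) t"
  using lookup_single_mult[of 0 c f t] by simp

lemma keys_single_mult: "keys (single s c * f) \<subseteq> (+) s ` keys (f :: ('v, 'k::field) mpoly)"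
  using keys_mult[of "single s c" f] by (auto split: if_splits)

text \<open>The initial monomials of degree \<open>c\<close> of a homogeneous ideal.\<close>

definition ideal_leads :: "'v set \<Rightarrow> ('v, 'k::field) mpoly set \<Rightarrow> nat \<Rightarrow> ('v \<Rightarrow>\<^sub>0 nat) set" where
  "ideal_leads V I c =
    leading (monomial_key V) (expos_deg V c) (lookup ` {f \<in> I. keys f \<subseteq> expos_deg V c})"

lemma pideal_add_scale:
  assumes "pideal V I" "f \<in> I" "g \<in> I"
  shows "f + single 0 c * g \<in> I"
  using pidealD[OF assms(1)] assms by simp

lemma lookup_image_space:
  fixes V :: "'v set" and I :: "('v, 'k::field) mpoly set" and T
  assumes I: "pideal V I"
  defines "N \<equiv> lookup ` {f \<in> I. keys f \<subseteq> T}"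
  shows "(\<lambda>_. 0) \<in> N" "\<And>f g c. f \<in> N \<Longrightarrow> g \<in> N \<Longrightarrow> (\<lambda>s. f s + c * g s) \<in> N"
proof -
  show "(\<lambda>_. 0) \<in> N"
    using pidealD(2)[OF I] unfolding N_def by (intro image_eqI[of _ _ 0]) auto
  fix f g c assume "f \<in> N" "g \<in> N"
  then obtain x y where xy: "f = lookup x" "g = lookup y" "x \<in> I" "y \<in> I" "keys x \<subseteq> T" "keys y \<subseteq> T"
    by (auto simp: N_def)
  have "keys (x + single 0 c * y) \<subseteq> T"
    using keys_add[of x "single 0 c * y"] keys_single_mult[of 0 c y] xy by auto
  moreover have "x + single 0 c * y \<in> I"
    using pideal_add_scale[OF I] xy by blast
  ultimately show "(\<lambda>s. f s + c * g s) \<in> N"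
    unfolding N_def by (intro image_eqI[of _ _ "x + single 0 c * y"]) (auto simp: xy lookup_add lookup_scale)
qed

text \<open>An element of \<open>J\<close> reduced modulo \<open>I\<close> is still in \<open>J\<close> but has no initial monomial left, hence
it is zero.\<close>

lemma ideal_leads_determine:
  assumes V: "finite V" and I: "hideal V I" and J: "hideal V J" and sub: "I \<subseteq> J"
    and eq: "\<And>c. ideal_leads V J c \<subseteq> ideal_leads V I c"
  shows "I = J"
proof
  show "J \<subseteq> I"
  proof
    fix f assume f: "f \<in> J"
    then have fV: "f \<in> polys V" using pidealD(1)[OF hideal_pideal[OF J]] by blast
    have "hcomp c f \<in> I" for c
    proof -
      define T where "T = expos_deg V c"
      define N where "N I = lookup ` {f \<in> I. keys f \<subseteq> T}" for I :: "('a, 'b) mpoly set"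
      have T: "finite T" "inj_on (monomial_key V) T"
        using finite_expos_deg[OF V] inj_on_monomial_key[OF V]
        by (auto simp: T_def expos_deg_def inj_on_def)
      have NI: "(\<lambda>_. 0) \<in> N I" "\<And>f g c. f \<in> N I \<Longrightarrow> g \<in> N I \<Longrightarrow> (\<lambda>s. f s + c * g s) \<in> N I"
        unfolding N_def using lookup_image_space[OF hideal_pideal[OF I]] by blast+
      have NJ: "(\<lambda>_. 0) \<in> N J" "\<And>f g c. f \<in> N J \<Longrightarrow> g \<in> N J \<Longrightarrow> (\<lambda>s. f s + c * g s) \<in> N J"
        unfolding N_def using lookup_image_space[OF hideal_pideal[OF J]] by blast+
      have "keys (hcomp c f) \<subseteq> T"
        using hcomp_polys[OF fV, of c] homog_hcomp[of c f] by (auto simp: polys_def T_def expos_deg_def homog_def)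
      then have h: "lookup (hcomp c f) \<in> N J" using J f by (auto simp: hideal_def N_def)
      obtain g where g: "g \<in> N I" "\<forall>s\<in>leading (monomial_key V) T (N I). lookup (hcomp c f) s = g s"
        using reduce_leading[OF T NI] by blast
      then obtain x where x: "g = lookup x" "x \<in> I" "keys x \<subseteq> T" by (auto simp: N_def)
      have "g \<in> N J" using x sub by (auto simp: N_def)
      then have z: "(\<lambda>s. lookup (hcomp c f) s + - 1 * g s) \<in> N J" by (rule NJ(2)[OF h])
      have lead: "leading (monomial_key V) T (N J) \<subseteq> leading (monomial_key V) T (N I)"
        using eq[of c] by (simp add: ideal_leads_def N_def T_def)
      have "\<forall>s\<in>T. lookup (hcomp c f) s + - 1 * g s = 0"
        by (rule leading_eq_zero[OF T(1) NJ z, of "monomial_key V"]) (use g(2) lead in auto)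
      then have T0: "lookup (hcomp c f) s = lookup x s" if "s \<in> T" for s
        using that x(1) by auto
      have "hcomp c f = x"
      proof (rule poly_mapping_eqI)
        fix s
        show "lookup (hcomp c f) s = lookup x s"
          using T0[of s] \<open>keys (hcomp c f) \<subseteq> T\<close> x(3) by (cases "s \<in> T") (simp, metis in_keys_iff subsetD)
      qed
      then show ?thesis using x by simp
    qed
    moreover obtain a where "f \<in> polys_le V a" using polys_in_polys_le fV by blast
    ultimately show "f \<in> I"
      using sum_hcomp pideal_sum[OF hideal_pideal[OF I]] by metis
  qed
qed (rule sub)

lemma ideal_leads_mono: "I \<subseteq> J \<Longrightarrow> ideal_leads V I c \<subseteq> ideal_leads V J c"
  unfolding ideal_leads_def leading_def by blast

lemma ideal_leads_add:
  assumes V: "finite V" and I: "pideal V I" and s: "s \<in> ideal_leads V I c" and t: "t \<in> expos V"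
  shows "s + t \<in> ideal_leads V I (c + tdeg t)"
proof -
  obtain f where f: "f \<in> I" "keys f \<subseteq> expos_deg V c" "lookup f s = 1" "s \<in> expos_deg V c"
    "\<And>u. u \<in> expos_deg V c \<Longrightarrow> lookup f u \<noteq> 0 \<Longrightarrow> monomial_key V u \<le> monomial_key V s"
    using s by (auto simp: ideal_leads_def leading_def)
  define g where "g = single t 1 * f"
  have k: "keys g \<subseteq> (+) t ` keys f" unfolding g_def by (rule keys_single_mult)
  have "g \<in> I" unfolding g_def using t f(1) pidealD(4)[OF I] by simp
  moreover have "keys g \<subseteq> expos_deg V (c + tdeg t)"
    using k f(2) t by (fastforce simp: expos_deg_def)
  moreover have "lookup g (s + t) = 1"
    using lookup_single_mult[of t 1 f s] f(3) by (simp add: g_def add.commute)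
  moreover have "monomial_key V u \<le> monomial_key V (s + t)" if gu: "lookup g u \<noteq> 0" for u
  proof -
    obtain w where w: "w \<in> keys f" "u = t + w" using k gu unfolding in_keys_iff[symmetric] by blast
    then have "monomial_key V w \<le> monomial_key V s" using f(2,5) by (auto simp: in_keys_iff)
    then show ?thesis unfolding w(2) monomial_key_add add.commute[of "monomial_key V s"] by (rule add_left_mono)
  qed
  moreover have "s + t \<in> expos_deg V (c + tdeg t)" using f(4) t by (simp add: expos_deg_def)
  ultimately show ?thesis unfolding ideal_leads_def leading_def by blast
qed

text \<open>Hilbert's basis theorem for homogeneous ideals, as an ascending chain condition: the initial
monomials of the members of a chain become stationary by Dickson's lemma, and they determine the
ideals within the chain.\<close>

lemma hideal_chain_stable:
  assumes V: "finite V" and I: "\<And>i::nat. hideal V (I i)" and inc: "\<And>i. I i \<subseteq> I (Suc i)"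
  obtains N where "\<And>i. N \<le> i \<Longrightarrow> I i = I N"
proof -
  (* the monomials that are not initial, a set closed under division *)
  define D where "D i = {t \<in> expos V. t \<notin> ideal_leads V (I i) (tdeg t)}" for i
  have "downset V (D i)" for i
    unfolding downset_def D_def using ideal_leads_add[OF V hideal_pideal[OF I]] by auto
  moreover have "D (Suc i) \<subseteq> D i" for i
    unfolding D_def using ideal_leads_mono[OF inc] by auto
  ultimately obtain N where N: "\<And>i. N \<le> i \<Longrightarrow> D i = D N"
    using downset_chain_stable[OF V, of D] by blast
  have mono: "I i \<subseteq> I j" if "i \<le> j" for i j
    using that by (induction j) (use inc le_Suc_eq in \<open>auto\<close>)
  have "I N = I i" if i: "N \<le> i" for i
  proof (rule ideal_leads_determine[OF V I I mono[OF i]])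
    show "ideal_leads V (I i) c \<subseteq> ideal_leads V (I N) c" for c
    proof
      fix t assume t: "t \<in> ideal_leads V (I i) c"
      then have "t \<in> expos V" "tdeg t = c" by (auto simp: ideal_leads_def leading_def expos_deg_def)
      moreover have "t \<notin> D N" using t N[OF i] \<open>tdeg t = c\<close> by (auto simp: D_def)
      ultimately show "t \<in> ideal_leads V (I N) c" by (auto simp: D_def)
    qed
  qed
  then show ?thesis using that by metis
qed

lemma hideal_maximal:
  assumes V: "finite V" and S: "I \<in> \<S>" "\<And>J. J \<in> \<S> \<Longrightarrow> hideal V J"
  shows "\<exists>J\<in>\<S>. \<forall>J'\<in>\<S>. J \<subseteq> J' \<longrightarrow> J' = J"
proof (rule ccontr)
  assume "\<not> ?thesis"
  then have "\<forall>J\<in>\<S>. \<exists>J'\<in>\<S>. J \<subset> J'" by blast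
  then obtain F where F: "\<And>J. J \<in> \<S> \<Longrightarrow> F J \<in> \<S> \<and> J \<subset> F J" by metis
  have mem: "(F ^^ i) I \<in> \<S>" for i by (induction i) (use S(1) F in auto)
  have "(F ^^ i) I \<subset> (F ^^ Suc i) I" for i using F[OF mem[of i]] by simp
  then show False
    using hideal_chain_stable[OF V S(2)[OF mem]] by (metis le_SucI order_refl psubset_imp_subset psubsetE)
qed

section \<open>Growth of homogeneous coordinate rings\<close>

interpretation pm: vector_space "\<lambda>c (f :: ('v, 'k::field) mpoly). single 0 c * f"
  by unfold_locales (simp_all add: distrib_left distrib_right single_add mult_single flip: mult.assoc)

text \<open>\<open>growth_less V e I\<close> expresses \<open>dim K[V]/I < e\<close> through the Hilbert function: in degrees up to
\<open>a\<close> the quotient is spanned by \<open>O(a\<^sup>e\<^sup>-\<^sup>1)\<close> elements, and it is zero for \<open>e = 0\<close>.  Counting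
spanning sets avoids bases and exact sequences, since only upper bounds have to be combined.\<close>

fun growth_less :: "'v set \<Rightarrow> nat \<Rightarrow> ('v, 'k::field) mpoly set \<Rightarrow> bool" where
  "growth_less V 0 I \<longleftrightarrow> 1 \<in> I"
| "growth_less V (Suc e) I \<longleftrightarrow> (\<exists>C. \<forall>a. \<exists>B. finite B \<and> card B \<le> C * (a + 1) ^ e \<and> B \<subseteq> polys_le V a \<and>
    (\<forall>f\<in>polys_le V a. \<exists>h\<in>pm.span B. f - h \<in> I))"

lemma span_polys_le:
  assumes "B \<subseteq> polys_le V a" "h \<in> pm.span B"
  shows "h \<in> polys_le V a"
  using assms(2)
proof (induction rule: pm.span_induct_alt)
  case base
  show ?case by simp
next
  case (step c x y)
  have "single 0 c * x \<in> polys_le V (0 + a)"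
    using step(1) assms(1) by (intro polys_le_mult) (auto simp: polys_le_def)
  then show ?case using step by (auto intro: polys_le_add)
qed

lemma span_mult:
  assumes "h \<in> pm.span B"
  shows "h * x \<in> pm.span ((\<lambda>b. b * x) ` B)"
  using assms
proof (induction rule: pm.span_induct_alt)
  case base
  show ?case by (simp add: pm.span_zero)
next
  case (step c b y)
  have "single 0 c * (b * x) + y * x \<in> pm.span ((\<lambda>b. b * x) ` B)"
    using pm.span_add[OF pm.span_scale[OF pm.span_base] step(2)] step(1) by blast
  then show ?case by (simp add: distrib_right mult.assoc)
qed

lemma growth_less_mono: "I \<subseteq> J \<Longrightarrow> growth_less V e I \<Longrightarrow> growth_less V e J"
  by (cases e) (auto, meson subsetD)

text \<open>Homogeneity allows the cofactor of \<open>f\<close> to be truncated, which bounds its degree.\<close>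

lemma adjoin_homog:
  assumes I: "hideal V I" and f: "homog c f" "f \<in> polys V" and d: "d \<in> polys_le V a" "d \<in> adjoin V I f"
  shows "\<exists>g\<in>polys V. d - g * f \<in> I \<and> (if c \<le> a then g \<in> polys_le V (a - c) else g = 0)"
proof -
  note p = hideal_pideal[OF I]
  obtain i g where ig: "d = i + g * f" "i \<in> I" "g \<in> polys V" using d(2) by (auto simp: adjoin_def)
  (* the components of g that can contribute to g * f in degrees up to a *)
  define g' where "g' = (\<Sum>b\<in>{b. c \<le> b \<and> b \<le> a}. hcomp (b - c) g)"
  have "d = (\<Sum>b\<le>a. hcomp b d)" using sum_hcomp[OF d(1)] by simp
  also have "\<dots> = (\<Sum>b\<le>a. hcomp b i) + (\<Sum>b\<le>a. if c \<le> b then hcomp (b - c) g * f else 0)"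
    by (simp add: ig(1) hcomp_add hcomp_mult_homog[OF f(1)] sum.distrib)
  also have "(\<Sum>b\<le>a. if c \<le> b then hcomp (b - c) g * f else 0) = g' * f"
    unfolding g'_def sum_distrib_right by (rule sum.mono_neutral_cong_right) auto
  finally have "d - g' * f = (\<Sum>b\<le>a. hcomp b i)" by simp
  moreover have "(\<Sum>b\<le>a. hcomp b i) \<in> I" using I ig(2) by (intro pideal_sum[OF p]) (auto simp: hideal_def)
  ultimately have 1: "d - g' * f \<in> I" by simp
  have "g' \<in> polys V" unfolding g'_def using ig(3) by (intro polys_sum hcomp_polys)
  moreover have "g' \<in> polys_le V (a - c)" if "c \<le> a"
  proof (rule polys_leI[OF \<open>g' \<in> polys V\<close>])
    fix t assume "t \<in> keys g'"
    then have "(\<Sum>b\<in>{b. c \<le> b \<and> b \<le> a}. lookup (hcomp (b - c) g) t) \<noteq> 0"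
      by (simp add: g'_def in_keys_iff lookup_sum)
    then obtain b where "c \<le> b" "b \<le> a" "lookup (hcomp (b - c) g) t \<noteq> 0"
      by (metis (mono_tags, lifting) mem_Collect_eq sum.neutral)
    then have "tdeg t = b - c" by (auto simp: lookup_hcomp)
    then show "tdeg t \<le> a - c" using \<open>b \<le> a\<close> by simp
  qed
  moreover have "g' = 0" if "a < c" proof -
    have e: "{b. c \<le> b \<and> b \<le> a} = {}" using that by auto
    show ?thesis by (simp only: g'_def e sum.empty)
  qed
  ultimately show ?thesis using 1 by (intro bexI[of _ g']) auto
qed

text \<open>The exact sequence \<open>0 \<rightarrow> S/(I : f)(-c) \<rightarrow> S/I \<rightarrow> S/(I + f) \<rightarrow> 0\<close>: products of \<open>f\<close> with a
spanning set of the first term and a spanning set of the last term together span the middle one.\<close>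

lemma growth_less_colon:
  assumes I: "hideal V I" and f: "homog c f" "f \<in> polys V"
    and 1: "growth_less V e (adjoin V I f)" and 2: "growth_less V e (colon V I f)"
  shows "growth_less V e I"
proof (cases e)
  case 0
  have "f \<in> I" using 2 by (simp add: 0 colon_def)
  then have "adjoin V I f \<subseteq> I"
    using pidealD[OF hideal_pideal[OF I]] by (auto simp: adjoin_def)
  then show ?thesis using 0 1 by auto
next
  case (Suc e')
  note p = hideal_pideal[OF I]
  obtain C1 where C1: "\<And>a. \<exists>B. finite B \<and> card B \<le> C1 * (a + 1) ^ e' \<and> B \<subseteq> polys_le V a \<and>
    (\<forall>g\<in>polys_le V a. \<exists>h\<in>pm.span B. g - h \<in> adjoin V I f)" using 1 unfolding Suc by auto
  obtain C2 where C2: "\<And>a. \<exists>B. finite B \<and> card B \<le> C2 * (a + 1) ^ e' \<and> B \<subseteq> polys_le V a \<and>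
    (\<forall>g\<in>polys_le V a. \<exists>h\<in>pm.span B. g - h \<in> colon V I f)" using 2 unfolding Suc by auto
  have "\<exists>B. finite B \<and> card B \<le> (C1 + C2) * (a + 1) ^ e' \<and> B \<subseteq> polys_le V a \<and>
    (\<forall>g\<in>polys_le V a. \<exists>h\<in>pm.span B. g - h \<in> I)" for a
  proof -
    obtain B1 where B1: "finite B1" "card B1 \<le> C1 * (a + 1) ^ e'" "B1 \<subseteq> polys_le V a"
      "\<And>g. g \<in> polys_le V a \<Longrightarrow> \<exists>h\<in>pm.span B1. g - h \<in> adjoin V I f" using C1[of a] by blast
    obtain B2 where B2: "finite B2" "card B2 \<le> C2 * (a - c + 1) ^ e'" "B2 \<subseteq> polys_le V (a - c)"
      "\<And>g. g \<in> polys_le V (a - c) \<Longrightarrow> \<exists>h\<in>pm.span B2. g - h \<in> colon V I f" using C2[of "a - c"] by blast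
    define B where "B = B1 \<union> (if c \<le> a then (\<lambda>b. b * f) ` B2 else {})"
    have "f \<in> polys_le V c" using f by (auto simp: polys_le_def homog_def)
    then have "b * f \<in> polys_le V a" if "b \<in> B2" "c \<le> a" for b
      using polys_le_mult[of b V "a - c" f c] that B2(3) by auto
    then have sub: "B \<subseteq> polys_le V a" using B1(3) by (auto simp: B_def)
    have "card B \<le> card B1 + card B2"
      unfolding B_def using card_Un_le[of B1 "(\<lambda>b. b * f) ` B2"] card_image_le[OF B2(1), of "\<lambda>b. b * f"] by auto
    also have "\<dots> \<le> C1 * (a + 1) ^ e' + C2 * (a + 1) ^ e'"
      by (intro add_mono B1(2) order_trans[OF B2(2)] mult_left_mono power_mono) auto
    finally have card: "card B \<le> (C1 + C2) * (a + 1) ^ e'" by (simp add: distrib_right)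
    have "\<exists>h\<in>pm.span B. g - h \<in> I" if g: "g \<in> polys_le V a" for g
    proof -
      obtain h where h: "h \<in> pm.span B1" "g - h \<in> adjoin V I f" using B1(4)[OF g] by blast
      have hB: "h \<in> pm.span B" using h(1) pm.span_mono[of B1 B] by (auto simp: B_def)
      have "g - h \<in> polys_le V a" using g span_polys_le[OF B1(3) h(1)] by (intro polys_le_diff)
      then obtain q where q: "q \<in> polys V" "g - h - q * f \<in> I" "if c \<le> a then q \<in> polys_le V (a - c) else q = 0"
        using adjoin_homog[OF I f _ h(2)] by blast
      show ?thesis
      proof (cases "c \<le> a")
        case True
        have "q \<in> polys_le V (a - c)" using q(3) True by simp
        then obtain k where k: "k \<in> pm.span B2" "q - k \<in> colon V I f" using B2(4) by blast
        have "k * f \<in> pm.span B"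
          using span_mult[OF k(1), of f] pm.span_mono[of "(\<lambda>b. b * f) ` B2" B] True by (auto simp: B_def)
        then have "h + k * f \<in> pm.span B" using hB by (intro pm.span_add)
        moreover have "g - (h + k * f) = (g - h - q * f) + (q - k) * f" by (simp add: algebra_simps)
        moreover have "(q - k) * f \<in> I" using k(2) by (simp add: colon_def)
        ultimately show ?thesis using pidealD(3)[OF p q(2)] by metis
      next
        case False
        then show ?thesis using q(2,3) hB by auto
      qed
    qed
    then show ?thesis using sub card B1(1) B2(1) by (intro exI[of _ B]) (auto simp: B_def)
  qed
  then show ?thesis unfolding Suc by auto
qed

text \<open>If \<open>B\<^sub>a\<close> spans \<open>S/(I + x)\<close> up to degree \<open>a\<close>, then the elements \<open>x\<^sup>i b\<close> with
\<open>b \<in> B\<^sub>a\<^sub>-\<^sub>i\<close> span \<open>S/I\<close>.  There are \<open>a + 1\<close> values of \<open>i\<close>, so the order of growth rises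
by at most one.\<close>

lemma growth_less_adjoin_var:
  assumes I: "hideal V I" and v: "v \<in> V" and 1: "growth_less V e (adjoin V I (single (single v 1) 1))"
  shows "growth_less V (Suc e) I"
proof -
  define x where "x = (single (single v 1) 1 :: ('a, 'b) mpoly)"
  note p = hideal_pideal[OF I]
  have x: "homog 1 x" "x \<in> polys V" using v by (auto simp: x_def homog_def)
  then have x1: "x \<in> polys_le V 1" by (auto simp: polys_le_def homog_def)
  (* for e = 0 the quotient by the larger ideal is zero, which the empty set spans *)
  obtain C where C: "\<And>a. \<exists>B. finite B \<and> card B \<le> C * (a + 1) ^ (e - 1) \<and> (e = 0 \<longrightarrow> B = {}) \<and> B \<subseteq> polys_le V a \<and>
    (\<forall>g\<in>polys_le V a. \<exists>h\<in>pm.span B. g - h \<in> adjoin V I x)"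
  proof (cases e)
    case 0
    have "g \<in> adjoin V I x" if "g \<in> polys V" for g
      using 1 that pidealD(4)[OF hideal_pideal[OF adjoin_hideal[OF I x(2,1)]], of 1 g] by (simp add: 0 x_def)
    then show ?thesis using 0 by (intro that[of 0]) (auto intro!: exI[of _ "{}"] simp: polys_le_def)
  next
    case (Suc e')
    then show ?thesis using 1 that by (auto simp: x_def)
  qed
  have "\<exists>B. finite B \<and> card B \<le> C * (a + 1) ^ e \<and> B \<subseteq> polys_le V a \<and>
    (\<forall>g\<in>polys_le V a. \<exists>h\<in>pm.span B. g - h \<in> I)" for a
  proof (induction a)
    case 0
    obtain B where B: "finite B" "card B \<le> C * (0 + 1) ^ (e - 1)" "B \<subseteq> polys_le V 0"
      "\<And>g. g \<in> polys_le V 0 \<Longrightarrow> \<exists>h\<in>pm.span B. g - h \<in> adjoin V I x" using C[of 0] by blast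
    have "\<exists>h\<in>pm.span B. g - h \<in> I" if g: "g \<in> polys_le V 0" for g
    proof -
      obtain h where h: "h \<in> pm.span B" "g - h \<in> adjoin V I x" using B(4)[OF g] by blast
      have "g - h \<in> polys_le V 0" using g span_polys_le[OF B(3) h(1)] by (intro polys_le_diff)
      then have "g - h \<in> I" using adjoin_homog[OF I x _ h(2), of 0] by auto
      then show ?thesis using h by blast
    qed
    then show ?case using B by (intro exI[of _ B]) auto
  next
    case (Suc a)
    then obtain A where A: "finite A" "card A \<le> C * (a + 1) ^ e" "A \<subseteq> polys_le V a"
      "\<And>g. g \<in> polys_le V a \<Longrightarrow> \<exists>h\<in>pm.span A. g - h \<in> I" by blast
    obtain B where B: "finite B" "card B \<le> C * (Suc a + 1) ^ (e - 1)" "e = 0 \<longrightarrow> B = {}" "B \<subseteq> polys_le V (Suc a)"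
      "\<And>g. g \<in> polys_le V (Suc a) \<Longrightarrow> \<exists>h\<in>pm.span B. g - h \<in> adjoin V I x" using C[of "Suc a"] by blast
    define E where "E = B \<union> (\<lambda>b. b * x) ` A"
    have "card E \<le> card B + card A"
      unfolding E_def using card_Un_le[of B "(\<lambda>b. b * x) ` A"] card_image_le[OF A(1), of "\<lambda>b. b * x"] by auto
    also have "\<dots> \<le> C * (Suc a + 1) ^ e"
    proof (cases e)
      case 0
      then show ?thesis using A(2) B(3) by simp
    next
      case (Suc e')
      have "(a + 1) ^ e' \<le> (Suc a + 1) ^ e'" by (intro power_mono) auto
      then have "card A \<le> C * ((a + 1) * (Suc a + 1) ^ e')"
        using order_trans[OF A(2) [unfolded Suc power_Suc] mult_left_mono[OF mult_left_mono]] by simp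
      then show ?thesis using B(2) by (simp add: Suc algebra_simps)
    qed
    finally have card: "card E \<le> C * (Suc a + 1) ^ e" .
    have sub: "E \<subseteq> polys_le V (Suc a)"
      using A(3) B(4) polys_le_mult[OF _ x1, of _ a] by (auto simp: E_def)
    have "\<exists>h\<in>pm.span E. g - h \<in> I" if g: "g \<in> polys_le V (Suc a)" for g
    proof -
      obtain h where h: "h \<in> pm.span B" "g - h \<in> adjoin V I x" using B(5)[OF g] by blast
      have "g - h \<in> polys_le V (Suc a)" using g span_polys_le[OF B(4) h(1)] by (intro polys_le_diff)
      then obtain q where q: "q \<in> polys V" "g - h - q * x \<in> I" "q \<in> polys_le V a"
        using adjoin_homog[OF I x _ h(2), of "Suc a"] by auto
      obtain k where k: "k \<in> pm.span A" "q - k \<in> I" using A(4)[OF q(3)] by blast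
      have "h + k * x \<in> pm.span E"
        using span_mult[OF k(1), of x] h(1) pm.span_mono[of "(\<lambda>b. b * x) ` A" E] pm.span_mono[of B E]
        by (intro pm.span_add) (auto simp: E_def)
      moreover have "g - (h + k * x) = (g - h - q * x) + x * (q - k)" by (simp add: algebra_simps)
      moreover have "x * (q - k) \<in> I" using k(2) x pidealD(4)[OF p] by blast
      ultimately show ?thesis using pidealD(3)[OF p q(2)] by metis
    qed
    then show ?case using sub card A(1) B(1) by (intro exI[of _ E]) (auto simp: E_def)
  qed
  then show ?thesis by auto
qed

lemma polys_split_const:
  assumes I: "pideal V I" and vars: "\<And>v. v \<in> V \<Longrightarrow> single (single v 1) 1 \<in> I" and f: "f \<in> polys V"
  shows "f - single 0 (lookup f 0) \<in> I"
proof -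
  have mon: "single t c \<in> I" if t: "t \<in> expos V" "t \<noteq> 0" for t c
  proof -
    obtain v where v: "v \<in> keys t" using t(2) by (auto simp: keys_eq_empty[symmetric] simp del: keys_eq_empty)
    then have "t = single v 1 + (t - single v 1)"
      by (intro le_imp_add) (auto simp: lookup_single when_def in_keys_iff)
    then have "single t c = single (t - single v 1) c * single (single v 1) 1" and "t - single v 1 \<in> expos V"
      using t(1) by (auto simp: mult_single add.commute) (metis expos_add)
    then show ?thesis using v t(1) vars pidealD(4)[OF I] by (auto simp: expos_def)
  qed
  have "f - single 0 (lookup f 0) = (\<Sum>t\<in>keys f - {0}. single t (lookup f t))"
    by (intro poly_mapping_eqI) (auto simp: lookup_sum lookup_minus lookup_single when_def in_keys_iff)
  then show ?thesis using mon f by (auto intro!: pideal_sum[OF I] simp: polys_def)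
qed


text \<open>Among the homogeneous ideals above \<open>I\<close> that still have large growth choose a maximal one, \<open>J\<close>.
If \<open>f h \<in> J\<close> with \<open>f\<close> and \<open>h\<close> outside \<open>J\<close>, then \<open>J + f\<close> and \<open>J : f\<close> are strictly larger and
so have small growth, and \<open>growth_less_colon\<close> gives a contradiction; thus \<open>J\<close> is prime.  If
\<open>e > 0\<close>, some variable \<open>x\<close> lies outside \<open>J\<close>, and the chain for \<open>J + x\<close> continues \<open>J\<close>.\<close>

lemma prime_chain_exists:
  assumes V: "finite V" and I: "hideal V I" and g: "\<not> growth_less V e I"
  shows "\<exists>P. (\<forall>i\<le>e. pprime V (P i) \<and> I \<subseteq> P i) \<and> (\<forall>i<e. P i \<subset> P (Suc i))"
proof -
  have step: "\<exists>J. hideal V J \<and> pprime V J \<and> I \<subseteq> J \<and> \<not> growth_less V e J"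
    if I: "hideal V I" and g: "\<not> growth_less V e I" for e I
  proof -
    define S where "S = {J. hideal V J \<and> I \<subseteq> J \<and> \<not> growth_less V e J}"
    have "I \<in> S" using I g by (simp add: S_def)
    moreover have "hideal V J" if "J \<in> S" for J using that by (simp add: S_def)
    ultimately obtain J where J: "J \<in> S" "\<forall>J'\<in>S. J \<subseteq> J' \<longrightarrow> J' = J"
      using hideal_maximal[OF V, of I S] by meson
    have J': "hideal V J" "I \<subseteq> J" "\<not> growth_less V e J" using J(1) by (auto simp: S_def)
    have max: "growth_less V e J'" if "hideal V J'" "J \<subset> J'" for J'
      using J(2) that J'(2) by (auto simp: S_def)
    note p = hideal_pideal[OF J'(1)]
    have "1 \<notin> J"
    proof
      assume "1 \<in> J"
      then have "\<exists>h\<in>pm.span {}. f - h \<in> J" if "f \<in> polys_le V a" for f a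
        using pidealD(4)[OF p, of 1 f] that by (auto simp: polys_le_def)
      then have "growth_less V (Suc n) J" for n
        by (auto intro!: exI[of _ 0] exI[of _ "{}"])
      then show False using J'(3) \<open>1 \<in> J\<close> by (cases e) auto
    qed
    moreover have "f \<in> J \<or> h \<in> J"
      if fh: "f \<in> polys V" "h \<in> polys V" "homog c f" "homog d h" "f * h \<in> J" for f h c d
    proof (rule ccontr)
      assume no: "\<not> ?thesis"
      have "h \<in> colon V J f" using fh by (simp add: colon_def mult.commute)
      then have "growth_less V e (colon V J f)"
        using no colon_superset[OF p fh(1)] by (intro max colon_hideal[OF J'(1) fh(1,3)]) blast
      moreover have "growth_less V e (adjoin V J f)"
        using no adjoin_superset[of J V f] adjoin_mem[OF pidealD(2)[OF p], of f V]
        by (intro max adjoin_hideal[OF J'(1) fh(1,3)]) blast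
      ultimately show False using growth_less_colon[OF J'(1) fh(3,1)] J'(3) by blast
    qed
    ultimately have "pprime V J" by (rule hideal_primeI[OF J'(1)])
    then show ?thesis using J' by blast
  qed
  show ?thesis
    using I g
  proof (induction e arbitrary: I)
    case 0
    obtain J where "pprime V J" "I \<subseteq> J" using step[OF 0] by blast
    then show ?case by (intro exI[of _ "\<lambda>_. J"]) simp
  next
    case (Suc e)
    obtain J where J: "hideal V J" "pprime V J" "I \<subseteq> J" "\<not> growth_less V (Suc e) J"
      using step[OF Suc.prems] by blast
    note p = hideal_pideal[OF J(1)]
    obtain v where v: "v \<in> V" "single (single v 1) 1 \<notin> J"
    proof (rule ccontr)
      note found = that
      assume no: "\<not> thesis"
      have vars: "single (single w 1) 1 \<in> J" if "w \<in> V" for w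
        using no found[of w] that by blast
      have "\<exists>h\<in>pm.span {1}. f - h \<in> J" if "f \<in> polys_le V a" for f a
      proof (intro bexI)
        show "f - single 0 (lookup f 0) \<in> J"
          using polys_split_const[OF p vars polys_le_polys[OF that]] by blast
        have "single 0 (lookup f 0) * 1 \<in> pm.span {1 :: ('a, 'b) mpoly}"
          by (intro pm.span_scale pm.span_base) simp
        then show "single 0 (lookup f 0) \<in> pm.span {1 :: ('a, 'b) mpoly}" by simp
      qed
      then have "growth_less V (Suc e) J"
        by (auto intro!: exI[of _ 1] exI[of _ "{1}"])
      then show False using J(4) by blast
    qed
    define x where "x = (single (single v 1) 1 :: ('a, 'b) mpoly)"
    have x: "x \<in> polys V" "homog 1 x" using v by (auto simp: x_def homog_def)
    have "\<not> growth_less V e (adjoin V J x)"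
      using growth_less_adjoin_var[OF J(1) v(1)] J(4) unfolding x_def by blast
    then obtain P where P: "\<forall>i\<le>e. pprime V (P i) \<and> adjoin V J x \<subseteq> P i" "\<forall>i<e. P i \<subset> P (Suc i)"
      using Suc.IH[OF adjoin_hideal[OF J(1) x]] by blast
    have "J \<subset> adjoin V J x"
      using adjoin_superset[of J V x] adjoin_mem[OF pidealD(2)[OF p], of x V] v(2) by (auto simp: x_def)
    then have "J \<subset> P 0" using P(1) by blast
    then show ?case
      using P J adjoin_superset[of J V x]
      by (intro exI[of _ "\<lambda>i. case i of 0 \<Rightarrow> J | Suc i \<Rightarrow> P i"]) (auto split: nat.split simp: less_Suc_eq_0_disj, blast+)
  qed
qed

section \<open>Algebraically independent elements\<close>

lemma single_sum: "single t (sum f A) = (\<Sum>i\<in>A. single t (f i))"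
  by (induction A rule: infinite_finite_induct) (simp_all add: single_add)

lemma underdetermined_system:
  fixes A :: "'j \<Rightarrow> 'b \<Rightarrow> 'k::field"
  assumes "finite B" "finite J" "card B < card J"
  shows "\<exists>c. (\<exists>j\<in>J. c j \<noteq> 0) \<and> (\<forall>b\<in>B. (\<Sum>j\<in>J. c j * A j b) = 0)"
  using assms
proof (induction B arbitrary: J A rule: finite_induct)
  case empty
  then have "J \<noteq> {}" by auto
  then show ?case by (auto intro!: exI[of _ "\<lambda>_. 1"])
next
  case (insert b B)
  show ?case
  proof (cases "\<forall>j\<in>J. A j b = 0")
    case True
    have "card B < card J" using insert.prems insert.hyps by simp
    from insert.IH[OF insert.prems(1) this, of A] True show ?thesis by auto
  next
    case False
    then obtain p where p: "p \<in> J" "A p b \<noteq> 0" by blast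
    define A' where "A' j x = A j x - A j b / A p b * A p x" for j x
    have "card B < card (J - {p})" using insert.prems insert.hyps p by simp
    then obtain c where c: "\<exists>j\<in>J - {p}. c j \<noteq> 0" "\<forall>x\<in>B. (\<Sum>j\<in>J - {p}. c j * A' j x) = 0"
      using insert.IH[of "J - {p}" A'] insert.prems by auto
    define c' where "c' j = (if j = p then - (\<Sum>j\<in>J - {p}. c j * A j b) / A p b else c j)" for j
    have eq: "(\<Sum>j\<in>J. c' j * A j x) = (\<Sum>j\<in>J - {p}. c j * A' j x)" for x
    proof -
      have "(\<Sum>j\<in>J. c' j * A j x) = c' p * A p x + (\<Sum>j\<in>J - {p}. c' j * A j x)"
        using p insert.prems by (simp add: sum.remove)
      also have "(\<Sum>j\<in>J - {p}. c' j * A j x) = (\<Sum>j\<in>J - {p}. c j * A j x)"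
        by (intro sum.cong) (auto simp: c'_def)
      also have "c' p * A p x = - (\<Sum>j\<in>J - {p}. c j * A j b / A p b * A p x)"
        by (simp add: c'_def sum_distrib_right sum_divide_distrib flip: sum_negf)
      finally show ?thesis
        by (simp add: A'_def algebra_simps sum_subtractf)
    qed
    have "(\<Sum>j\<in>J. c' j * A j b) = 0" unfolding eq using p by (simp add: A'_def)
    moreover have "\<forall>x\<in>B. (\<Sum>j\<in>J. c' j * A j x) = 0" unfolding eq using c by simp
    moreover have "\<exists>j\<in>J. c' j \<noteq> 0" using c(1) by (auto simp: c'_def)
    ultimately show ?thesis by (intro exI[of _ c']) auto
  qed
qed

fun power_product :: "'a::comm_monoid_mult list \<Rightarrow> nat list \<Rightarrow> 'a" where
  "power_product (a # as) (j # js) = a ^ j * power_product as js"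
| "power_product _ _ = 1"

definition exponent_lists :: "nat \<Rightarrow> nat \<Rightarrow> nat list set" where
  "exponent_lists l N = {js. set js \<subseteq> {..N} \<and> length js = l}"

text \<open>Algebraic independence modulo \<open>I\<close>.  Exponents are bounded by \<open>N\<close> separately for each element,
so that the number of monomials is exactly \<open>(N + 1)\<^sup>l\<close>.\<close>

definition alg_indep :: "('v, 'k::field) mpoly set \<Rightarrow> ('v, 'k) mpoly list \<Rightarrow> bool" where
  "alg_indep I as \<longleftrightarrow> (\<forall>N c. (\<Sum>js\<in>exponent_lists (length as) N. single 0 (c js) * power_product as js) \<in> I \<longrightarrow>
    (\<forall>js\<in>exponent_lists (length as) N. c js = 0))"

lemma exponent_lists_0: "exponent_lists 0 N = {[]}"
  by (auto simp: exponent_lists_def)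

lemma exponent_lists_Suc: "exponent_lists (Suc l) N = (\<lambda>(j, js). j # js) ` ({..N} \<times> exponent_lists l N)"
  by (force simp: exponent_lists_def length_Suc_conv)

lemma finite_exponent_lists: "finite (exponent_lists l N)"
  and card_exponent_lists: "card (exponent_lists l N) = (N + 1) ^ l"
  using finite_lists_length_eq[of "{..N}" l] card_lists_length_eq[of "{..N}" l]
  by (simp_all add: exponent_lists_def)

lemma power_product_polys_le:
  assumes "set as \<subseteq> polys_le V d" "js \<in> exponent_lists (length as) N"
  shows "power_product as js \<in> polys_le V (length as * (N * d))"
  using assms
proof (induction as arbitrary: js)
  case Nil
  then show ?case by (simp add: exponent_lists_0)
next
  case (Cons a as)
  then obtain j js' where js: "js = j # js'" "j \<le> N" "js' \<in> exponent_lists (length as) N"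
    by (auto simp: exponent_lists_Suc)
  have "a ^ j \<in> polys_le V (j * d)" using Cons.prems by (intro polys_le_power) auto
  then have "a ^ j \<in> polys_le V (N * d)" using polys_le_mono[of "j * d" "N * d" V] js by auto
  then show ?case using Cons.IH[OF _ js(3)] Cons.prems(1) by (auto simp: js dest: polys_le_mult)
qed

text \<open>With \<open>l\<close> independent elements of degree at most \<open>d\<close> there are \<open>(N + 1)\<^sup>l\<close> linearly independent
products of degree at most \<open>l d N\<close>; for large \<open>N\<close> this exceeds any bound of order \<open>N\<^sup>l\<^sup>-\<^sup>1\<close>.\<close>

lemma alg_indep_growth:
  assumes I: "pideal V I" and as: "set as \<subseteq> polys V" "alg_indep I as"
  shows "\<not> growth_less V (length as) I"
proof
  assume small: "growth_less V (length as) I"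
  show False
  proof (cases "length as")
    case 0
    then have "1 \<in> I" using small by simp
    then show False
      using as(2)[unfolded alg_indep_def, rule_format, of "\<lambda>_. 1" 0 "[]"] 0 by (simp add: exponent_lists_0)
  next
    case (Suc e)
    obtain d where d: "set as \<subseteq> polys_le V d"
    proof -
      have "\<exists>d. set as \<subseteq> polys_le V d" using as(1)
      proof (induction as)
        case (Cons a as)
        then obtain d b where db: "set as \<subseteq> polys_le V d" "a \<in> polys_le V b"
          using polys_in_polys_le by (metis insert_subset list.set(2))
        have "set (a # as) \<subseteq> polys_le V (max d b)"
          using db polys_le_mono[of d "max d b" V] polys_le_mono[of b "max d b" V] by auto
        then show ?case by blast
      qed simp
      then show ?thesis using that by blast
    qed
    define L where "L = Suc e * d"
    obtain C where C: "\<And>a. \<exists>B. finite B \<and> card B \<le> C * (a + 1) ^ e \<and> B \<subseteq> polys_le V a \<and>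
      (\<forall>f\<in>polys_le V a. \<exists>h\<in>pm.span B. f - h \<in> I)" using small unfolding Suc by auto
    have bound: "(N + 1) ^ Suc e \<le> C * (L * N + 1) ^ e" for N
    proof (rule ccontr)
      assume neg: "\<not> ?thesis"
      obtain B where B: "finite B" "card B \<le> C * (L * N + 1) ^ e"
        "\<And>f. f \<in> polys_le V (L * N) \<Longrightarrow> \<exists>h\<in>pm.span B. f - h \<in> I" using C[of "L * N"] by blast
      define J where "J = exponent_lists (Suc e) N"
      have ex: "\<forall>js\<in>J. \<exists>A. power_product as js - (\<Sum>b\<in>B. single 0 (A b) * b) \<in> I"
      proof
        fix js assume "js \<in> J"
        then have "power_product as js \<in> polys_le V (L * N)"
          using power_product_polys_le[OF d, of js N] Suc by (simp add: J_def L_def mult_ac)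
        from B(3)[OF this] show "\<exists>A. power_product as js - (\<Sum>b\<in>B. single 0 (A b) * b) \<in> I"
          unfolding pm.span_finite[OF B(1)] by auto
      qed
      from bchoice[OF this]
      obtain A where A: "\<forall>js\<in>J. power_product as js - (\<Sum>b\<in>B. single 0 (A js b) * b) \<in> I" by blast
      have "card B < card J" using B(2) neg by (simp add: J_def card_exponent_lists)
      then obtain c where c: "\<exists>js\<in>J. c js \<noteq> 0" "\<forall>b\<in>B. (\<Sum>js\<in>J. c js * A js b) = 0"
        using underdetermined_system[OF B(1), of J A] finite_exponent_lists by (auto simp: J_def)
      have "(\<Sum>js\<in>J. single 0 (c js) * (power_product as js - (\<Sum>b\<in>B. single 0 (A js b) * b))) \<in> I"
        using A pidealD(4)[OF I] by (intro pideal_sum[OF I]) auto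
      moreover have "(\<Sum>js\<in>J. single 0 (c js) * (\<Sum>b\<in>B. single 0 (A js b) * b)) = 0"
      proof -
        have "(\<Sum>js\<in>J. single 0 (c js) * (\<Sum>b\<in>B. single 0 (A js b) * b)) =
            (\<Sum>b\<in>B. \<Sum>js\<in>J. single 0 (c js * A js b) * b)"
          unfolding sum_distrib_left by (subst sum.swap) (simp add: mult_single flip: mult.assoc)
        also have "\<dots> = (\<Sum>b\<in>B. single 0 (\<Sum>js\<in>J. c js * A js b) * b)"
          by (intro sum.cong refl) (simp add: single_sum sum_distrib_right)
        finally show ?thesis using c(2) by simp
      qed
      ultimately have "(\<Sum>js\<in>J. single 0 (c js) * power_product as js) \<in> I"
        by (simp add: right_diff_distrib sum_subtractf)
      then show False using as(2) c(1) Suc unfolding alg_indep_def J_def by metis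
    qed
    (* since C (L N + 1)^e <= C (L + 1)^e (N + 1)^e, any N of at least this size
       contradicts the bound *)
    define N where "N = C * (L + 1) ^ e"
    have "(N + 1) ^ Suc e \<le> C * (L * N + 1) ^ e" by (rule bound)
    also have "\<dots> \<le> C * ((L + 1) * (N + 1)) ^ e"
      by (intro mult_left_mono power_mono) auto
    also have "\<dots> = N * (N + 1) ^ e" by (simp only: N_def power_mult_distrib mult.assoc)
    finally show False by simp
  qed
qed

text \<open>Take \<open>a\<^sub>i \<in> P\<^sub>i\<close> outside \<open>P\<^sub>i\<^sub>-\<^sub>1\<close>.  In a relation \<open>\<Sum> a\<^sub>1\<^sup>j G\<^sub>j \<in> P\<^sub>0\<close> with
\<open>G\<^sub>j\<close> polynomials in the remaining elements, the term \<open>G\<^sub>0\<close> lies in \<open>P\<^sub>1\<close>, so its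
coefficients vanish by induction; then \<open>a\<^sub>1\<close> can be cancelled modulo the prime \<open>P\<^sub>0\<close>.\<close>

lemma alg_indep_of_chain:
  assumes "\<And>i. i \<le> l \<Longrightarrow> pprime V (P i)" "\<And>i. i < l \<Longrightarrow> P i \<subset> P (Suc i)"
  shows "\<exists>as. length as = l \<and> set as \<subseteq> polys V \<and> alg_indep (P 0) as"
  using assms
proof (induction l arbitrary: P)
  case 0
  have p: "pideal V (P 0)" "1 \<notin> P 0" using 0 by (auto simp: pprime_def)
  have "c = 0" if "single 0 c \<in> P 0" for c
  proof (rule ccontr)
    assume "c \<noteq> 0"
    then have "single 0 (inverse c) * single 0 c = (1 :: ('a, 'b) mpoly)" by (simp add: mult_single)
    then show False using pidealD(4)[OF p(1) that, of "single 0 (inverse c)"] p(2) by simp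
  qed
  then have "alg_indep (P 0) []" by (auto simp: alg_indep_def exponent_lists_0)
  then show ?case by auto
next
  case (Suc l)
  have "\<exists>as. length as = l \<and> set as \<subseteq> polys V \<and> alg_indep (P (Suc 0)) as"
    using Suc.IH[of "\<lambda>i. P (Suc i)"] Suc.prems by auto
  then obtain as where as: "length as = l" "set as \<subseteq> polys V" "alg_indep (P 1) as" by auto
  have P0: "pprime V (P 0)" "pideal V (P 0)" and P1: "pideal V (P 1)" and sub: "P 0 \<subset> P 1"
    using Suc.prems(1)[of 0] Suc.prems(1)[of 1] Suc.prems(2)[of 0] by (auto simp: pprime_def)
  obtain a where a: "a \<in> P 1" "a \<notin> P 0" using sub by blast
  have aV: "a \<in> polys V" using pidealD(1)[OF P1 a(1)] .
  have indep: "\<forall>j\<le>N. G j = 0"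
    if "\<And>j. j \<le> N \<Longrightarrow> G j \<in> polys V" "\<And>j. j \<le> N \<Longrightarrow> G j \<in> P 1 \<Longrightarrow> G j = 0" "(\<Sum>j\<le>N. a ^ j * G j) \<in> P 0" for N G
    using that
  proof (induction N arbitrary: G)
    case 0
    then show ?case using sub by auto
  next
    case (Suc N)
    define R where "R = (\<Sum>j\<le>N. a ^ j * G (Suc j))"
    have R: "R \<in> polys V" unfolding R_def using Suc.prems(1) aV by (intro polys_sum polys_mult polys_power) auto
    have eq: "(\<Sum>j\<le>Suc N. a ^ j * G j) = G 0 + a * R"
      unfolding R_def by (subst sum.atMost_Suc_shift) (simp add: sum_distrib_left mult.assoc)
    have "a * R \<in> P 1" using pidealD(4)[OF P1 a(1) R] by (simp add: mult.commute)
    moreover have "G 0 + a * R \<in> P 1" using Suc.prems(3) sub eq by auto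
    ultimately have "G 0 \<in> P 1" using pideal_diff[OF P1] by fastforce
    then have G0: "G 0 = 0" using Suc.prems(2) by blast
    then have "a * R \<in> P 0" using Suc.prems(3) eq by simp
    then have "R \<in> P 0" using P0(1) a(2) aV R unfolding pprime_def by blast
    have "\<forall>j\<le>N. G (Suc j) = 0"
    proof (rule Suc.IH)
      show "(\<Sum>j\<le>N. a ^ j * G (Suc j)) \<in> P 0" using \<open>R \<in> P 0\<close> by (simp add: R_def)
      show "G (Suc j) \<in> polys V" if "j \<le> N" for j using Suc.prems(1) that by simp
      show "G (Suc j) = 0" if "j \<le> N" "G (Suc j) \<in> P 1" for j using Suc.prems(2) that by simp
    qed
    then show ?case using G0 by (metis Suc_le_mono not0_implies_Suc)
  qed
  have "alg_indep (P 0) (a # as)"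
    unfolding alg_indep_def
  proof (intro allI impI)
    fix N c assume h: "(\<Sum>js\<in>exponent_lists (length (a # as)) N. single 0 (c js) * power_product (a # as) js) \<in> P 0"
    define G where "G j = (\<Sum>js\<in>exponent_lists l N. single 0 (c (j # js)) * power_product as js)" for j
    have inj: "inj_on (\<lambda>(j, js). j # js) ({..N} \<times> exponent_lists l N)" by (auto simp: inj_on_def)
    have "(\<Sum>js\<in>exponent_lists (length (a # as)) N. single 0 (c js) * power_product (a # as) js) =
        (\<Sum>j\<le>N. \<Sum>js\<in>exponent_lists l N. single 0 (c (j # js)) * (a ^ j * power_product as js))"
      unfolding list.size(4) as(1) add_Suc_right add_0_right exponent_lists_Suc sum.reindex[OF inj] sum.cartesian_product
      by (intro sum.cong) auto
    also have "\<dots> = (\<Sum>j\<le>N. a ^ j * G j)"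
      by (simp add: G_def sum_distrib_left mult_ac)
    finally have s: "(\<Sum>j\<le>N. a ^ j * G j) \<in> P 0" using h by simp
    have pp: "power_product as js \<in> polys V" for js
      using as(2) by (induction as js rule: power_product.induct) (auto intro: polys_mult polys_power)
    have GV: "G j \<in> polys V" for j unfolding G_def using pp by (intro polys_sum polys_mult) auto
    have GP: "\<forall>js\<in>exponent_lists l N. c (j # js) = 0" if "G j \<in> P 1" for j
      using as(3)[unfolded alg_indep_def as(1), rule_format, of "\<lambda>js. c (j # js)" N] that unfolding G_def by blast
    have G0: "G j = 0" if "G j \<in> P 1" for j
      using GP[OF that] by (simp add: G_def)
    have "\<forall>j\<le>N. G j = 0" using indep[OF _ _ s] GV G0 by blast
    then have "\<forall>j\<le>N. \<forall>js\<in>exponent_lists l N. c (j # js) = 0" using GP pidealD(2)[OF P1] by auto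
    then show "\<forall>js\<in>exponent_lists (length (a # as)) N. c js = 0"
      by (auto simp: as(1) exponent_lists_Suc)
  qed
  then show ?case using as aV by (intro exI[of _ "a # as"]) auto
qed

lemma growth_less_zero_ideal:
  assumes "finite V"
  shows "growth_less V (Suc (card V)) {0}"
proof -
  have "\<exists>B. finite B \<and> card B \<le> 1 * (a + 1) ^ card V \<and> B \<subseteq> polys_le V a \<and>
      (\<forall>f\<in>polys_le V a. \<exists>h\<in>pm.span B. f - h \<in> {0 :: ('a, 'b) mpoly})" for a
  proof -
    define T where "T = (\<Union>j\<le>a. expos_deg V j)"
    define B where "B = (\<lambda>t. single t 1 :: ('a, 'b) mpoly) ` T"
    have T: "finite T" using finite_expos_deg[OF assms] by (simp add: T_def)
    have "card B \<le> card T" unfolding B_def by (rule card_image_le[OF T])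
    then have "card B \<le> 1 * (a + 1) ^ card V" using expos_deg_bound[OF assms, of a] by (simp add: T_def)
    moreover have "B \<subseteq> polys_le V a" by (auto simp: B_def T_def expos_deg_def polys_le_def)
    moreover have "f \<in> pm.span B" if f: "f \<in> polys_le V a" for f
    proof -
      have "(\<Sum>t\<in>keys f. single 0 (lookup f t) * single t 1) \<in> pm.span B"
      proof (intro pm.span_sum pm.span_scale pm.span_base)
        fix t assume "t \<in> keys f"
        then have "t \<in> T" using f by (auto simp: T_def expos_deg_def polys_le_def polys_def)
        then show "single t 1 \<in> B" by (simp add: B_def)
      qed
      moreover have "(\<Sum>t\<in>keys f. single 0 (lookup f t) * single t 1) = f"
        by (intro poly_mapping_eqI) (simp add: mult_single lookup_sum lookup_single when_def in_keys_iff)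
      ultimately show ?thesis by simp
    qed
    ultimately show ?thesis using T by (intro exI[of _ B]) (auto simp: B_def)
  qed
  then show ?thesis by (auto intro!: exI[of _ 1])
qed

lemma prime_chain_length:
  assumes V: "finite V" and P: "\<And>i. i \<le> l \<Longrightarrow> pprime V (P i)" "\<And>i. i < l \<Longrightarrow> P i \<subset> P (Suc i)"
  shows "l \<le> card V"
proof (rule ccontr)
  assume "\<not> ?thesis"
  then obtain as where as: "length as = Suc (card V)" "set as \<subseteq> polys V" "alg_indep (P 0) as"
    using alg_indep_of_chain[of "Suc (card V)" V P] P by auto
  have p: "pideal V (P 0)" using P(1)[of 0] by (simp add: pprime_def)
  have "growth_less V (length as) (P 0)"
    using growth_less_mono[OF _ growth_less_zero_ideal[OF V], of "P 0"] pidealD(2)[OF p] as(1) by simp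
  then show False using alg_indep_growth[OF p as(2,3)] by blast
qed

lemma alg_indep_variables:
  assumes U: "finite U" and I: "\<And>f. f \<in> I \<Longrightarrow> keys f \<subseteq> expos U \<Longrightarrow> f = 0"
  shows "\<exists>as. length as = card U \<and> set as \<subseteq> polys U \<and> alg_indep I as"
proof -
  obtain vs where vs: "set vs = U" "distinct vs" using finite_distinct_list[OF U] by blast
  define x where "x v = (single (single v 1) 1 :: ('a, 'b) mpoly)" for v
  define m where "m ws js = (\<Sum>(v, j)\<leftarrow>zip ws js. single v j)" for ws :: "'a list" and js :: "nat list"
  have pw: "x v ^ j = single (single v j) 1" for v j
    by (induction j) (simp_all add: x_def mult_single single_add[symmetric])
  have pp: "power_product (map x ws) js = single (m ws js) 1" for ws js
    by (induction ws js rule: list_induct2') (auto simp: m_def pw mult_single)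
  have lk: "lookup (m ws js) w = 0" if "w \<notin> set ws" for ws js w
    using that by (induction ws js rule: list_induct2') (auto simp: m_def lookup_add lookup_single)
  have inj: "js = ks" if "m ws js = m ws ks" "distinct ws" "length js = length ws" "length ks = length ws" for ws js ks
    using that
  proof (induction ws arbitrary: js ks)
    case (Cons w ws)
    obtain j js' k ks' where jk: "js = j # js'" "ks = k # ks'" using Cons.prems by (metis length_Suc_conv)
    have eq: "single w j + m ws js' = single w k + m ws ks'" using Cons.prems by (simp add: jk m_def)
    then have "lookup (single w j + m ws js') w = lookup (single w k + m ws ks') w" by simp
    then have "j = k" using lk Cons.prems by (simp add: lookup_add)
    then show ?case using eq Cons by (auto simp: jk)
  qed simp
  have "alg_indep I (map x vs)"
    unfolding alg_indep_def
  proof (intro allI impI ballI)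
    fix N c js
    define J where "J = exponent_lists (length (map x vs)) N"
    assume h: "(\<Sum>js\<in>J. single 0 (c js) * power_product (map x vs) js) \<in> I" and js: "js \<in> J"
    have eq: "(\<Sum>js\<in>J. single 0 (c js) * power_product (map x vs) js) = (\<Sum>js\<in>J. single (m vs js) (c js))"
      by (simp add: pp mult_single)
    have mem: "m vs js \<in> expos U" for js
      using lk vs by (auto simp: expos_def in_keys_iff)
    have "keys (\<Sum>js\<in>J. single (m vs js) (c js)) \<subseteq> expos U"
      using keys_sum[of "\<lambda>js. single (m vs js) (c js)" J] mem by (fastforce split: if_splits)
    then have "(\<Sum>js\<in>J. single (m vs js) (c js)) = 0" using I h eq by simp
    then have "0 = lookup (\<Sum>js\<in>J. single (m vs js) (c js)) (m vs js)" by simp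
    also have "\<dots> = (\<Sum>ks\<in>J. if ks = js then c js else 0)"
      unfolding lookup_sum
      using inj vs js by (intro sum.cong refl) (auto simp: lookup_single when_def J_def exponent_lists_def)
    also have "\<dots> = c js" using js finite_exponent_lists by (simp add: J_def)
    finally show "c js = 0" by simp
  qed
  moreover have "length (map x vs) = card U" using vs distinct_card by fastforce
  moreover have "set (map x vs) \<subseteq> polys U" using vs by (auto simp: x_def)
  ultimately show ?thesis by blast
qed

section \<open>Krull dimension of graded quotients\<close>

lemma poly_ring_sel:
  "carrier (poly_ring V) = polys V" "x \<otimes>\<^bsub>poly_ring V\<^esub> y = x * y" "x \<oplus>\<^bsub>poly_ring V\<^esub> y = x + y"
  "\<one>\<^bsub>poly_ring V\<^esub> = 1" "\<zero>\<^bsub>poly_ring V\<^esub> = 0"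
  by (auto simp: poly_ring_def polys_def expos_def)

lemma poly_ring_a_inv: "x \<in> polys V \<Longrightarrow> \<ominus>\<^bsub>poly_ring V\<^esub> x = - (x :: ('v, 'k::field) mpoly)"
proof -
  interpret cring "poly_ring V :: ('v, 'k) mpoly ring" by (rule poly_ring_cring)
  assume "x \<in> polys V"
  then show ?thesis
    by (intro minus_equality) (auto simp: poly_ring_sel)
qed

lemma pideal_iff_ideal: "pideal V I \<longleftrightarrow> ideal I (poly_ring V :: ('v, 'k::field) mpoly ring)"
proof
  interpret R: cring "poly_ring V :: ('v, 'k) mpoly ring" by (rule poly_ring_cring)
  show "ideal I (poly_ring V)" if I: "pideal V I"
  proof (rule idealI)
    show "subgroup I (add_monoid (poly_ring V))"
    proof (rule R.add.subgroupI)
      show "I \<subseteq> carrier (poly_ring V)" "I \<noteq> {}"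
        using pidealD[OF I] by (auto simp: poly_ring_sel)
      show "\<ominus>\<^bsub>poly_ring V\<^esub> a \<in> I" if "a \<in> I" for a
        using pideal_uminus[OF I that] pidealD(1)[OF I that] by (simp add: poly_ring_a_inv)
      show "a \<oplus>\<^bsub>poly_ring V\<^esub> b \<in> I" if "a \<in> I" "b \<in> I" for a b
        using pidealD(3)[OF I that] by (simp add: poly_ring_sel)
    qed
  qed (use pidealD(4)[OF I] R.ring_axioms in \<open>auto simp: poly_ring_sel mult.commute\<close>)
  show "pideal V I" if "ideal I (poly_ring V)"
  proof -
    interpret ideal I "poly_ring V :: ('v, 'k) mpoly ring" by fact
    show ?thesis
      unfolding pideal_def
      using a_subset a_closed I_l_closed zero_closed by (auto simp: poly_ring_sel)
  qed
qed

lemma pprime_iff_primeideal: "pprime V P \<longleftrightarrow> primeideal P (poly_ring V :: ('v, 'k::field) mpoly ring)"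
proof
  show "primeideal P (poly_ring V)" if "pprime V P"
    using that
    by (intro primeidealI poly_ring_cring) (auto simp: pprime_def pideal_iff_ideal poly_ring_sel)
  show "pprime V P" if "primeideal P (poly_ring V)"
  proof -
    interpret primeideal P "poly_ring V :: ('v, 'k) mpoly ring" by fact
    have "1 \<notin> P"
      using I_notcarr one_imp_carrier by (auto simp: poly_ring_sel)
    then show ?thesis
      using I_prime is_ideal by (auto simp: pprime_def pideal_iff_ideal poly_ring_sel)
  qed
qed

lemma krull_dim_ring_quot_ge:
  assumes I: "pideal V I" and P: "\<And>i. i \<le> l \<Longrightarrow> pprime V (P i) \<and> I \<subseteq> P i" "\<And>i. i < l \<Longrightarrow> P i \<subset> P (Suc i)"
  shows "ereal (real l) \<le> krull_dim_ring (poly_ring V Quot I)"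
proof -
  interpret R: cring "poly_ring V :: ('a, 'b) mpoly ring" by (rule poly_ring_cring)
  interpret I: ideal I "poly_ring V :: ('a, 'b) mpoly ring" using I by (simp add: pideal_iff_ideal)
  define Q where "Q i = (+>\<^bsub>poly_ring V\<^esub>) I ` P i" for i
  have Pid: "ideal (P i) (poly_ring V)" if "i \<le> l" for i
    using P(1)[OF that] by (simp add: pprime_def pideal_iff_ideal)
  have un: "\<Union> (Q i) = P i" if "i \<le> l" for i
    using R.ideal_incl_iff[OF I.is_ideal Pid[OF that]] P(1)[OF that] by (auto simp: Q_def)
  have Qid: "ideal (Q i) (poly_ring V Quot I)" if "i \<le> l" for i
    unfolding Q_def using R.ring_ideal_imp_quot_ideal[OF I.is_ideal Pid[OF that]] .
  have mem: "I +>\<^bsub>poly_ring V\<^esub> r \<in> Q i \<longleftrightarrow> r \<in> P i" if "i \<le> l" "r \<in> polys V" for i r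
  proof -
    have "Q i \<subseteq> carrier (poly_ring V Quot I)"
      using Qid[OF that(1)] by (simp add: additive_subgroup.a_subset ideal.axioms(1))
    then show ?thesis
      using R.canonical_proj_vimage_mem_iff[OF I.is_ideal, of "Q i" r] un[OF that(1)] that(2)
      by (simp add: poly_ring_sel)
  qed
  have carr: "\<exists>r\<in>polys V. a = I +>\<^bsub>poly_ring V\<^esub> r" if "a \<in> carrier (poly_ring V Quot I)" for a
    using that by (auto simp: FactRing_def A_RCOSETS_def' poly_ring_sel)
  have "primeideal (Q i) (poly_ring V Quot I)" if i: "i \<le> l" for i
  proof (rule primeidealI[OF Qid[OF i] I.quotient_is_cring[OF R.is_cring]])
    show "carrier (poly_ring V Quot I) \<noteq> Q i"
    proof
      assume "carrier (poly_ring V Quot I) = Q i"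
      moreover have "I +>\<^bsub>poly_ring V\<^esub> 1 \<in> carrier (poly_ring V Quot I)"
        by (auto simp: FactRing_def A_RCOSETS_def' poly_ring_sel)
      ultimately show False using mem[OF i, of 1] P(1)[OF i] by (simp add: pprime_def)
    qed
    fix a b assume a: "a \<in> carrier (poly_ring V Quot I)" and b: "b \<in> carrier (poly_ring V Quot I)"
      and ab: "a \<otimes>\<^bsub>poly_ring V Quot I\<^esub> b \<in> Q i"
    obtain r s where rs: "r \<in> polys V" "a = I +>\<^bsub>poly_ring V\<^esub> r" "s \<in> polys V" "b = I +>\<^bsub>poly_ring V\<^esub> s"
      using carr a b by metis
    have "a \<otimes>\<^bsub>poly_ring V Quot I\<^esub> b = I +>\<^bsub>poly_ring V\<^esub> (r * s)"
      using I.rcoset_mult_add[of r s] rs by (simp add: FactRing_def poly_ring_sel)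
    then have "r * s \<in> P i" using ab mem[OF i, of "r * s"] rs polys_mult by metis
    then have "r \<in> P i \<or> s \<in> P i" using P(1)[OF i] rs by (auto simp: pprime_def)
    then show "a \<in> Q i \<or> b \<in> Q i" using mem[OF i] rs by blast
  qed
  moreover have "Q i \<subset> Q (Suc i)" if "i < l" for i
  proof
    show "Q i \<subseteq> Q (Suc i)" using P(2)[OF that] by (auto simp: Q_def)
    show "Q i \<noteq> Q (Suc i)" using un[of i] un[of "Suc i"] that P(2)[OF that] by auto
  qed
  ultimately show ?thesis unfolding krull_dim_ring_def by (intro Sup_upper) blast
qed

lemma carrier_quotE:
  assumes "a \<in> carrier (R Quot I)"
  obtains r where "r \<in> carrier R" "a = I +>\<^bsub>R\<^esub> r"
  using assms by (auto simp: FactRing_def A_RCOSETS_def')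

lemma zero_quot: "\<zero>\<^bsub>R Quot I\<^esub> = I"
  by (simp add: FactRing_def)

lemma krull_dim_ring_quot_chain:
  assumes I: "pideal V I" and Q: "\<And>i. i \<le> l \<Longrightarrow> primeideal (Q i) (poly_ring V Quot I)" "\<And>i. i < l \<Longrightarrow> Q i \<subset> Q (Suc i)"
  shows "\<exists>P. (\<forall>i\<le>l. pprime V (P i) \<and> I \<subseteq> P i) \<and> (\<forall>i<l. P i \<subset> P (Suc i))"
proof -
  interpret R: cring "poly_ring V :: ('a, 'b) mpoly ring" by (rule poly_ring_cring)
  interpret I: ideal I "poly_ring V :: ('a, 'b) mpoly ring" using I by (simp add: pideal_iff_ideal)
  interpret h: ring_hom_ring "poly_ring V :: ('a, 'b) mpoly ring" "poly_ring V Quot I" "(+>\<^bsub>poly_ring V\<^esub>) I"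
    by (rule I.rcos_ring_hom_ring)
  define P where "P i = {r \<in> carrier (poly_ring V). I +>\<^bsub>poly_ring V\<^esub> r \<in> Q i}" for i
  have sub: "Q i \<subseteq> carrier (poly_ring V Quot I)" if "i \<le> l" for i
    using Q(1)[OF that] by (simp add: additive_subgroup.a_subset ideal.axioms(1) primeideal.axioms(1))
  have "pprime V (P i)" if "i \<le> l" for i
    unfolding P_def pprime_iff_primeideal by (rule h.primeideal_vimage[OF R.is_cring Q(1)[OF that]])
  moreover have "I \<subseteq> P i" if "i \<le> l" for i
  proof
    fix r assume r: "r \<in> I"
    have "\<zero>\<^bsub>poly_ring V Quot I\<^esub> \<in> Q i"
      by (rule additive_subgroup.zero_closed[OF ideal.axioms(1)[OF primeideal.axioms(1)[OF Q(1)[OF that]]]])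
    then have "I \<in> Q i" by (simp only: zero_quot)
    then show "r \<in> P i" using R.a_rcos_zero[OF I.is_ideal r] I.a_Hcarr[OF r] by (simp add: P_def)
  qed
  moreover have "P i \<subset> P (Suc i)" if i: "i < l" for i
  proof
    show "P i \<subseteq> P (Suc i)" using Q(2)[OF i] by (auto simp: P_def)
    obtain a where a: "a \<in> Q (Suc i)" "a \<notin> Q i" using Q(2)[OF i] by blast
    then have "a \<in> carrier (poly_ring V Quot I)" using sub[of "Suc i"] i by auto
    from carrier_quotE[OF this]
    obtain r where "r \<in> carrier (poly_ring V)" "a = I +>\<^bsub>poly_ring V\<^esub> r" .
    then show "P i \<noteq> P (Suc i)" using a by (auto simp: P_def)
  qed
  ultimately show ?thesis by blast
qed

lemma krull_dim_ring_quot_UNIV: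
  assumes I: "pideal V I" and 1: "1 \<in> I"
  shows "krull_dim_ring (poly_ring V Quot I) = - \<infinity>"
proof -
  have "\<not> (\<exists>P. (\<forall>i\<le>l. primeideal (P i) (poly_ring V Quot I)) \<and> (\<forall>i<l. P i \<subset> P (Suc i)))" for l
  proof
    assume "\<exists>P. (\<forall>i\<le>l. primeideal (P i) (poly_ring V Quot I)) \<and> (\<forall>i<l. P i \<subset> P (Suc i))"
    then obtain P where P: "\<forall>i\<le>l. primeideal (P i) (poly_ring V Quot I)" "\<forall>i<l. P i \<subset> P (Suc i)" by blast
    obtain P' where "\<forall>i\<le>l. pprime V (P' i) \<and> I \<subseteq> P' i"
      using krull_dim_ring_quot_chain[OF I, of l P] P by blast
    then show False using 1 by (auto simp: pprime_def)
  qed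
  then have "krull_dim_ring (poly_ring V Quot I) = Sup {}"
    unfolding krull_dim_ring_def by (intro arg_cong[of _ _ Sup]) blast
  then show ?thesis by (simp add: bot_ereal_def)
qed

text \<open>Growth of order at least \<open>e\<close> yields a chain of \<open>e + 1\<close> primes, and no chain of primes is longer
than the number of variables allows.\<close>

lemma krull_dim_ring_graded_quot:
  assumes V: "finite V" and I: "hideal V I" and 1: "1 \<notin> I"
  obtains d where "krull_dim_ring (poly_ring V Quot I) = ereal (real d)"
    "\<And>e. \<not> growth_less V e I \<Longrightarrow> e \<le> d"
proof -
  note p = hideal_pideal[OF I]
  let ?K = "krull_dim_ring (poly_ring V Quot I)"
  have ge: "ereal (real e) \<le> ?K" if "\<not> growth_less V e I" for e
    using prime_chain_exists[OF V I that] krull_dim_ring_quot_ge[OF p] by blast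
  define L where "L = {l :: nat. \<exists>P. (\<forall>i\<le>l. primeideal (P i) (poly_ring V Quot I)) \<and> (\<forall>i<l. P i \<subset> P (Suc i))}"
  have le: "l \<le> card V" if l: "l \<in> L" for l
  proof -
    obtain P where "\<forall>i\<le>l. primeideal (P i) (poly_ring V Quot I)" "\<forall>i<l. P i \<subset> P (Suc i)"
      using l unfolding L_def by blast
    then obtain P' where "\<forall>i\<le>l. pprime V (P' i) \<and> I \<subseteq> P' i" "\<forall>i<l. P' i \<subset> P' (Suc i)"
      using krull_dim_ring_quot_chain[OF p, of l P] by blast
    then show ?thesis using prime_chain_length[OF V, of l P'] by blast
  qed
  have K: "?K = Sup ((\<lambda>l. ereal (real l)) ` L)"
    unfolding krull_dim_ring_def L_def by (intro arg_cong[of _ _ Sup]) blast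
  have "finite L" using le by (meson atMost_iff finite_atMost finite_subset subsetI)
  have "L \<noteq> {}"
  proof
    assume "L = {}"
    then have "?K = - \<infinity>" unfolding K by (simp add: bot_ereal_def)
    moreover have "ereal (real 0) \<le> ?K" using 1 by (intro ge) simp
    ultimately show False by simp
  qed
  define d where "d = Max L"
  have "?K = ereal (real d)"
    unfolding K
  proof (rule antisym)
    show "Sup ((\<lambda>l. ereal (real l)) ` L) \<le> ereal (real d)"
      using \<open>finite L\<close> by (intro Sup_least) (auto simp: d_def)
    show "ereal (real d) \<le> Sup ((\<lambda>l. ereal (real l)) ` L)"
      using \<open>finite L\<close> \<open>L \<noteq> {}\<close> by (intro Sup_upper imageI) (simp add: d_def)
  qed
  then show ?thesis using that[of d] ge by simp
qed

section \<open>Binomial expansions\<close>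

text \<open>The Hilbert function of a polynomial ring in \<open>R\<close> variables of degree one.\<close>

definition free_hilbert :: "nat \<Rightarrow> int \<Rightarrow> nat" where
  "free_hilbert R b = (if b < 0 then 0 else if R = 0 then (if b = 0 then 1 else 0) else (nat b + R - 1) choose (R - 1))"

lemma free_hilbert_neg [simp]: "b < 0 \<Longrightarrow> free_hilbert R b = 0"
  by (simp add: free_hilbert_def)

lemma sum_free_hilbert_nat: "(\<Sum>i\<le>n. free_hilbert R (int i)) = free_hilbert (Suc R) (int n)"
proof (induction n)
  case 0
  then show ?case by (simp add: free_hilbert_def)
next
  case (Suc n)
  show ?case
  proof (cases R)
    case 0
    then show ?thesis using Suc by (simp add: free_hilbert_def)
  next
    case (Suc r)
    have "(\<Sum>i\<le>Suc n. free_hilbert R (int i)) = free_hilbert (Suc R) (int n) + free_hilbert R (int (Suc n))"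
      using Suc.IH by simp
    also have "\<dots> = (n + Suc r choose Suc r) + (Suc n + r choose r)"
      unfolding free_hilbert_def Suc by (simp add: nat_add_distrib del: of_nat_Suc)
    also have "\<dots> = (Suc n + Suc r choose Suc r)"
      by simp
    finally show ?thesis unfolding free_hilbert_def Suc by (simp add: nat_add_distrib del: of_nat_Suc)
  qed
qed

lemma card_expos_deg: "finite U \<Longrightarrow> card (expos_deg U k) = free_hilbert (card U) (int k)"
proof (induction U arbitrary: k rule: finite_induct)
  case empty
  then show ?case by (simp add: expos_deg_empty free_hilbert_def)
next
  case (insert v U)
  have "card (expos_deg (insert v U) k) = (\<Sum>i\<le>k. card (expos_deg U (k - i)))"
    using sum_expos_deg_insert[OF insert.hyps, of "\<lambda>_. 1 :: nat" k] by simp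
  also have "\<dots> = (\<Sum>i\<le>k. free_hilbert (card U) (int (k - i)))"
    by (simp only: insert.IH)
  also have "\<dots> = (\<Sum>i\<le>k. free_hilbert (card U) (int i))"
    using sum.atLeastAtMost_rev[of "\<lambda>i. free_hilbert (card U) (int i)" 0 k]
    by (simp add: atMost_atLeast0)
  finally show ?case using insert.hyps by (simp add: sum_free_hilbert_nat)
qed

text \<open>Summation over all smaller degrees amounts to adjoining one more variable of degree one.  This is
why the iterated Hilbert functions of a free module are again of the same form.\<close>

lemma sum_free_hilbert:
  fixes b L :: int
  assumes "L \<le> 0"
  shows "(\<Sum>j\<in>{L..b}. free_hilbert R j) = free_hilbert (Suc R) b"
proof (cases "b < 0")
  case True
  then show ?thesis by (simp add: sum.neutral)
next
  case False
  have "(\<Sum>j\<in>{L..b}. free_hilbert R j) = (\<Sum>j\<in>{0..b}. free_hilbert R j)"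
    using assms by (intro sum.mono_neutral_right) auto
  also have "{0..b} = int ` {..nat b}"
    using False by (auto simp: image_int_atLeastAtMost atMost_atLeast0)
  also have "(\<Sum>j\<in>int ` {..nat b}. free_hilbert R j) = (\<Sum>i\<le>nat b. free_hilbert R (int i))"
    by (subst sum.reindex) auto
  finally show ?thesis using False by (simp add: sum_free_hilbert_nat)
qed

text \<open>Hilbert coefficients are integers, so generalized binomial coefficients are needed with values in
\<open>\<int>\<close>, for possibly negative degrees \<open>b\<close>.\<close>

definition int_choose :: "int \<Rightarrow> nat \<Rightarrow> int" where
  "int_choose b l = (\<Prod>i=0..<l. b - of_nat i) div fact l"

lemma of_int_int_choose: "of_int (int_choose b l) = (of_int b :: rat) gchoose l"
  using of_int_gbinomial[of b l, where 'a = rat] by (simp add: int_choose_def gbinomial_prod_rev)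

definition binom_poly :: "nat \<Rightarrow> rat poly" where
  "binom_poly l = Polynomial.smult (1 / fact l) (\<Prod>i<l. [:of_nat l - of_nat i, 1:])"

lemma poly_binom_poly: "poly (binom_poly l) x = (x + of_nat l) gchoose l"
proof -
  have "(\<Prod>i<l. poly [:of_nat l - of_nat i, 1:] x) = (\<Prod>i = 0..<l. (x + of_nat l) - of_nat i)"
    by (intro prod.cong) (auto simp: algebra_simps)
  then show ?thesis by (simp add: binom_poly_def gbinomial_prod_rev poly_prod)
qed

lemma degree_binom_poly: "degree (binom_poly l) \<le> l"
proof -
  have "degree (\<Prod>i<l. [:of_nat l - of_nat i, 1 :: rat:]) \<le> sum (degree \<circ> (\<lambda>i. [:of_nat l - of_nat i, 1 :: rat:])) {..<l}"
    by (rule degree_prod_sum_le) simp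
  then show ?thesis by (simp add: binom_poly_def)
qed

lemma free_hilbert_gbinomial:
  assumes "0 \<le> b" "R \<noteq> 0"
  shows "(of_nat (free_hilbert R b) :: rat) = (of_int b + of_nat (R - 1)) gchoose (R - 1)"
proof -
  have "(of_nat (free_hilbert R b) :: rat) = of_nat ((nat b + (R - 1)) choose (R - 1))"
    using assms by (simp add: free_hilbert_def)
  also have "\<dots> = of_nat (nat b + (R - 1)) gchoose (R - 1)" by (rule binomial_gbinomial)
  finally show ?thesis by (simp only: of_nat_add of_nat_nat[OF assms(1)])
qed

text \<open>The coefficient identity behind \<open>s\<^sup>b = (1 - (1 - s))\<^sup>b\<close> after division by \<open>(1 - s)\<^sup>R\<close>.\<close>

lemma gbinomial_shift_expansion:
  fixes x :: rat and b :: int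
  assumes "R \<noteq> 0"
  shows "(x - of_int b + of_nat (R - 1)) gchoose (R - 1) =
    (\<Sum>l<R. (- 1) ^ l * (of_int b gchoose l) * ((x + of_nat (R - l - 1)) gchoose (R - l - 1)))"
proof -
  obtain n where R: "R = Suc n" using assms not0_implies_Suc by blast
  have neg: "((- y - 1) gchoose k) = (- 1) ^ k * ((y + of_nat k) gchoose k)" for y :: rat and k
    by (subst gbinomial_negated_upper) (simp add: algebra_simps)
  have "(x - of_int b + of_nat n) gchoose n = (- 1) ^ n * ((of_int b + (- x - 1)) gchoose n)"
    using neg[of "x - of_int b" n] by (simp add: algebra_simps flip: power_mult_distrib)
  also have "(of_int b + (- x - 1)) gchoose n = (\<Sum>l\<le>n. (of_int b gchoose l) * ((- x - 1) gchoose (n - l)))"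
    by (simp flip: gbinomial_Vandermonde add: atMost_atLeast0)
  also have "(- 1) ^ n * \<dots> = (\<Sum>l\<le>n. (- 1) ^ l * (of_int b gchoose l) * ((x + of_nat (n - l)) gchoose (n - l)))"
    unfolding sum_distrib_left
  proof (intro sum.cong refl)
    fix l assume "l \<in> {..n}"
    then have "(- 1 :: rat) ^ n = (- 1) ^ l * (- 1) ^ (n - l)" by (simp flip: power_add)
    then show "(- 1) ^ n * ((of_int b gchoose l) * ((- x - 1) gchoose (n - l))) =
        (- 1) ^ l * (of_int b gchoose l) * ((x + of_nat (n - l)) gchoose (n - l))"
      by (simp add: neg flip: power_mult_distrib)
  qed
  finally show ?thesis by (simp add: R lessThan_Suc_atMost)
qed

text \<open>Evaluation at \<open>x = -1, -2, \<dots>\<close> gives a triangular system: \<open>(s - 1 - t choose s)\<close> vanishes for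
\<open>s > t\<close> and is a sign for \<open>s = t\<close>.\<close>

lemma binomial_basis_unique:
  fixes f :: "nat \<Rightarrow> rat"
  assumes "\<And>x :: rat. (\<Sum>s<N. f s * ((x + of_nat s) gchoose s)) = 0" and "s < N"
  shows "f s = 0"
  using assms(2)
proof (induction s rule: less_induct)
  case (less t)
  have van: "((- 1 - of_nat t + of_nat s :: rat) gchoose s) = 0" if "t < s" for s
  proof -
    have "(- 1 - of_nat t + of_nat s :: rat) = of_nat (s - 1 - t)" using that by simp
    then have "((- 1 - of_nat t + of_nat s :: rat) gchoose s) = of_nat ((s - 1 - t) choose s)"
      by (simp only: binomial_gbinomial)
    then show ?thesis using that by (simp add: binomial_eq_0)
  qed
  have "(\<Sum>s<N. f s * ((- 1 - of_nat t + of_nat s) gchoose s)) = (\<Sum>s<N. if s = t then f t * ((- 1) gchoose t) else 0)"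
  proof (intro sum.cong refl)
    fix s assume "s \<in> {..<N}"
    then show "f s * ((- 1 - of_nat t + of_nat s) gchoose s) = (if s = t then f t * ((- 1) gchoose t) else 0)"
      using less.IH van by (cases s t rule: linorder_cases) auto
  qed
  then have "f t * ((- 1) gchoose t) = 0" using assms(1)[of "- 1 - of_nat t"] less.prems by simp
  moreover have "((- 1 :: rat) gchoose t) = (- 1) ^ t"
    by (subst gbinomial_minus) (simp flip: binomial_gbinomial)
  ultimately show ?case by simp
qed


section \<open>Sums of polynomials over simplices\<close>

text \<open>Polynomial functions of degree less than \<open>d\<close>.  They are written in the binomial basis because
convolution maps a pair of basis elements to a basis element.\<close>

definition is_poly_fun :: "nat \<Rightarrow> (nat \<Rightarrow> rat) \<Rightarrow> bool" where
  "is_poly_fun d f \<longleftrightarrow> (\<exists>c. \<forall>k. f k = (\<Sum>s<d. c s * of_nat ((k + s) choose s)))"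

lemma is_poly_fun_add:
  assumes "is_poly_fun d f" "is_poly_fun d g"
  shows "is_poly_fun d (\<lambda>k. f k + g k)"
proof -
  obtain c e where "\<forall>k. f k = (\<Sum>s<d. c s * of_nat ((k + s) choose s))"
    "\<forall>k. g k = (\<Sum>s<d. e s * of_nat ((k + s) choose s))"
    using assms by (auto simp: is_poly_fun_def)
  then show ?thesis
    unfolding is_poly_fun_def by (intro exI[of _ "\<lambda>s. c s + e s"]) (simp add: distrib_right sum.distrib)
qed

lemma is_poly_fun_zero: "is_poly_fun d (\<lambda>_. 0)"
  by (auto simp: is_poly_fun_def intro: exI[of _ "\<lambda>_. 0"])

lemma is_poly_fun_sum: "(\<And>i. i \<in> A \<Longrightarrow> is_poly_fun d (f i)) \<Longrightarrow> is_poly_fun d (\<lambda>k. \<Sum>i\<in>A. f i k)"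
  by (induction A rule: infinite_finite_induct) (auto intro: is_poly_fun_zero is_poly_fun_add)

lemma is_poly_fun_scale:
  assumes "is_poly_fun d f"
  shows "is_poly_fun d (\<lambda>k. a * f k)"
proof -
  obtain c where "\<forall>k. f k = (\<Sum>s<d. c s * of_nat ((k + s) choose s))"
    using assms by (auto simp: is_poly_fun_def)
  then show ?thesis
    unfolding is_poly_fun_def by (intro exI[of _ "\<lambda>s. a * c s"]) (simp add: sum_distrib_left mult.assoc)
qed

lemma is_poly_fun_mono:
  assumes "is_poly_fun d f" "d \<le> e"
  shows "is_poly_fun e f"
proof -
  obtain c where c: "\<forall>k. f k = (\<Sum>s<d. c s * of_nat ((k + s) choose s))"
    using assms by (auto simp: is_poly_fun_def)
  have "(\<Sum>s<d. c s * of_nat ((k + s) choose s)) = (\<Sum>s<e. (if s < d then c s else 0) * of_nat ((k + s) choose s))" for k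
    using assms(2) by (intro sum.mono_neutral_cong_left) auto
  then show ?thesis using c unfolding is_poly_fun_def by (intro exI[of _ "\<lambda>s. if s < d then c s else 0"]) simp
qed

lemma convolution_choose:
  "(\<Sum>t\<le>k. ((k - t + s) choose s) * ((t + r) choose r)) = (k + (s + r + 1)) choose (s + r + 1)"
proof (induction s arbitrary: k)
  case 0
  have "(\<Sum>t\<le>k. (t + r) choose r) = (\<Sum>t\<le>k. (r + t) choose t)"
    by (intro sum.cong refl) (metis add.commute binomial_symmetric le_add2 add_diff_cancel_right')
  also have "\<dots> = (r + k + 1) choose k"
    using sum_choose_lower[of r k] by simp
  also have "\<dots> = (k + (r + 1)) choose (r + 1)"
    by (subst binomial_symmetric) (simp_all add: ac_simps)
  finally show ?case by simp
next
  case (Suc s)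
  have hockey: "(\<Sum>j\<le>m. (j + s) choose s) = (m + Suc s) choose Suc s" for m
    by (induction m) simp_all
  have "(\<Sum>t\<le>k. ((k - t + Suc s) choose Suc s) * ((t + r) choose r)) =
      (\<Sum>t\<le>k. \<Sum>j\<le>k - t. ((j + s) choose s) * ((t + r) choose r))"
    by (simp only: hockey[symmetric] sum_distrib_right)
  also have "\<dots> = (\<Sum>(t, j)\<in>{(t, j). t + j \<le> k}. ((j + s) choose s) * ((t + r) choose r))"
    by (subst sum.Sigma) (auto intro!: sum.cong)
  also have "\<dots> = (\<Sum>m\<le>k. \<Sum>t\<le>m. ((m - t + s) choose s) * ((t + r) choose r))"
    by (rule sum.triangle_reindex_eq)
  also have "\<dots> = (\<Sum>m\<le>k. (m + (s + r + 1)) choose (s + r + 1))"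
    by (simp only: Suc.IH)
  also have "\<dots> = (k + Suc (s + r + 1)) choose Suc (s + r + 1)"
    by (induction k) simp_all
  finally show ?case by simp
qed

lemma is_poly_fun_convolution:
  assumes "is_poly_fun d f" "is_poly_fun e g"
  shows "is_poly_fun (d + e) (\<lambda>k. \<Sum>t\<le>k. f (k - t) * g t)"
proof -
  obtain a b where a: "\<And>k. f k = (\<Sum>s<d. a s * of_nat ((k + s) choose s))"
    and b: "\<And>k. g k = (\<Sum>r<e. b r * of_nat ((k + r) choose r))"
    using assms by (auto simp: is_poly_fun_def)
  have eq: "(\<Sum>t\<le>k. f (k - t) * g t) =
      (\<Sum>s<d. \<Sum>r<e. a s * b r * of_nat ((k + (s + r + 1)) choose (s + r + 1)))" for k
  proof -
    have "(\<Sum>t\<le>k. f (k - t) * g t) =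
        (\<Sum>t\<le>k. \<Sum>s<d. \<Sum>r<e. a s * b r * of_nat (((k - t + s) choose s) * ((t + r) choose r)))"
      unfolding a b sum_product by (intro sum.cong refl) (simp add: mult_ac)
    also have "\<dots> = (\<Sum>s<d. \<Sum>r<e. \<Sum>t\<le>k. a s * b r * of_nat (((k - t + s) choose s) * ((t + r) choose r)))"
    proof -
      have "(\<Sum>t\<le>k. \<Sum>s<d. \<Sum>r<e. a s * b r * rat_of_nat (((k - t + s) choose s) * ((t + r) choose r))) =
          (\<Sum>s<d. \<Sum>t\<le>k. \<Sum>r<e. a s * b r * of_nat (((k - t + s) choose s) * ((t + r) choose r)))"
        by (rule sum.swap)
      also have "\<dots> = (\<Sum>s<d. \<Sum>r<e. \<Sum>t\<le>k. a s * b r * of_nat (((k - t + s) choose s) * ((t + r) choose r)))"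
        by (intro sum.cong refl sum.swap)
      finally show ?thesis .
    qed
    also have "\<dots> = (\<Sum>s<d. \<Sum>r<e. a s * b r * of_nat (\<Sum>t\<le>k. ((k - t + s) choose s) * ((t + r) choose r)))"
      by (simp only: sum_distrib_left of_nat_sum)
    finally show ?thesis by (simp only: convolution_choose)
  qed
  have single: "is_poly_fun (d + e) (\<lambda>k. c * of_nat ((k + m) choose m))" if "m < d + e" for c m
    unfolding is_poly_fun_def
  proof (intro exI allI)
    fix k
    have "(\<Sum>s<d + e. (if s = m then c else 0) * of_nat ((k + s) choose s)) =
        (\<Sum>s<d + e. if s = m then c * of_nat ((k + m) choose m) else 0)"
      by (intro sum.cong) auto
    then show "c * of_nat ((k + m) choose m) = (\<Sum>s<d + e. (if s = m then c else 0) * of_nat ((k + s) choose s))"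
      using that by simp
  qed
  show ?thesis
    unfolding eq by (intro is_poly_fun_sum single) auto
qed

lemma coeff_binom_poly: "coeff (binom_poly l) l = 1 / fact l"
proof -
  have "coeff (\<Prod>i<k. [:of_nat l - of_nat i, 1 :: rat:]) k = 1 \<and> degree (\<Prod>i<k. [:of_nat l - of_nat i, 1 :: rat:]) \<le> k" for k
  proof (induction k)
    case (Suc k)
    then show ?case
      by (auto simp: coeff_eq_0 intro!: degree_add_le order_trans[OF degree_smult_le] order_trans[OF degree_pCons_le])
  qed simp
  then show ?thesis by (simp add: binom_poly_def)
qed

lemma binomial_basis:
  fixes P :: "rat poly"
  assumes "degree P < d"
  shows "\<exists>c. \<forall>x. poly P x = (\<Sum>s<d. c s * ((x + of_nat s) gchoose s))"
  using assms
proof (induction d arbitrary: P)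
  case (Suc d)
  define a where "a = coeff P d * fact d"
  define Q where "Q = P - Polynomial.smult a (binom_poly d)"
  have "degree Q \<le> d"
    unfolding Q_def using Suc.prems degree_binom_poly[of d]
    by (intro degree_diff_le) (auto intro: order_trans[OF degree_smult_le])
  moreover have "coeff Q d = 0" by (simp add: Q_def a_def coeff_binom_poly)
  ultimately have Q: "degree Q < d \<or> Q = 0"
    using leading_coeff_0_iff[of Q] by (cases "degree Q = d") auto
  have "\<exists>c. \<forall>x. poly Q x = (\<Sum>s<d. c s * ((x + of_nat s) gchoose s))"
    using Q Suc.IH[of Q] by (auto intro: exI[of _ "\<lambda>_. 0"])
  then obtain c where c: "\<And>x. poly Q x = (\<Sum>s<d. c s * ((x + of_nat s) gchoose s))" by blast
  have "poly P x = (\<Sum>s<Suc d. (c(d := a)) s * ((x + of_nat s) gchoose s))" for x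
  proof -
    have "poly P x = poly Q x + a * ((x + of_nat d) gchoose d)" by (simp add: Q_def poly_binom_poly)
    then show ?thesis unfolding c by simp
  qed
  then show ?case by blast
qed simp

lemma is_poly_fun_gchoose: "is_poly_fun (Suc l) (\<lambda>k. (of_nat (q * k) :: rat) gchoose l)"
proof -
  define P :: "rat poly" where "P = Polynomial.smult (1 / fact l) (\<Prod>i<l. [:- of_nat i, of_nat q:])"
  have "degree P \<le> sum (degree \<circ> (\<lambda>i. [:- of_nat i, of_nat q :: rat:])) {..<l}"
    unfolding P_def by (rule order_trans[OF degree_smult_le degree_prod_sum_le]) simp
  also have "\<dots> \<le> (\<Sum>i<l. 1)" by (intro sum_mono) simp
  finally have "degree P < Suc l" by simp
  then obtain c where c: "\<forall>x. poly P x = (\<Sum>s<Suc l. c s * ((x + of_nat s) gchoose s))"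
    using binomial_basis by blast
  have "(of_nat (q * k) :: rat) gchoose l = poly P (of_nat k)" for k
    by (simp add: P_def gbinomial_prod_rev poly_prod atLeast0LessThan mult.commute)
  then have "(of_nat (q * k) :: rat) gchoose l = (\<Sum>s<Suc l. c s * of_nat ((k + s) choose s))" for k
    using c by (simp add: binomial_gbinomial del: sum.lessThan_Suc)
  then show ?thesis unfolding is_poly_fun_def by blast
qed

text \<open>For a single variable the simplex is a point.  For one more variable \<open>v\<close>, Vandermonde's identity
splits \<open>(w s + p\<^sub>v i choose l)\<close>, and summation over the exponent \<open>i\<close> of \<open>v\<close> becomes a sum of
convolutions; the bounds on the degrees add up.\<close>

lemma is_poly_fun_simplex_sum:
  fixes p :: "'v \<Rightarrow> nat" and w :: "('v \<Rightarrow>\<^sub>0 nat) \<Rightarrow> nat"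
  assumes w: "\<And>s t. w (s + t) = w s + w t" "\<And>v i. v \<in> Y \<Longrightarrow> w (single v i) = p v * i" and Y: "finite Y" "Y \<noteq> {}"
  shows "is_poly_fun (l + card Y) (\<lambda>k. \<Sum>t\<in>expos_deg Y k. (of_nat (w t) :: rat) gchoose l)"
  using Y w(2)
proof (induction Y arbitrary: l rule: finite_ne_induct)
  case (singleton v)
  have "w 0 = 0" using w(1)[of 0 0] by simp
  have "(\<Sum>t\<in>expos_deg {v} k. (of_nat (w t) :: rat) gchoose l) = of_nat (p v * k) gchoose l" for k
  proof -
    have "expos_deg {v} k = {single v k}"
    proof (intro equalityI subsetI)
      fix t assume t: "t \<in> expos_deg {v} k"
      then obtain s where s: "s \<in> expos {}" "t = s + single v (lookup t v)"
        using expos_insert_split[of v "{}" t] by (auto simp: expos_deg_def)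
      then have "t = single v (lookup t v)" by simp
      then show "t \<in> {single v k}" using t by (metis (mono_tags, lifting) expos_deg_def insertI1 mem_Collect_eq tdeg_single)
    qed (auto simp: expos_deg_def)
    then show ?thesis using singleton by simp
  qed
  then show ?case using is_poly_fun_gchoose[of l "p v"] by simp
next
  case (insert v Y)
  have "(\<Sum>t\<in>expos_deg (insert v Y) k. (of_nat (w t) :: rat) gchoose l) =
      (\<Sum>a\<le>l. \<Sum>i\<le>k. (\<Sum>s\<in>expos_deg Y (k - i). of_nat (w s) gchoose a) * (of_nat (p v * i) gchoose (l - a)))" for k
  proof -
    have "(\<Sum>t\<in>expos_deg (insert v Y) k. (of_nat (w t) :: rat) gchoose l) =
        (\<Sum>i\<le>k. \<Sum>s\<in>expos_deg Y (k - i). (of_nat (w s) + of_nat (p v * i)) gchoose l)"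
      using insert by (simp add: sum_expos_deg_insert w(1))
    also have "\<dots> = (\<Sum>i\<le>k. \<Sum>s\<in>expos_deg Y (k - i). \<Sum>a\<le>l. (of_nat (w s) gchoose a) * (of_nat (p v * i) gchoose (l - a)))"
      by (simp only: gbinomial_Vandermonde[symmetric] atMost_atLeast0)
    also have "\<dots> = (\<Sum>i\<le>k. \<Sum>a\<le>l. \<Sum>s\<in>expos_deg Y (k - i). (of_nat (w s) gchoose a) * (of_nat (p v * i) gchoose (l - a)))"
      by (intro sum.cong refl sum.swap)
    also have "\<dots> = (\<Sum>a\<le>l. \<Sum>i\<le>k. \<Sum>s\<in>expos_deg Y (k - i). (of_nat (w s) gchoose a) * (of_nat (p v * i) gchoose (l - a)))"
      by (rule sum.swap)
    finally show ?thesis by (simp only: sum_distrib_right)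
  qed
  moreover have "is_poly_fun (l + card (insert v Y)) (\<lambda>k. \<Sum>a\<le>l. \<Sum>i\<le>k.
      (\<Sum>s\<in>expos_deg Y (k - i). of_nat (w s) gchoose a) * (of_nat (p v * i) gchoose (l - a)))"
  proof (rule is_poly_fun_sum)
    fix a assume a: "a \<in> {..l}"
    have "is_poly_fun (a + card Y) (\<lambda>k. \<Sum>t\<in>expos_deg Y k. (of_nat (w t) :: rat) gchoose a)"
      using insert by simp
    from is_poly_fun_convolution[OF this is_poly_fun_gchoose[of "l - a" "p v"]]
    have "is_poly_fun (a + card Y + Suc (l - a)) (\<lambda>k. \<Sum>i\<le>k.
        (\<Sum>s\<in>expos_deg Y (k - i). of_nat (w s) gchoose a) * (of_nat (p v * i) gchoose (l - a)))" .
    then show "is_poly_fun (l + card (insert v Y)) (\<lambda>k. \<Sum>i\<le>k.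
        (\<Sum>s\<in>expos_deg Y (k - i). of_nat (w s) gchoose a) * (of_nat (p v * i) gchoose (l - a)))"
      by (rule is_poly_fun_mono) (use insert.hyps a in auto)
  qed
  ultimately show ?case by simp
qed

lemma is_poly_fun_shifted_simplex_sum:
  fixes p :: "'v \<Rightarrow> nat" and w :: "('v \<Rightarrow>\<^sub>0 nat) \<Rightarrow> nat" and a :: int
  assumes w: "\<And>s t. w (s + t) = w s + w t" "\<And>v i. v \<in> Y \<Longrightarrow> w (single v i) = p v * i" and Y: "finite Y" "Y \<noteq> {}"
  shows "is_poly_fun (l + card Y) (\<lambda>k. \<Sum>t\<in>expos_deg Y k. of_int (int_choose (a + int (w t)) l))"
proof -
  have "(\<Sum>t\<in>expos_deg Y k. of_int (int_choose (a + int (w t)) l)) =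
      (\<Sum>j\<le>l. (of_int a gchoose j) * (\<Sum>t\<in>expos_deg Y k. (of_nat (w t) :: rat) gchoose (l - j)))" for k
  proof -
    have "(\<Sum>t\<in>expos_deg Y k. of_int (int_choose (a + int (w t)) l)) =
        (\<Sum>t\<in>expos_deg Y k. (of_int a + of_nat (w t) :: rat) gchoose l)"
      by (simp add: of_int_int_choose)
    also have "\<dots> = (\<Sum>t\<in>expos_deg Y k. \<Sum>j\<le>l. (of_int a gchoose j) * (of_nat (w t) gchoose (l - j)))"
      by (simp only: gbinomial_Vandermonde[symmetric] atMost_atLeast0)
    also have "\<dots> = (\<Sum>j\<le>l. \<Sum>t\<in>expos_deg Y k. (of_int a gchoose j) * (of_nat (w t) gchoose (l - j)))"
      by (rule sum.swap)
    finally show ?thesis by (simp only: sum_distrib_left)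
  qed
  moreover have "is_poly_fun (l + card Y)
      (\<lambda>k. \<Sum>j\<le>l. (of_int a gchoose j) * (\<Sum>t\<in>expos_deg Y k. (of_nat (w t) :: rat) gchoose (l - j)))"
    by (intro is_poly_fun_sum is_poly_fun_scale is_poly_fun_mono[OF is_poly_fun_simplex_sum[OF w Y]]) auto
  ultimately show ?thesis by simp
qed

lemma is_poly_fun_shift_poly:
  assumes "is_poly_fun d f"
  obtains P where "\<And>k :: int. b \<le> k \<Longrightarrow> f (nat (k - b)) = poly P (of_int k)" "deg P \<le> int d - 1"
proof -
  obtain c where c: "\<And>k. f k = (\<Sum>s<d. c s * of_nat ((k + s) choose s))"
    using assms by (auto simp: is_poly_fun_def)
  define P0 where "P0 = (\<Sum>s<d. Polynomial.smult (c s) (binom_poly s))"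
  define P where "P = pcompose P0 [:- of_int b, 1:]"
  have "f (nat (k - b)) = poly P (of_int k)" if "b \<le> k" for k
    using that by (simp add: c P_def P0_def poly_sum poly_pcompose poly_binom_poly binomial_gbinomial)
  moreover have "deg P \<le> int d - 1"
  proof (cases "P = 0")
    case False
    have "d \<noteq> 0"
    proof
      assume "d = 0"
      then have "P0 = 0" by (simp add: P0_def)
      then show False using False by (simp add: P_def)
    qed
    have "degree P0 \<le> d - 1"
      unfolding P0_def by (intro degree_sum_le) (auto intro!: order_trans[OF degree_smult_le] order_trans[OF degree_binom_poly])
    moreover have "degree P = degree P0" by (simp add: P_def degree_pcompose)
    ultimately show ?thesis using False \<open>d \<noteq> 0\<close> by (simp add: deg_def)
  qed (simp add: deg_def)
  ultimately show ?thesis using that by blast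
qed

section \<open>Hilbert coefficients of sums of free Hilbert functions\<close>

lemma iter_hilbert_free_sum:
  assumes X: "finite X" and h: "\<And>a. iter_hilbert W g 0 a = (\<Sum>x\<in>X. free_hilbert (r x) (a - b x))"
  shows "iter_hilbert W g i a = (\<Sum>x\<in>X. free_hilbert (r x + i) (a - b x))"
proof (induction i arbitrary: a)
  case 0
  show ?case using h by simp
next
  case (Suc i)
  obtain L where L: "\<And>x. x \<in> X \<Longrightarrow> L \<le> b x"
  proof (cases "X = {}")
    case False
    then show ?thesis using that[of "Min (b ` X)"] X by simp
  qed (use that in auto)
  have 0: "iter_hilbert W g i j = 0" if "j < L" for j
    unfolding Suc using L that by (intro sum.neutral) (auto simp: less_le_trans)
  have "iter_hilbert W g (Suc i) a = (\<Sum>j\<in>{L..a}. iter_hilbert W g i j)"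
    unfolding iter_hilbert.simps using 0 by (intro sum.mono_neutral_left) (auto simp: not_less[symmetric])
  also have "\<dots> = (\<Sum>x\<in>X. \<Sum>j\<in>{L..a}. free_hilbert (r x + i) (j - b x))"
    unfolding Suc by (rule sum.swap)
  also have "\<dots> = (\<Sum>x\<in>X. free_hilbert (r x + Suc i) (a - b x))"
  proof (intro sum.cong refl)
    fix x assume x: "x \<in> X"
    have "(\<Sum>j\<in>{L..a}. free_hilbert (r x + i) (j - b x)) = (\<Sum>j\<in>{L - b x..a - b x}. free_hilbert (r x + i) j)"
      by (rule sum.reindex_bij_witness[of _ "\<lambda>j. j + b x" "\<lambda>j. j - b x"]) auto
    then show "(\<Sum>j\<in>{L..a}. free_hilbert (r x + i) (j - b x)) = free_hilbert (r x + Suc i) (a - b x)"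
      using L[OF x] by (simp add: sum_free_hilbert)
  qed
  finally show ?case .
qed

lemma eventually_poly_unique:
  fixes P Q :: "rat poly"
  assumes "\<forall>\<^sub>F k::int in at_top. poly P (of_int k) = poly Q (of_int k)"
  shows "P = Q"
proof -
  obtain K where K: "\<And>k. K \<le> k \<Longrightarrow> poly P (of_int k) = poly Q (of_int k)"
    using assms by (auto simp: eventually_at_top_linorder)
  have "infinite ((of_int :: int \<Rightarrow> rat) ` {K..})"
    by (subst finite_image_iff) (auto simp: inj_on_def infinite_Ici)
  moreover have "of_int ` {K..} \<subseteq> {x. poly (P - Q) x = 0}" using K by auto
  ultimately have "infinite {x. poly (P - Q) x = 0}" using finite_subset by blast
  then have "P - Q = 0" using poly_roots_finite by blast
  then show ?thesis by simp
qed

definition hilbert_poly_sum :: "'x set \<Rightarrow> ('x \<Rightarrow> nat) \<Rightarrow> ('x \<Rightarrow> int) \<Rightarrow> rat poly" where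
  "hilbert_poly_sum X R b =
    (\<Sum>x\<in>X. if R x = 0 then 0 else pcompose (binom_poly (R x - 1)) [:- of_int (b x), 1:])"

lemma hilbert_poly_free_sum:
  assumes X: "finite X" and h: "\<And>a. iter_hilbert W g i a = (\<Sum>x\<in>X. free_hilbert (R x) (a - b x))"
  shows "hilbert_poly W g i = hilbert_poly_sum X R b"
proof -
  obtain B where B: "\<And>x. x \<in> X \<Longrightarrow> b x < B"
  proof (cases "X = {}")
    case False
    then show ?thesis using that[of "Max (b ` X) + 1"] X by (simp add: le_imp_less_Suc zle_add1_eq_le)
  qed (use that in auto)
  have agree: "of_nat (iter_hilbert W g i a) = poly (hilbert_poly_sum X R b) (of_int a)" if "B \<le> a" for a
  proof -
    have "rat_of_nat (free_hilbert (R x) (a - b x)) =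
        poly (if R x = 0 then 0 else pcompose (binom_poly (R x - 1)) [:- of_int (b x), 1:]) (of_int a)" if "x \<in> X" for x
    proof (cases "R x = 0")
      case True
      then show ?thesis using B[OF that] \<open>B \<le> a\<close> by (simp add: free_hilbert_def)
    next
      case False
      then show ?thesis
        using free_hilbert_gbinomial[of "a - b x" "R x"] B[OF that] \<open>B \<le> a\<close> by (simp add: poly_pcompose poly_binom_poly)
    qed
    then show ?thesis unfolding h hilbert_poly_sum_def poly_sum by simp
  qed
  have "\<forall>\<^sub>F a in at_top. of_nat (iter_hilbert W g i a) = poly (hilbert_poly_sum X R b) (of_int a)"
    using agree by (auto simp: eventually_at_top_linorder)
  moreover have "P = hilbert_poly_sum X R b"
    if "\<forall>\<^sub>F a in at_top. of_nat (iter_hilbert W g i a) = poly P (of_int a)" for P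
    by (rule eventually_poly_unique)
      (use eventually_conj[OF that calculation] in \<open>auto elim!: eventually_mono\<close>)
  ultimately show ?thesis unfolding hilbert_poly_def by blast
qed

text \<open>The Hilbert coefficients \<open>e\<^sub>j\<close>, for \<open>N\<close> coefficients, of a direct sum of polynomial rings in
\<open>R x\<close> variables shifted by \<open>b x\<close>.  A summand with fewer than \<open>N\<close> variables enters with the
index \<open>l = j - (N - R x)\<close>, and the sign \<open>(-1)\<^sup>N\<^sup>-\<^sup>R\<close> corrects the difference between
\<open>(-1)\<^sup>l\<close> and \<open>(-1)\<^sup>j\<close>.\<close>

definition coeff_sum :: "'x set \<Rightarrow> ('x \<Rightarrow> nat) \<Rightarrow> ('x \<Rightarrow> int) \<Rightarrow> nat \<Rightarrow> nat \<Rightarrow> int" where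
  "coeff_sum X R b N j =
    (if j < N then \<Sum>x\<in>X. if N \<le> R x + j then (- 1) ^ (N - R x) * int_choose (b x) (R x + j - N) else 0 else 0)"

lemma hilbert_coeff_free_sum:
  assumes X: "finite X" and h: "\<And>a. iter_hilbert W g i a = (\<Sum>x\<in>X. free_hilbert (R x) (a - b x))"
    and N: "num_coeffs n W i = N" and R: "\<And>x. x \<in> X \<Longrightarrow> R x \<le> N"
  shows "hilbert_coeff n W g i j = coeff_sum X R b N j"
proof -
  define bas where "bas x j = ((x + of_nat (N - j - 1)) gchoose (N - j - 1))" for x :: rat and j
  have one: "(\<Sum>j<N. (- 1) ^ j * of_int (if N \<le> R y + j then (- 1) ^ (N - R y) * int_choose (b y) (R y + j - N) else 0) * bas x j) =
      poly (if R y = 0 then 0 else pcompose (binom_poly (R y - 1)) [:- of_int (b y), 1:]) x" (is "?l = ?r")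
    if y: "y \<in> X" for x y
  proof (cases "R y = 0")
    case True
    then show ?thesis by (auto intro!: sum.neutral)
  next
    case False
    have "?l = (\<Sum>j\<in>{N - R y..<N}. (- 1) ^ j * of_int ((- 1) ^ (N - R y) * int_choose (b y) (R y + j - N)) * bas x j)"
      by (intro sum.mono_neutral_cong_right) auto
    also have "\<dots> = (\<Sum>l<R y. (- 1) ^ l * (of_int (b y) gchoose l) * ((x + of_nat (R y - l - 1)) gchoose (R y - l - 1)))"
    proof (rule sum.reindex_bij_witness[of _ "\<lambda>l. l + (N - R y)" "\<lambda>j. j - (N - R y)"])
      fix j assume j: "j \<in> {N - R y..<N}"
      have "(- 1 :: rat) ^ (j - (N - R y)) = (- 1) ^ j * (- 1) ^ (N - R y)"
      proof -
        have "(- 1 :: rat) ^ j = (- 1) ^ (j - (N - R y)) * (- 1) ^ (N - R y)"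
          using j by (simp flip: power_add)
        then show ?thesis by (simp flip: power_mult_distrib)
      qed
      moreover have "R y + j - N = j - (N - R y)" "R y - (j - (N - R y)) - 1 = N - j - 1"
        using j R[OF y] by auto
      ultimately show "(- 1) ^ (j - (N - R y)) * (of_int (b y) gchoose (j - (N - R y))) *
          ((x + of_nat (R y - (j - (N - R y)) - 1)) gchoose (R y - (j - (N - R y)) - 1)) =
          (- 1) ^ j * of_int ((- 1) ^ (N - R y) * int_choose (b y) (R y + j - N)) * bas x j"
        by (simp add: bas_def of_int_int_choose)
    qed (use R[OF y] in auto)
    also have "\<dots> = ?r"
      using False gbinomial_shift_expansion[of "R y" x "b y"] by (simp add: poly_pcompose poly_binom_poly algebra_simps)
    finally show ?thesis .
  qed
  have expand: "poly (hilbert_poly_sum X R b) x = (\<Sum>j<N. (- 1) ^ j * of_int (coeff_sum X R b N j) * bas x j)" for x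
  proof -
    have "poly (hilbert_poly_sum X R b) x = (\<Sum>y\<in>X. \<Sum>j<N. (- 1) ^ j *
        of_int (if N \<le> R y + j then (- 1) ^ (N - R y) * int_choose (b y) (R y + j - N) else 0) * bas x j)"
      unfolding hilbert_poly_sum_def poly_sum by (intro sum.cong refl) (rule one[symmetric])
    also have "\<dots> = (\<Sum>j<N. \<Sum>y\<in>X. (- 1) ^ j *
        of_int (if N \<le> R y + j then (- 1) ^ (N - R y) * int_choose (b y) (R y + j - N) else 0) * bas x j)"
      by (rule sum.swap)
    also have "\<dots> = (\<Sum>j<N. (- 1) ^ j * of_int (coeff_sum X R b N j) * bas x j)"
      by (intro sum.cong refl) (simp add: coeff_sum_def sum_distrib_left sum_distrib_right)
    finally show ?thesis .
  qed
  have unique: "e = coeff_sum X R b N"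
    if e: "\<forall>j\<ge>N. e j = 0" "\<forall>x. poly (hilbert_poly_sum X R b) x = (\<Sum>j<N. (- 1) ^ j * of_int (e j) * bas x j)" for e :: "nat \<Rightarrow> int"
  proof
    fix j
    show "e j = coeff_sum X R b N j"
    proof (cases "j < N")
      case True
      (* the basis element belonging to the coefficient e j has degree N - j - 1,
         so the order of the coefficients is reversed *)
      define f :: "nat \<Rightarrow> rat" where "f s = (- 1) ^ (N - s - 1) * (of_int (e (N - s - 1)) - of_int (coeff_sum X R b N (N - s - 1)))" for s
      have "(\<Sum>s<N. f s * ((x + of_nat s) gchoose s)) = 0" for x
      proof -
        have "(\<Sum>s<N. f s * ((x + of_nat s) gchoose s)) =
            (\<Sum>j<N. (- 1) ^ j * (of_int (e j) - of_int (coeff_sum X R b N j)) * bas x j)"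
          by (rule sum.reindex_bij_witness[of _ "\<lambda>j. N - j - 1" "\<lambda>s. N - s - 1"]) (auto simp: f_def bas_def)
        also have "\<dots> = 0" using e(2) expand[of x] by (simp add: algebra_simps sum_subtractf)
        finally show ?thesis .
      qed
      then have "f (N - j - 1) = 0" using True by (intro binomial_basis_unique[where N = N and f = f]) auto
      then show ?thesis using True by (simp add: f_def)
    next
      case False
      then show ?thesis using e(1) by (simp add: coeff_sum_def)
    qed
  qed
  have "hilbert_coeff n W g i = (THE e. (\<forall>j\<ge>N. e j = 0) \<and>
      (\<forall>x. poly (hilbert_poly_sum X R b) x = (\<Sum>j<N. (- 1) ^ j * of_int (e j) * bas x j)))"
    unfolding hilbert_coeff_def N Let_def hilbert_poly_free_sum[OF X h] bas_def ..
  also have "\<dots> = coeff_sum X R b N"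
    using unique expand by (intro the_equality) (auto simp: coeff_sum_def)
  finally show ?thesis by simp
qed

section \<open>Bidegrees of exponent vectors\<close>

abbreviation varsA :: "nat \<Rightarrow> nat \<Rightarrow> (nat + nat) set" where
  "varsA n m \<equiv> {..<n} <+> {..<m}"

abbreviation varsS :: "nat \<Rightarrow> (nat + nat) set" where
  "varsS n \<equiv> Inl ` {..<n}"

lemma bideg_superset:
  assumes "finite V" "keys t \<subseteq> V"
  shows "bideg p t = (\<Sum>v\<in>V. int (lookup t v) * fst (var_bideg p v), \<Sum>v\<in>V. int (lookup t v) * snd (var_bideg p v))"
  unfolding bideg_def prod.inject
  by (intro conjI sum.mono_neutral_left) (use assms in \<open>auto simp: in_keys_iff\<close>)

lemma bideg_add: "bideg p (s + t) = bideg p s + bideg p t"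
  by (subst (1 2 3) bideg_superset[of "keys s \<union> keys t"])
    (auto simp: keys_add_nat lookup_add sum.distrib distrib_right plus_prod_def)

lemma bideg_zero [simp]: "bideg p 0 = 0"
  by (simp add: bideg_def zero_prod_def)

lemma bideg_single: "bideg p (single v k) = (int k * fst (var_bideg p v), int k * snd (var_bideg p v))"
  by (cases "k = 0") (simp_all add: bideg_def)

lemma bideg_varsS: "t \<in> expos (range Inl) \<Longrightarrow> bideg p t = (int (tdeg t), 0)"
  unfolding bideg_def tdeg_def expos_def
  by (auto simp: var_bideg_def intro!: sum.cong sum.neutral split: sum.splits)

text \<open>For a monomial \<open>y\<^sup>\<beta>\<close> this is \<open>p \<cdot> \<beta>\<close>, which is never negative.\<close>

definition y_weight :: "(nat \<Rightarrow> nat) \<Rightarrow> (nat + nat \<Rightarrow>\<^sub>0 nat) \<Rightarrow> nat" where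
  "y_weight p t = nat (fst (bideg p t))"

lemma fst_bideg_nonneg: "0 \<le> fst (bideg p t)"
  by (auto simp: bideg_def var_bideg_def intro!: sum_nonneg split: sum.splits)

lemma bideg_varsY: "t \<in> expos (range Inr) \<Longrightarrow> bideg p t = (int (y_weight p t), int (tdeg t))"
  unfolding y_weight_def using fst_bideg_nonneg[of p t]
  by (auto simp: bideg_def tdeg_def expos_def var_bideg_def intro!: prod_eqI sum.cong split: sum.splits)

lemma y_weight_add: "y_weight p (s + t) = y_weight p s + y_weight p t"
  using fst_bideg_nonneg[of p s] fst_bideg_nonneg[of p t]
  by (simp add: y_weight_def bideg_add nat_add_distrib)

lemma y_weight_single: "y_weight p (single (Inr j) i) = p j * i"
  by (simp add: y_weight_def bideg_single var_bideg_def nat_mult_distrib)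

lemma expos_Un_split:
  assumes "s \<in> expos (X \<union> Y)"
  obtains a b where "a \<in> expos X" "b \<in> expos Y" "s = a + b"
proof
  define b where "b = Poly_Mapping.mapp (\<lambda>v k. k when v \<in> Y) s"
  have b: "lookup b v = (lookup s v when v \<in> Y)" for v
    by (auto simp: b_def lookup_mapp when_def in_keys_iff)
  show "b \<in> expos Y" by (auto simp: expos_def in_keys_iff b when_def split: if_splits)
  show "s - b \<in> expos X"
    unfolding expos_def
  proof (intro CollectI subsetI)
    fix v assume "v \<in> keys (s - b)"
    then have "v \<notin> Y" "v \<in> keys s" by (auto simp: in_keys_iff lookup_minus b)
    then show "v \<in> X" using assms by (auto simp: expos_def)
  qed
  show "s = (s - b) + b"
    by (intro poly_mapping_eqI) (simp add: lookup_add lookup_minus b when_def)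
qed

text \<open>The monomials of bidegree \<open>(A, K)\<close> in \<open>K[U]\<close>: first choose the part in the variables \<open>y\<^sub>j\<close>, of
degree \<open>K\<close>; it uses up \<open>p \<cdot> \<beta>\<close> of the first degree, and the rest is left to the variables
\<open>x\<^sub>i\<close>.\<close>

lemma card_expos_bideg:
  assumes U: "finite U"
  defines "X \<equiv> U \<inter> range Inl" and "Y \<equiv> U \<inter> range Inr"
  shows "card {s \<in> expos U. bideg p s = (A, K)} =
    (if K < 0 then 0 else \<Sum>b\<in>expos_deg Y (nat K). free_hilbert (card X) (A - int (y_weight p b)))"
proof -
  have XY: "X \<union> Y = U" "X \<inter> Y = {}" "finite X" "finite Y"
    using U by (auto simp: X_def Y_def) (metis Int_iff UNIV_I Un_iff image_eqI sumE)
  have bd: "bideg p (a + b) = (int (tdeg a) + int (y_weight p b), int (tdeg b))" if "a \<in> expos X" "b \<in> expos Y" for a b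
  proof -
    have "X \<subseteq> range Inl" "Y \<subseteq> range Inr" by (auto simp: X_def Y_def)
    then have "a \<in> expos (range Inl)" "b \<in> expos (range Inr)" using that expos_mono by blast+
    then show ?thesis using bideg_varsS[of a p] bideg_varsY[of b p] by (simp add: bideg_add)
  qed
  have uniq: "b = b'" if "a \<in> expos X" "b \<in> expos Y" "a' \<in> expos X" "b' \<in> expos Y" "a + b = a' + b'" for a b a' b'
  proof (rule poly_mapping_eqI)
    fix v
    have "lookup (a + b) v = lookup (a' + b') v" using that by simp
    moreover have "lookup a v = 0 \<and> lookup a' v = 0" if "v \<in> Y"
      using that XY(2) \<open>a \<in> expos X\<close> \<open>a' \<in> expos X\<close> by (auto intro!: expos_lookup)
    ultimately show "lookup b v = lookup b' v"
      using that(2,4) by (cases "v \<in> Y") (simp_all add: lookup_add expos_lookup)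
  qed
  define F where "F b = {a \<in> expos X. int (tdeg a) = A - int (y_weight p b)}" for b
  have F: "F b = (if A - int (y_weight p b) < 0 then {} else expos_deg X (nat (A - int (y_weight p b))))" for b
    by (auto simp: F_def expos_deg_def)
  have cardF: "card (F b) = free_hilbert (card X) (A - int (y_weight p b))" for b
    using card_expos_deg[OF XY(3)] by (simp add: F)
  show ?thesis
  proof (cases "K < 0")
    case True
    have "bideg p s \<noteq> (A, K)" if "s \<in> expos U" for s
    proof -
      have "s \<in> expos (X \<union> Y)" using that XY(1) by simp
      then obtain a b where "a \<in> expos X" "b \<in> expos Y" "s = a + b" by (rule expos_Un_split)
      then show ?thesis using True bd by auto
    qed
    then have e: "{s \<in> expos U. bideg p s = (A, K)} = {}" by auto
    show ?thesis unfolding e using True by simp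
  next
    case False
    have "{s \<in> expos U. bideg p s = (A, K)} = (\<Union>b\<in>expos_deg Y (nat K). (\<lambda>a. a + b) ` F b)"
    proof (intro equalityI subsetI)
      fix s assume s: "s \<in> {s \<in> expos U. bideg p s = (A, K)}"
      then have "s \<in> expos (X \<union> Y)" using XY(1) by simp
      then obtain a b where ab: "a \<in> expos X" "b \<in> expos Y" "s = a + b" by (rule expos_Un_split)
      then have "int (tdeg a) + int (y_weight p b) = A" "int (tdeg b) = K" using s bd by auto
      then show "s \<in> (\<Union>b\<in>expos_deg Y (nat K). (\<lambda>a. a + b) ` F b)"
        using ab by (auto simp: F_def expos_deg_def)
    next
      fix s assume "s \<in> (\<Union>b\<in>expos_deg Y (nat K). (\<lambda>a. a + b) ` F b)"
      then obtain a b where ab: "a \<in> expos X" "int (tdeg a) = A - int (y_weight p b)" "b \<in> expos Y" "tdeg b = nat K" "s = a + b"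
        by (auto simp: F_def expos_deg_def)
      then have "s \<in> expos U" using expos_mono[of X U] expos_mono[of Y U] XY(1) by auto
      moreover have "bideg p s = (A, K)" using ab bd False by simp
      ultimately show "s \<in> {s \<in> expos U. bideg p s = (A, K)}" by simp
    qed
    also have "card \<dots> = (\<Sum>b\<in>expos_deg Y (nat K). card ((\<lambda>a. a + b) ` F b))"
    proof (rule card_UN_disjoint)
      show "finite (expos_deg Y (nat K))" using XY(4) by (rule finite_expos_deg)
      show "\<forall>b\<in>expos_deg Y (nat K). finite ((\<lambda>a. a + b) ` F b)"
        using finite_expos_deg[OF XY(3)] by (auto simp: F)
      show "\<forall>b\<in>expos_deg Y (nat K). \<forall>b'\<in>expos_deg Y (nat K). b \<noteq> b' \<longrightarrow>
          (\<lambda>a. a + b) ` F b \<inter> (\<lambda>a. a + b') ` F b' = {}"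
        using uniq by (auto simp: F_def expos_deg_def)
    qed
    also have "\<dots> = (\<Sum>b\<in>expos_deg Y (nat K). free_hilbert (card X) (A - int (y_weight p b)))"
      by (intro sum.cong refl) (simp add: card_image inj_on_def cardF)
    finally show ?thesis using False by simp
  qed
qed

lemma finite_bideg_fibre:
  assumes "finite U"
  shows "finite {s \<in> expos U. bideg p s = d}"
proof -
  have "{s \<in> expos U. bideg p s = d} \<subseteq> (\<Union>k\<le>nat (fst d) + nat (snd d). expos_deg U k)"
  proof
    fix s assume s: "s \<in> {s \<in> expos U. bideg p s = d}"
    have "s \<in> expos (range Inl \<union> range Inr)" by (auto simp: expos_def) (metis UNIV_I image_eqI sumE)
    then obtain a b where ab: "a \<in> expos (range Inl)" "b \<in> expos (range Inr)" "s = a + b" by (rule expos_Un_split)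
    then have "d = (int (tdeg a) + int (y_weight p b), int (tdeg b))"
      using s bideg_varsS[OF ab(1), of p] bideg_varsY[OF ab(2), of p] by (auto simp: bideg_add plus_prod_def)
    then have "tdeg s \<le> nat (fst d) + nat (snd d)" using ab(3) by simp
    then show "s \<in> (\<Union>k\<le>nat (fst d) + nat (snd d). expos_deg U k)" using s by (auto simp: expos_deg_def)
  qed
  then show ?thesis using finite_expos_deg[OF assms] by (meson finite_UN_I finite_atMost finite_subset)
qed

section \<open>Homogeneous elements of a bigraded module\<close>

lemma ringA_sel:
  "carrier (ringA n m) = polys (varsA n m)" "x \<otimes>\<^bsub>ringA n m\<^esub> y = x * y" "x \<oplus>\<^bsub>ringA n m\<^esub> y = x + y"
  "\<one>\<^bsub>ringA n m\<^esub> = 1" "\<zero>\<^bsub>ringA n m\<^esub> = 0"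
  by (simp_all add: ringA_def poly_ring_sel)

locale bigraded = module "ringA n m" M
  for n m :: nat and M :: "((nat + nat, 'k::field) mpoly, 'b) module" +
  fixes p :: "nat \<Rightarrow> nat" and G :: "int \<times> int \<Rightarrow> 'b set"
  assumes bigraded: "bigraded_module n m p M G"
begin

abbreviation V where "V \<equiv> varsA n m"

lemma finite_V: "finite V"
  by simp

lemma single_carrier [simp]: "t \<in> expos V \<Longrightarrow> single t c \<in> carrier (ringA n m)"
  by (simp add: ringA_sel)

lemma G_subgroup: "subgroup (G d) (add_monoid M)"
  using bigraded unfolding bigraded_module_def by blast

lemma G_carrier [simp]: "w \<in> G d \<Longrightarrow> w \<in> carrier M"
  using subgroup.subset[OF G_subgroup, of d] by auto

lemma G_zero [simp]: "\<zero>\<^bsub>M\<^esub> \<in> G d"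
  using subgroup.one_closed[OF G_subgroup, of d] by simp

lemma G_add [simp]: "v \<in> G d \<Longrightarrow> w \<in> G d \<Longrightarrow> v \<oplus>\<^bsub>M\<^esub> w \<in> G d"
  using subgroup.m_closed[OF G_subgroup, of v d w] by simp

lemma G_finsum: "(\<And>i. i \<in> A \<Longrightarrow> f i \<in> G d) \<Longrightarrow> finsum M f A \<in> G d"
proof (induction A rule: infinite_finite_induct)
  case (insert x F)
  then show ?case by (subst M.finsum_insert) (auto intro: G_carrier[of _ d])
qed auto

lemma bihomogeneous_smult: "f \<in> polys V \<Longrightarrow> (\<And>t. t \<in> keys f \<Longrightarrow> bideg p t = d) \<Longrightarrow> w \<in> G e \<Longrightarrow> f \<odot>\<^bsub>M\<^esub> w \<in> G (d + e)"
proof -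
  assume "f \<in> polys V" "\<And>t. t \<in> keys f \<Longrightarrow> bideg p t = d" and w: "w \<in> G e"
  then have "f \<in> bihomogeneous n m p d" by (simp add: bihomogeneous_def ringA_sel)
  then show "f \<odot>\<^bsub>M\<^esub> w \<in> G (d + e)" using bigraded w unfolding bigraded_module_def by blast
qed

lemma single_smult: "t \<in> expos V \<Longrightarrow> w \<in> G e \<Longrightarrow> single t c \<odot>\<^bsub>M\<^esub> w \<in> G (bideg p t + e)"
  by (rule bihomogeneous_smult) (auto split: if_splits)

lemma scale_G: "w \<in> G e \<Longrightarrow> single 0 c \<odot>\<^bsub>M\<^esub> w \<in> G e"
  using single_smult[of 0 w e c] by simp

lemma single_single_smult:
  "s \<in> expos V \<Longrightarrow> t \<in> expos V \<Longrightarrow> w \<in> carrier M \<Longrightarrow>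
    single s c \<odot>\<^bsub>M\<^esub> (single t d \<odot>\<^bsub>M\<^esub> w) = single (s + t) (c * d) \<odot>\<^bsub>M\<^esub> w"
  using smult_assoc1[of "single s c" "single t d" w] by (simp add: ringA_sel mult_single)

lemma single_add_smult:
  "t \<in> expos V \<Longrightarrow> w \<in> carrier M \<Longrightarrow>
    single t (c + d) \<odot>\<^bsub>M\<^esub> w = single t c \<odot>\<^bsub>M\<^esub> w \<oplus>\<^bsub>M\<^esub> single t d \<odot>\<^bsub>M\<^esub> w"
  using smult_l_distr[of "single t c" "single t d" w] by (simp add: ringA_sel single_add)

lemma zero_smult [simp]: "w \<in> carrier M \<Longrightarrow> 0 \<odot>\<^bsub>M\<^esub> w = \<zero>\<^bsub>M\<^esub>"
  using smult_l_null[of w] by (simp add: ringA_sel)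

lemma sum_smult:
  "w \<in> carrier M \<Longrightarrow> (\<And>i. i \<in> A \<Longrightarrow> f i \<in> polys V) \<Longrightarrow> sum f A \<odot>\<^bsub>M\<^esub> w = (\<Oplus>\<^bsub>M\<^esub>i\<in>A. f i \<odot>\<^bsub>M\<^esub> w)"
proof (induction A rule: infinite_finite_induct)
  case (insert x F)
  then have "f x \<in> carrier (ringA n m)" "sum f F \<in> carrier (ringA n m)"
    by (auto simp: ringA_sel intro: polys_sum)
  with insert have "(f x + sum f F) \<odot>\<^bsub>M\<^esub> w = f x \<odot>\<^bsub>M\<^esub> w \<oplus>\<^bsub>M\<^esub> (\<Oplus>\<^bsub>M\<^esub>i\<in>F. f i \<odot>\<^bsub>M\<^esub> w)"
    using smult_l_distr[of "f x" "sum f F" w] by (simp add: ringA_sel)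
  moreover have "(\<lambda>i. f i \<odot>\<^bsub>M\<^esub> w) \<in> F \<rightarrow> carrier M" "f x \<odot>\<^bsub>M\<^esub> w \<in> carrier M"
    using insert.prems by (auto simp: ringA_sel)
  ultimately show ?case
    using insert.hyps by (simp add: M.finsum_insert)
qed auto

lemma smult_keys:
  assumes "f \<in> polys V" "w \<in> carrier M"
  shows "f \<odot>\<^bsub>M\<^esub> w = (\<Oplus>\<^bsub>M\<^esub>t\<in>keys f. single t (lookup f t) \<odot>\<^bsub>M\<^esub> w)"
proof -
  have f: "f = (\<Sum>t\<in>keys f. single t (lookup f t))"
    by (intro poly_mapping_eqI) (simp add: lookup_sum lookup_single when_def in_keys_iff)
  have "(\<Sum>t\<in>keys f. single t (lookup f t)) \<odot>\<^bsub>M\<^esub> w = (\<Oplus>\<^bsub>M\<^esub>t\<in>keys f. single t (lookup f t) \<odot>\<^bsub>M\<^esub> w)"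
    using assms by (intro sum_smult) (auto simp: polys_def)
  then show ?thesis using f by simp
qed

lemma finsum_pad:
  assumes "finite B" "A \<subseteq> B" "\<And>i. i \<in> A \<Longrightarrow> f i \<in> carrier M"
  shows "finsum M (\<lambda>i. if i \<in> A then f i else \<zero>\<^bsub>M\<^esub>) B = finsum M f A"
  using assms by (intro M.add.finprod_mono_neutral_cong_right) (auto split: if_splits)

text \<open>This lemma and \<open>graded_decomposition\<close> restate the existence and uniqueness of homogeneous components
for sums over a prescribed finite index set.\<close>

lemma graded_unique:
  assumes D: "finite D" and f: "\<And>d. d \<in> D \<Longrightarrow> f d \<in> G d" and g: "\<And>d. d \<in> D \<Longrightarrow> g d \<in> G d"
    and eq: "finsum M f D = finsum M g D" and d: "d \<in> D"
  shows "f d = g d"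
proof -
  define w where "w = finsum M f D"
  have w: "w \<in> carrier M" unfolding w_def by (intro M.finsum_closed funcsetI G_carrier[OF f])
  have uniq: "\<exists>!c. (\<forall>d. c d \<in> G d) \<and> finite {d. c d \<noteq> \<zero>\<^bsub>M\<^esub>} \<and> w = finsum M c {d. c d \<noteq> \<zero>\<^bsub>M\<^esub>}"
    using bigraded w unfolding bigraded_module_def by blast
  define ext where "ext h d = (if d \<in> D then h d else \<zero>\<^bsub>M\<^esub>)" for h :: "int \<times> int \<Rightarrow> 'b" and d
  have "(\<forall>d. ext h d \<in> G d) \<and> finite {d. ext h d \<noteq> \<zero>\<^bsub>M\<^esub>} \<and> w = finsum M (ext h) {d. ext h d \<noteq> \<zero>\<^bsub>M\<^esub>}"
    if h: "\<And>d. d \<in> D \<Longrightarrow> h d \<in> G d" and wh: "w = finsum M h D" for h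
  proof (intro conjI)
    show "\<forall>d. ext h d \<in> G d" using h by (simp add: ext_def)
    have sub: "{d. ext h d \<noteq> \<zero>\<^bsub>M\<^esub>} \<subseteq> D" by (auto simp: ext_def)
    then show "finite {d. ext h d \<noteq> \<zero>\<^bsub>M\<^esub>}" using D finite_subset by blast
    show "w = finsum M (ext h) {d. ext h d \<noteq> \<zero>\<^bsub>M\<^esub>}"
      unfolding wh
      by (rule M.add.finprod_mono_neutral_cong_right[OF D sub, simplified])
        (auto simp: ext_def split: if_splits intro: G_carrier[OF h])
  qed
  from this[OF f w_def] this[OF g] have "ext f = ext g"
    using uniq eq w_def by metis
  then have "ext f d = ext g d" by simp
  then show ?thesis using d by (simp add: ext_def)
qed

lemma graded_decomposition:
  assumes "w \<in> carrier M"
  obtains D f where "finite D" "\<And>d. d \<in> D \<Longrightarrow> f d \<in> G d" "w = finsum M f D"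
proof -
  have "\<exists>!c. (\<forall>d. c d \<in> G d) \<and> finite {d. c d \<noteq> \<zero>\<^bsub>M\<^esub>} \<and> w = finsum M c {d. c d \<noteq> \<zero>\<^bsub>M\<^esub>}"
    using bigraded assms unfolding bigraded_module_def by blast
  then show ?thesis using that by (elim ex1E conjE) blast
qed

end

section \<open>Homogeneous generators\<close>

text \<open>The \<open>K\<close>-span of the terms of bidegree \<open>d\<close>.  The inductive form reduces statements about it to
single terms.\<close>

inductive_set (in bigraded) hspan :: "nat \<Rightarrow> (nat \<Rightarrow> 'b) \<Rightarrow> (nat \<Rightarrow> int \<times> int) \<Rightarrow> int \<times> int \<Rightarrow> 'b set"
  for g :: nat and x :: "nat \<Rightarrow> 'b" and \<delta> :: "nat \<Rightarrow> int \<times> int" and d :: "int \<times> int"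
  where
    hspan_zero: "\<zero>\<^bsub>M\<^esub> \<in> hspan g x \<delta> d"
  | hspan_term: "e < g \<Longrightarrow> t \<in> expos V \<Longrightarrow> \<delta> e + bideg p t = d \<Longrightarrow> single t c \<odot>\<^bsub>M\<^esub> x e \<in> hspan g x \<delta> d"
  | hspan_add: "v \<in> hspan g x \<delta> d \<Longrightarrow> w \<in> hspan g x \<delta> d \<Longrightarrow> v \<oplus>\<^bsub>M\<^esub> w \<in> hspan g x \<delta> d"

context bigraded
begin

lemma hspan_G:
  assumes x: "\<And>e. e < g \<Longrightarrow> x e \<in> G (\<delta> e)" and w: "w \<in> hspan g x \<delta> d"
  shows "w \<in> G d"
  using w
proof induction
  case (hspan_term e t c)
  then show ?case using single_smult[of t "x e" "\<delta> e" c] x by (simp add: add.commute)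
qed auto

text \<open>The homogeneous components of the given generators generate as well.  The sums of elements of the
sets \<open>hspan\<close> exhaust \<open>M\<close>, and comparing components in degree \<open>d\<close> shows that \<open>hspan\<close> is all of
\<open>G d\<close>.\<close>

lemma homogeneous_generators:
  assumes fg: "finitely_generated (ringA n m) M"
  obtains g :: nat and x and \<delta> where "\<And>e. e < g \<Longrightarrow> x e \<in> G (\<delta> e)" "\<And>d. G d = hspan g x \<delta> d"
proof -
  obtain B where B: "finite B" "B \<subseteq> carrier M" "span B = carrier M"
    using fg by (auto simp: finitely_generated_def)
  have "\<forall>b\<in>B. \<exists>D f. finite D \<and> (\<forall>d\<in>D. f d \<in> G d) \<and> b = finsum M f D"
  proof
    fix b assume "b \<in> B"
    then have "b \<in> carrier M" using B(2) by blast
    then obtain D f where "finite D" "\<And>d. d \<in> D \<Longrightarrow> f d \<in> G d" "b = finsum M f D"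
      by (rule graded_decomposition) blast
    then show "\<exists>D f. finite D \<and> (\<forall>d\<in>D. f d \<in> G d) \<and> b = finsum M f D" by blast
  qed
  then obtain D f where Df: "\<forall>b\<in>B. finite (D b) \<and> (\<forall>d\<in>D b. f b d \<in> G d) \<and> b = finsum M (f b) (D b)"
    by metis
  define gens where "gens = (\<Union>b\<in>B. (\<lambda>d. (f b d, d)) ` D b)"
  have "finite gens" using B(1) Df by (auto simp: gens_def)
  then obtain xs where xs: "set xs = gens" using finite_list by blast
  define g where "g = length xs"
  define x where "x e = fst (xs ! e)" for e
  define \<delta> where "\<delta> e = snd (xs ! e)" for e
  have x: "x e \<in> G (\<delta> e)" if "e < g" for e
  proof -
    have "xs ! e \<in> gens" using that xs by (auto simp: g_def)
    then show ?thesis using Df by (auto simp: gens_def x_def \<delta>_def)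
  qed
  have gen: "\<exists>e<g. x e = f b d \<and> \<delta> e = d" if "b \<in> B" "d \<in> D b" for b d
  proof -
    have "(f b d, d) \<in> set xs" using that by (auto simp: xs gens_def)
    then obtain e where "e < length xs" "xs ! e = (f b d, d)" by (auto simp: in_set_conv_nth)
    then show ?thesis by (auto simp: g_def x_def \<delta>_def)
  qed
  (* H will turn out to be all of M *)
  define H where "H = {w. \<exists>D f. finite D \<and> (\<forall>d\<in>D. f d \<in> hspan g x \<delta> d) \<and> w = finsum M f D}"
  have hspan_carrier: "w \<in> carrier M" if "w \<in> hspan g x \<delta> d" for w d
    using hspan_G[OF x that] by simp
  have H_zero: "\<zero>\<^bsub>M\<^esub> \<in> H"
    unfolding H_def by (intro CollectI exI[of _ "{}"]) auto
  have H_hspan: "w \<in> H" if w: "w \<in> hspan g x \<delta> d" for w d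
    unfolding H_def
    using hspan_carrier[OF w] w by (intro CollectI exI[of _ "{d}"] exI[of _ "\<lambda>_. w"]) (auto simp: M.finsum_insert)
  have H_add: "v \<oplus>\<^bsub>M\<^esub> w \<in> H" if vw: "v \<in> H" "w \<in> H" for v w
  proof -
    obtain D f E h where D: "finite D" "\<forall>d\<in>D. f d \<in> hspan g x \<delta> d" "v = finsum M f D"
      and E: "finite E" "\<forall>d\<in>E. h d \<in> hspan g x \<delta> d" "w = finsum M h E"
      using vw by (auto simp: H_def)
    define f' where "f' d = (if d \<in> D then f d else \<zero>\<^bsub>M\<^esub>)" for d
    define h' where "h' d = (if d \<in> E then h d else \<zero>\<^bsub>M\<^esub>)" for d
    have "v = finsum M f' (D \<union> E)" "w = finsum M h' (D \<union> E)"
      unfolding D(3) E(3) f'_def h'_def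
      using D E hspan_carrier by (intro finsum_pad[symmetric]; fastforce)+
    moreover have fh: "f' d \<in> hspan g x \<delta> d" "h' d \<in> hspan g x \<delta> d" for d
      using D E by (auto simp: f'_def h'_def intro: hspan_zero)
    moreover have "finsum M (\<lambda>d. f' d \<oplus>\<^bsub>M\<^esub> h' d) (D \<union> E) = finsum M f' (D \<union> E) \<oplus>\<^bsub>M\<^esub> finsum M h' (D \<union> E)"
      by (intro M.finsum_addf funcsetI hspan_carrier[OF fh(1)] hspan_carrier[OF fh(2)])
    ultimately have "v \<oplus>\<^bsub>M\<^esub> w = finsum M (\<lambda>d. f' d \<oplus>\<^bsub>M\<^esub> h' d) (D \<union> E)"
      by simp
    moreover have "\<forall>d\<in>D \<union> E. f' d \<oplus>\<^bsub>M\<^esub> h' d \<in> hspan g x \<delta> d" using fh by (auto intro: hspan_add)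
    moreover have "finite (D \<union> E)" using D(1) E(1) by simp
    ultimately show ?thesis unfolding H_def
      by (intro CollectI exI[of _ "D \<union> E"] exI[of _ "\<lambda>d. f' d \<oplus>\<^bsub>M\<^esub> h' d"] conjI)
  qed
  have H_carrier: "w \<in> carrier M" if "w \<in> H" for w
    using that hspan_carrier by (auto simp: H_def intro!: M.finsum_closed)
  have H_finsum: "finsum M h A \<in> H" if "\<And>i. i \<in> A \<Longrightarrow> h i \<in> H" for h and A :: "'c set"
    using that
  proof (induction A rule: infinite_finite_induct)
    case (insert i A)
    then show ?case using H_carrier by (subst M.finsum_insert) (auto intro: H_add)
  qed (auto intro: H_zero)
  have H_all: "w \<in> H" if w: "w \<in> carrier M" for w
  proof -
    have "\<exists>a A. w = lincomb a A \<and> finite A \<and> A \<subseteq> B \<and> a \<in> A \<rightarrow> carrier (ringA n m)"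
      using w B(3) unfolding span_def by blast
    then obtain a A where a: "finite A" "A \<subseteq> B" "a \<in> A \<rightarrow> carrier (ringA n m)" "w = lincomb a A"
      by blast
    have "a b \<odot>\<^bsub>M\<^esub> b \<in> H" if b: "b \<in> A" for b
    proof -
      have bB: "b \<in> B" "b \<in> carrier M" using b a(2) B(2) by auto
      have ab: "a b \<in> polys V" using a(3) b by (auto simp: ringA_sel)
      have "single t c \<odot>\<^bsub>M\<^esub> b \<in> H" if t: "t \<in> expos V" for t c
      proof -
        have D: "finite (D b)" "\<forall>d\<in>D b. f b d \<in> G d" "b = finsum M (f b) (D b)" using Df bB by auto
        have "single t c \<odot>\<^bsub>M\<^esub> finsum M (f b) (D b) = (\<Oplus>\<^bsub>M\<^esub>d\<in>D b. single t c \<odot>\<^bsub>M\<^esub> f b d)"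
          using D t by (intro finsum_smult_ldistr) auto
        also have "\<dots> \<in> H"
        proof (rule H_finsum)
          fix d assume "d \<in> D b"
          then obtain e where e: "e < g" "x e = f b d" using gen[OF bB(1)] by blast
          then show "single t c \<odot>\<^bsub>M\<^esub> f b d \<in> H"
            using H_hspan[OF hspan_term[OF e(1) t refl]] by simp
        qed
        finally show ?thesis using D(3) by simp
      qed
      then show ?thesis
        unfolding smult_keys[OF ab bB(2)] using ab by (intro H_finsum) (auto simp: polys_def)
    qed
    then show ?thesis unfolding a(4) lincomb_def by (rule H_finsum)
  qed
  have "G d \<subseteq> hspan g x \<delta> d" for d
  proof
    fix w assume w: "w \<in> G d"
    then obtain D f where D: "finite D" "\<forall>d\<in>D. f d \<in> hspan g x \<delta> d" "w = finsum M f D"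
      using H_all[of w] by (auto simp: H_def)
    define f' where "f' c = (if c \<in> D then f c else \<zero>\<^bsub>M\<^esub>)" for c
    define w' where "w' c = (if c \<in> {d} then w else \<zero>\<^bsub>M\<^esub>)" for c
    have f': "f' c \<in> hspan g x \<delta> c" for c using D by (auto simp: f'_def intro: hspan_zero)
    have "finsum M f' (insert d D) = w"
      unfolding D(3) f'_def using D hspan_carrier by (intro finsum_pad) auto
    moreover have "finsum M w' (insert d D) = w"
    proof -
      have "finsum M w' (insert d D) = finsum M (\<lambda>_. w) {d}"
        unfolding w'_def using D(1) w by (intro finsum_pad) auto
      then show ?thesis using w by (simp add: M.finsum_insert)
    qed
    ultimately have "f' d = w' d"
      using graded_unique[of "insert d D" f' w' d] hspan_G[OF x f'] D(1) w by (auto simp: w'_def)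
    then show "w \<in> hspan g x \<delta> d" using f'[of d] by (simp add: w'_def)
  qed
  moreover have "hspan g x \<delta> d \<subseteq> G d" for d by (intro subsetI hspan_G[OF x])
  ultimately have "G d = hspan g x \<delta> d" for d by blast
  then show ?thesis using that x by blast
qed

end

section \<open>Standard terms\<close>

text \<open>A bigraded module with a list of homogeneous generators \<open>x e\<close> of degrees \<open>\<delta> e\<close>; a term is a
monomial applied to one of them.\<close>

locale generated = bigraded n m M p G
  for n m :: nat and M :: "((nat + nat, 'k::field) mpoly, 'b) module"
    and p :: "nat \<Rightarrow> nat" and G :: "int \<times> int \<Rightarrow> 'b set" +
  fixes g :: nat and x :: "nat \<Rightarrow> 'b" and \<delta> :: "nat \<Rightarrow> int \<times> int"
  assumes gens: "\<And>e. e < g \<Longrightarrow> x e \<in> G (\<delta> e)"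
    and G_eq: "\<And>d. G d = hspan g x \<delta> d"
begin

definition terms :: "int \<times> int \<Rightarrow> (nat \<times> (nat + nat \<Rightarrow>\<^sub>0 nat)) set" where
  "terms d = {(e, t). e < g \<and> t \<in> expos V \<and> \<delta> e + bideg p t = d}"

definition term_val :: "nat \<times> (nat + nat \<Rightarrow>\<^sub>0 nat) \<Rightarrow> 'k \<Rightarrow> 'b" where
  "term_val \<tau> c = single (snd \<tau>) c \<odot>\<^bsub>M\<^esub> x (fst \<tau>)"

definition term_sum :: "int \<times> int \<Rightarrow> (nat \<times> (nat + nat \<Rightarrow>\<^sub>0 nat) \<Rightarrow> 'k) \<Rightarrow> 'b" where
  "term_sum d f = (\<Oplus>\<^bsub>M\<^esub>\<tau>\<in>terms d. term_val \<tau> (f \<tau>))"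

definition relations :: "int \<times> int \<Rightarrow> (nat \<times> (nat + nat \<Rightarrow>\<^sub>0 nat) \<Rightarrow> 'k) set" where
  "relations d = {f. term_sum d f = \<zero>\<^bsub>M\<^esub>}"

definition key :: "nat \<times> (nat + nat \<Rightarrow>\<^sub>0 nat) \<Rightarrow> (nat \<Rightarrow>\<^sub>0 nat)" where
  "key \<tau> = single 0 (fst \<tau>) + monomial_key V (snd \<tau>)"

definition standard :: "int \<times> int \<Rightarrow> (nat \<times> (nat + nat \<Rightarrow>\<^sub>0 nat)) set" where
  "standard d = terms d - leading key (terms d) (relations d)"

lemma gens_carrier: "e < g \<Longrightarrow> x e \<in> carrier M"
  using gens by (rule G_carrier)

lemma finite_terms: "finite (terms d)"
proof -
  have "terms d \<subseteq> (\<Union>e<g. Pair e ` {t \<in> expos V. bideg p t = d - \<delta> e})"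
    by (auto simp: terms_def)
  moreover have "finite (\<Union>e<g. Pair e ` {t \<in> expos V. bideg p t = d - \<delta> e})"
    using finite_bideg_fibre[OF finite_V] by simp
  ultimately show ?thesis by (rule finite_subset)
qed

lemma inj_on_key: "inj_on key (terms d)"
proof (rule inj_onI)
  fix \<sigma> \<tau> assume \<sigma>: "\<sigma> \<in> terms d" and \<tau>: "\<tau> \<in> terms d" and eq: "key \<sigma> = key \<tau>"
  then have "lookup (key \<sigma>) 0 = lookup (key \<tau>) 0" by simp
  then have fst: "fst \<sigma> = fst \<tau>" by (simp add: key_def lookup_add lookup_monomial_key_0)
  then have "monomial_key V (snd \<sigma>) = monomial_key V (snd \<tau>)" using eq by (simp add: key_def)
  then have "snd \<sigma> = snd \<tau>"
    by (rule inj_onD[OF inj_on_monomial_key[OF finite_V]]) (use \<sigma> \<tau> in \<open>auto simp: terms_def\<close>)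
  then show "\<sigma> = \<tau>" using fst by (simp add: prod_eqI)
qed

lemma term_val_G: "\<tau> \<in> terms d \<Longrightarrow> term_val \<tau> c \<in> G d"
  using single_smult[of "snd \<tau>" "x (fst \<tau>)" "\<delta> (fst \<tau>)" c] gens
  by (auto simp: terms_def term_val_def add.commute)

lemma term_val_carrier: "\<tau> \<in> terms d \<Longrightarrow> term_val \<tau> c \<in> carrier M"
  using term_val_G by (rule G_carrier)

lemma term_val_funcset: "A \<subseteq> terms d \<Longrightarrow> (\<lambda>\<tau>. term_val \<tau> (f \<tau>)) \<in> A \<rightarrow> carrier M"
  using term_val_carrier by blast

lemma term_val_add: "\<tau> \<in> terms d \<Longrightarrow> term_val \<tau> (a + b) = term_val \<tau> a \<oplus>\<^bsub>M\<^esub> term_val \<tau> b"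
  using gens_carrier by (auto simp: terms_def term_val_def single_add_smult)

lemma term_val_zero: "\<tau> \<in> terms d \<Longrightarrow> term_val \<tau> 0 = \<zero>\<^bsub>M\<^esub>"
  using gens_carrier by (auto simp: terms_def term_val_def)

lemma single_term_val:
  "\<tau> \<in> terms d \<Longrightarrow> s \<in> expos V \<Longrightarrow> single s c \<odot>\<^bsub>M\<^esub> term_val \<tau> a = term_val (fst \<tau>, s + snd \<tau>) (c * a)"
  using gens_carrier by (auto simp: terms_def term_val_def single_single_smult)

lemma term_sum_G: "term_sum d f \<in> G d"
  unfolding term_sum_def by (intro G_finsum term_val_G)

lemma term_sum_carrier: "term_sum d f \<in> carrier M"
  using term_sum_G by (rule G_carrier)

lemma term_sum_cong: "(\<And>\<tau>. \<tau> \<in> terms d \<Longrightarrow> f \<tau> = h \<tau>) \<Longrightarrow> term_sum d f = term_sum d h"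
  unfolding term_sum_def by (intro M.finsum_cong' term_val_funcset) auto

lemma term_sum_add: "term_sum d (\<lambda>\<tau>. f \<tau> + h \<tau>) = term_sum d f \<oplus>\<^bsub>M\<^esub> term_sum d h"
proof -
  have "term_sum d (\<lambda>\<tau>. f \<tau> + h \<tau>) = (\<Oplus>\<^bsub>M\<^esub>\<tau>\<in>terms d. term_val \<tau> (f \<tau>) \<oplus>\<^bsub>M\<^esub> term_val \<tau> (h \<tau>))"
    unfolding term_sum_def
    by (intro M.finsum_cong' refl) (auto simp: term_val_add intro!: M.add.m_closed term_val_carrier)
  then show ?thesis
    unfolding term_sum_def using term_val_funcset[OF order_refl] by (simp only: M.finsum_addf)
qed

lemma term_sum_smult: "term_sum d (\<lambda>\<tau>. c * f \<tau>) = single 0 c \<odot>\<^bsub>M\<^esub> term_sum d f"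
proof -
  have "single 0 c \<odot>\<^bsub>M\<^esub> term_sum d f = (\<Oplus>\<^bsub>M\<^esub>\<tau>\<in>terms d. single 0 c \<odot>\<^bsub>M\<^esub> term_val \<tau> (f \<tau>))"
    unfolding term_sum_def by (intro finsum_smult_ldistr finite_terms term_val_funcset) auto
  also have "\<dots> = term_sum d (\<lambda>\<tau>. c * f \<tau>)"
    unfolding term_sum_def by (intro M.finsum_cong' term_val_funcset[OF order_refl] refl) (simp add: single_term_val)
  finally show ?thesis by simp
qed

lemma term_sum_zero: "term_sum d (\<lambda>_. 0) = \<zero>\<^bsub>M\<^esub>"
  unfolding term_sum_def by (intro M.add.finprod_one_eqI term_val_zero)

lemma term_sum_surj:
  assumes "w \<in> G d"
  obtains f where "w = term_sum d f"
proof -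
  have "\<exists>f. w = term_sum d f" using assms[unfolded G_eq]
  proof induction
    case hspan_zero
    then show ?case using term_sum_zero by metis
  next
    case (hspan_term e t c)
    then have \<tau>: "(e, t) \<in> terms d" by (simp add: terms_def)
    have "term_sum d (\<lambda>\<tau>. if (e, t) = \<tau> then c else 0) =
        (\<Oplus>\<^bsub>M\<^esub>\<tau>\<in>terms d. if (e, t) = \<tau> then term_val \<tau> c else \<zero>\<^bsub>M\<^esub>)"
      unfolding term_sum_def by (intro M.finsum_cong' refl) (auto simp: term_val_zero term_val_carrier)
    also have "\<dots> = term_val (e, t) c"
      using M.finsum_singleton[OF \<tau> finite_terms, of "\<lambda>\<tau>. term_val \<tau> c"] term_val_carrier by blast
    finally have "single t c \<odot>\<^bsub>M\<^esub> x e = term_sum d (\<lambda>\<tau>. if (e, t) = \<tau> then c else 0)"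
      by (simp add: term_val_def)
    then show ?case by blast
  next
    case (hspan_add v w)
    then show ?case using term_sum_add by metis
  qed
  then show ?thesis using that by blast
qed

lemma relations_space:
  "(\<lambda>_. 0) \<in> relations d"
  "f \<in> relations d \<Longrightarrow> h \<in> relations d \<Longrightarrow> (\<lambda>\<tau>. f \<tau> + c * h \<tau>) \<in> relations d"
proof -
  show "(\<lambda>_. 0) \<in> relations d" by (simp add: relations_def term_sum_zero)
  show "(\<lambda>\<tau>. f \<tau> + c * h \<tau>) \<in> relations d" if "f \<in> relations d" "h \<in> relations d"
    using that term_sum_add[of d f "\<lambda>\<tau>. c * h \<tau>"] by (simp add: relations_def term_sum_smult)
qed

lemma term_sum_reduce:
  "\<exists>h. term_sum d h = term_sum d f \<and> (\<forall>\<tau>\<in>terms d. \<tau> \<notin> standard d \<longrightarrow> h \<tau> = 0)"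
proof -
  obtain r where r: "r \<in> relations d" "\<forall>\<tau>\<in>leading key (terms d) (relations d). f \<tau> = r \<tau>"
    using reduce_leading[OF finite_terms inj_on_key relations_space] by blast
  have "term_sum d (\<lambda>\<tau>. f \<tau> + - 1 * r \<tau>) = term_sum d f \<oplus>\<^bsub>M\<^esub> single 0 (- 1) \<odot>\<^bsub>M\<^esub> term_sum d r"
    by (simp only: term_sum_add term_sum_smult)
  also have "\<dots> = term_sum d f" using r(1) by (simp add: relations_def term_sum_carrier)
  finally show ?thesis using r(2) by (intro exI[of _ "\<lambda>\<tau>. f \<tau> + - 1 * r \<tau>"]) (auto simp: standard_def)
qed

lemma term_sum_standard_zero:
  assumes "term_sum d f = \<zero>\<^bsub>M\<^esub>" "\<And>\<tau>. \<tau> \<in> terms d \<Longrightarrow> \<tau> \<notin> standard d \<Longrightarrow> f \<tau> = 0" "\<tau> \<in> terms d"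
  shows "f \<tau> = 0"
proof -
  have "f \<in> relations d" using assms(1) by (simp add: relations_def)
  moreover have "f \<sigma> = 0" if "\<sigma> \<in> leading key (terms d) (relations d)" for \<sigma>
  proof (rule assms(2))
    show "\<sigma> \<in> terms d" using that by (simp add: leading_def)
    show "\<sigma> \<notin> standard d" using that by (simp add: standard_def)
  qed
  ultimately show ?thesis
    using leading_eq_zero[OF finite_terms relations_space] assms(3) by blast
qed

text \<open>A relation multiplied by a monomial is a relation, and the order is compatible with
multiplication.\<close>

lemma leading_shift:
  assumes "(e, t) \<in> leading key (terms d) (relations d)" "s \<in> expos V"
  shows "(e, s + t) \<in> leading key (terms (d + bideg p s)) (relations (d + bideg p s))"
proof -
  let ?d = "d + bideg p s"
  obtain f where f: "(e, t) \<in> terms d" "f \<in> relations d" "f (e, t) = 1"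
    "\<And>\<sigma>. \<sigma> \<in> terms d \<Longrightarrow> f \<sigma> \<noteq> 0 \<Longrightarrow> key \<sigma> \<le> key (e, t)"
    using assms(1) by (auto simp: leading_def)
  define sh where "sh \<tau> = (fst \<tau>, s + snd \<tau>)" for \<tau> :: "nat \<times> (nat + nat \<Rightarrow>\<^sub>0 nat)"
  define h where "h \<tau> = (if \<tau> \<in> sh ` terms d then f (fst \<tau>, snd \<tau> - s) else 0)" for \<tau>
  have sub: "sh ` terms d \<subseteq> terms ?d"
    using assms(2) by (auto simp: sh_def terms_def bideg_add add.assoc add.commute add.left_commute)
  have inj: "inj_on sh (terms d)" by (auto simp: inj_on_def sh_def)
  have h_sh: "h (sh \<tau>) = f \<tau>" if "\<tau> \<in> terms d" for \<tau>
    using that by (simp add: h_def) (simp add: sh_def)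
  have "term_sum ?d h = (\<Oplus>\<^bsub>M\<^esub>\<tau>\<in>sh ` terms d. term_val \<tau> (h \<tau>))"
    unfolding term_sum_def
    by (rule M.add.finprod_mono_neutral_cong_right[OF finite_terms sub, simplified])
      (auto simp: h_def term_val_zero term_val_carrier)
  also have "\<dots> = (\<Oplus>\<^bsub>M\<^esub>\<tau>\<in>terms d. term_val (sh \<tau>) (h (sh \<tau>)))"
    by (rule M.finsum_reindex[OF term_val_funcset[OF sub] inj])
  also have "\<dots> = (\<Oplus>\<^bsub>M\<^esub>\<tau>\<in>terms d. single s 1 \<odot>\<^bsub>M\<^esub> term_val \<tau> (f \<tau>))"
  proof (intro M.finsum_cong' refl)
    show "(\<lambda>\<tau>. single s 1 \<odot>\<^bsub>M\<^esub> term_val \<tau> (f \<tau>)) \<in> terms d \<rightarrow> carrier M"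
      using assms(2) by (auto intro!: smult_closed term_val_carrier)
    show "term_val (sh \<tau>) (h (sh \<tau>)) = single s 1 \<odot>\<^bsub>M\<^esub> term_val \<tau> (f \<tau>)" if "\<tau> \<in> terms d" for \<tau>
      unfolding h_sh[OF that] single_term_val[OF that assms(2)] by (simp add: sh_def)
  qed
  also have "\<dots> = single s 1 \<odot>\<^bsub>M\<^esub> term_sum d f"
    unfolding term_sum_def using assms(2) by (intro finsum_smult_ldistr[symmetric] finite_terms term_val_funcset) auto
  also have "\<dots> = \<zero>\<^bsub>M\<^esub>" using f(2) assms(2) by (simp add: relations_def)
  finally have "h \<in> relations ?d" by (simp add: relations_def)
  moreover have "h (e, s + t) = 1" using h_sh[OF f(1)] f(3) by (simp add: sh_def)
  moreover have "key \<sigma> \<le> key (e, s + t)" if "h \<sigma> \<noteq> 0" for \<sigma>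
  proof -
    have "\<sigma> \<in> sh ` terms d" using that by (auto simp: h_def split: if_splits)
    then obtain \<tau> where \<tau>: "\<tau> \<in> terms d" "\<sigma> = sh \<tau>" by blast
    then have "key \<tau> \<le> key (e, t)" using f(4) h_sh that by auto
    then have "monomial_key V s + key \<tau> \<le> monomial_key V s + key (e, t)" by (rule add_left_mono)
    then show ?thesis by (simp add: \<tau>(2) key_def sh_def monomial_key_add add.left_commute)
  qed
  moreover have "(e, s + t) \<in> terms ?d" using sub f(1) by (force simp: sh_def)
  ultimately show ?thesis unfolding leading_def by blast
qed

definition standard_expos :: "nat \<Rightarrow> (nat + nat \<Rightarrow>\<^sub>0 nat) set" where
  "standard_expos e = {t \<in> expos V. (e, t) \<in> standard (\<delta> e + bideg p t)}"

lemma downset_standard_expos: "downset V (standard_expos e)"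
proof -
  have "s \<in> standard_expos e" if st: "s + t \<in> standard_expos e" for s t
  proof (rule ccontr)
    assume no: "s \<notin> standard_expos e"
    have e: "e < g" "s \<in> expos V" "t \<in> expos V" using st by (auto simp: standard_expos_def standard_def terms_def)
    then have "(e, s) \<in> leading key (terms (\<delta> e + bideg p s)) (relations (\<delta> e + bideg p s))"
      using no by (auto simp: standard_expos_def standard_def terms_def)
    from leading_shift[OF this e(3)] st show False
      by (simp add: standard_expos_def standard_def bideg_add ac_simps)
  qed
  moreover have "standard_expos e \<subseteq> expos V" by (auto simp: standard_expos_def)
  ultimately show ?thesis unfolding downset_def by blast
qed

lemma standard_eq: "standard d = (SIGMA e:{..<g}. {t \<in> standard_expos e. bideg p t = d - \<delta> e})"
  by (auto simp: standard_def standard_expos_def terms_def)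

section \<open>Dimensions of the homogeneous components\<close>

text \<open>The definition of \<open>finsum\<close> refers to the carrier, but the value of a sum does not depend on it.\<close>

lemma finsum_component_space:
  assumes "f \<in> A \<rightarrow> G d"
  shows "finsum (component_space M (G d)) f A = finsum M f A"
proof -
  interpret C: abelian_monoid "component_space M (G d)"
    by (unfold_locales) (auto simp: component_space_def M.a_assoc M.a_comm M.a_lcomm)
  show ?thesis using assms
  proof (induction A rule: infinite_finite_induct)
    case (infinite A)
    then show ?case by (simp add: finsum_def finprod_def component_space_def)
  next
    case empty
    then show ?case by (simp only: C.finsum_empty M.finsum_empty) (simp add: component_space_def)
  next
    case (insert a A)
    have "finsum (component_space M (G d)) f (insert a A) = f a \<oplus>\<^bsub>component_space M (G d)\<^esub> finsum (component_space M (G d)) f A"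
      using insert by (intro C.finsum_insert) (auto simp: component_space_def)
    also have "\<dots> = f a \<oplus>\<^bsub>M\<^esub> finsum M f A" using insert by (simp add: component_space_def)
    also have "\<dots> = finsum M f (insert a A)"
      using insert by (intro M.finsum_insert[symmetric]) (auto intro: G_carrier[of _ d])
    finally show ?case .
  qed
qed

lemma vectorspace_component: "vectorspace (class_ring :: 'k ring) (component_space M (G d))"
proof (rule vs_criteria)
  show "field (class_ring :: 'k ring)" by (rule class_field)
  have inv: "\<exists>w\<in>G d. v \<oplus>\<^bsub>M\<^esub> w = \<zero>\<^bsub>M\<^esub>" if "v \<in> G d" for v
    using subgroup.m_inv_closed[OF G_subgroup that] M.r_neg[OF G_carrier[OF that]]
    by (intro bexI[of _ "\<ominus>\<^bsub>M\<^esub> v"]) (auto simp: a_inv_def)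
  then show "\<forall>v\<in>carrier (component_space M (G d)). \<exists>neg_v\<in>carrier (component_space M (G d)).
      v \<oplus>\<^bsub>component_space M (G d)\<^esub> neg_v = \<zero>\<^bsub>component_space M (G d)\<^esub>"
    by (simp add: component_space_def)
  have c[simp]: "v \<in> carrier M" if "v \<in> G d" for v using that by (rule G_carrier)
  have one: "single 0 1 \<odot>\<^bsub>M\<^esub> v = v" if "v \<in> G d" for v
    using smult_one[of v] that by (simp add: ringA_sel)
  have mult: "single 0 (a * b) \<odot>\<^bsub>M\<^esub> v = single 0 a \<odot>\<^bsub>M\<^esub> (single 0 b \<odot>\<^bsub>M\<^esub> v)" if "v \<in> G d" for a b v
    using single_single_smult[of 0 0 v a b] that by simp
  have dist: "single 0 a \<odot>\<^bsub>M\<^esub> (v \<oplus>\<^bsub>M\<^esub> w) = single 0 a \<odot>\<^bsub>M\<^esub> v \<oplus>\<^bsub>M\<^esub> single 0 a \<odot>\<^bsub>M\<^esub> w" if "v \<in> G d" "w \<in> G d" for a v w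
    using that by (intro smult_r_distr) auto
  show "\<forall>a b v. a \<in> carrier class_ring \<and> b \<in> carrier class_ring \<and> v \<in> carrier (component_space M (G d)) \<longrightarrow>
      (a \<otimes>\<^bsub>class_ring\<^esub> b) \<odot>\<^bsub>component_space M (G d)\<^esub> v =
      a \<odot>\<^bsub>component_space M (G d)\<^esub> (b \<odot>\<^bsub>component_space M (G d)\<^esub> v)"
    using mult by (simp add: component_space_def)
  show "\<forall>v\<in>carrier (component_space M (G d)). \<one>\<^bsub>class_ring\<^esub> \<odot>\<^bsub>component_space M (G d)\<^esub> v = v"
    using one by (simp add: component_space_def)
  show "\<forall>a b v. a \<in> carrier class_ring \<and> b \<in> carrier class_ring \<and> v \<in> carrier (component_space M (G d)) \<longrightarrow>
      (a \<oplus>\<^bsub>class_ring\<^esub> b) \<odot>\<^bsub>component_space M (G d)\<^esub> v =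
      a \<odot>\<^bsub>component_space M (G d)\<^esub> v \<oplus>\<^bsub>component_space M (G d)\<^esub> b \<odot>\<^bsub>component_space M (G d)\<^esub> v"
    by (simp add: component_space_def single_add_smult)
  show "\<forall>a v w. a \<in> carrier class_ring \<and> v \<in> carrier (component_space M (G d)) \<and> w \<in> carrier (component_space M (G d)) \<longrightarrow>
      a \<odot>\<^bsub>component_space M (G d)\<^esub> (v \<oplus>\<^bsub>component_space M (G d)\<^esub> w) =
      a \<odot>\<^bsub>component_space M (G d)\<^esub> v \<oplus>\<^bsub>component_space M (G d)\<^esub> a \<odot>\<^bsub>component_space M (G d)\<^esub> w"
    using dist by (simp add: component_space_def)
qed (auto simp: component_space_def scale_G M.a_ac)

text \<open>The standard terms give a basis: they generate by \<open>term_sum_reduce\<close> and are independent by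
\<open>term_sum_standard_zero\<close>.\<close>

lemma dim_component: "vectorspace.dim (class_ring :: 'k ring) (component_space M (G d)) = card (standard d)"
proof -
  define C where "C = component_space M (G d)"
  interpret C: vectorspace "class_ring :: 'k ring" C unfolding C_def by (rule vectorspace_component)
  have C: "carrier C = G d" "\<zero>\<^bsub>C\<^esub> = \<zero>\<^bsub>M\<^esub>" "c \<odot>\<^bsub>C\<^esub> v = single 0 c \<odot>\<^bsub>M\<^esub> v" for c v
    by (simp_all add: C_def component_space_def)
  define \<phi> where "\<phi> \<tau> = term_val \<tau> 1" for \<tau>
  have std: "standard d \<subseteq> terms d" by (auto simp: standard_def)
  have \<phi>: "\<phi> \<tau> \<in> G d" if "\<tau> \<in> standard d" for \<tau> unfolding \<phi>_def by (rule term_val_G[OF subsetD[OF std that]])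
  have fin: "finite (standard d)" using std finite_terms finite_subset by blast
  have inj: "inj_on \<phi> (standard d)"
  proof (rule inj_onI, rule ccontr)
    fix \<sigma> \<tau> assume st: "\<sigma> \<in> standard d" "\<tau> \<in> standard d" "\<phi> \<sigma> = \<phi> \<tau>" "\<sigma> \<noteq> \<tau>"
    have T: "\<sigma> \<in> terms d" "\<tau> \<in> terms d" using st std by auto
    define f where "f \<rho> = (if \<rho> = \<sigma> then 1 else if \<rho> = \<tau> then - 1 else 0 :: 'k)" for \<rho>
    have "term_sum d f = (\<Oplus>\<^bsub>M\<^esub>\<rho>\<in>{\<sigma>, \<tau>}. term_val \<rho> (f \<rho>))"
      unfolding term_sum_def
      by (rule M.add.finprod_mono_neutral_cong_right[OF finite_terms, simplified])
        (use st std in \<open>auto simp: f_def term_val_zero term_val_carrier\<close>)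
    also have "\<dots> = term_val \<sigma> (f \<sigma>) \<oplus>\<^bsub>M\<^esub> (\<Oplus>\<^bsub>M\<^esub>\<rho>\<in>{\<tau>}. term_val \<rho> (f \<rho>))"
      using st(4) T by (intro M.finsum_insert) (auto intro: term_val_carrier[of _ d])
    also have "(\<Oplus>\<^bsub>M\<^esub>\<rho>\<in>{\<tau>}. term_val \<rho> (f \<rho>)) = term_val \<tau> (f \<tau>) \<oplus>\<^bsub>M\<^esub> (\<Oplus>\<^bsub>M\<^esub>\<rho>\<in>{}. term_val \<rho> (f \<rho>))"
      using T by (intro M.finsum_insert) (auto intro: term_val_carrier[of _ d])
    also have "\<dots> = term_val \<tau> (- 1)"
      using st(4) T(2) term_val_carrier by (simp add: f_def)
    also have "term_val \<sigma> (f \<sigma>) = term_val \<sigma> 1" by (simp add: f_def)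
    also have "term_val \<sigma> 1 \<oplus>\<^bsub>M\<^esub> term_val \<tau> (- 1) = term_val \<tau> (1 + - 1)" using term_val_add[OF T(2), of 1 "- 1"] st(3) by (simp only: \<phi>_def)
    also have "\<dots> = \<zero>\<^bsub>M\<^esub>" using term_val_zero[OF T(2)] by simp
    finally have "f \<sigma> = 0" by (rule term_sum_standard_zero) (use st std in \<open>auto simp: f_def\<close>)
    then show False by (simp add: f_def)
  qed
  have lincomb: "C.lincomb a (\<phi> ` standard d) = term_sum d (\<lambda>\<tau>. if \<tau> \<in> standard d then a (\<phi> \<tau>) else 0)" for a
  proof -
    have "C.lincomb a (\<phi> ` standard d) = finsum M (\<lambda>v. single 0 (a v) \<odot>\<^bsub>M\<^esub> v) (\<phi> ` standard d)"
      unfolding C.lincomb_def C(3) unfolding C_def by (rule finsum_component_space) (auto intro: scale_G \<phi>)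
    also have "\<dots> = (\<Oplus>\<^bsub>M\<^esub>\<tau>\<in>standard d. single 0 (a (\<phi> \<tau>)) \<odot>\<^bsub>M\<^esub> \<phi> \<tau>)"
      by (rule M.finsum_reindex[OF _ inj]) (auto intro!: smult_closed G_carrier[OF \<phi>])
    also have "\<dots> = term_sum d (\<lambda>\<tau>. if \<tau> \<in> standard d then a (\<phi> \<tau>) else 0)"
      unfolding term_sum_def
      by (rule M.add.finprod_mono_neutral_cong_left[OF finite_terms std, simplified])
        (use std in \<open>auto simp: term_val_zero term_val_carrier \<phi>_def single_term_val subset_iff standard_def\<close>)
    finally show ?thesis .
  qed
  have "C.lin_indpt (\<phi> ` standard d)"
  proof (rule C.finite_lin_indpt2)
    show "finite (\<phi> ` standard d)" using fin by simp
    show "\<phi> ` standard d \<subseteq> carrier C" using \<phi> by (auto simp: C)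
    fix a assume "C.lincomb a (\<phi> ` standard d) = \<zero>\<^bsub>C\<^esub>"
    then have z: "term_sum d (\<lambda>\<tau>. if \<tau> \<in> standard d then a (\<phi> \<tau>) else 0) = \<zero>\<^bsub>M\<^esub>" by (simp add: lincomb C)
    have "(if \<tau> \<in> standard d then a (\<phi> \<tau>) else 0) = 0" if "\<tau> \<in> standard d" for \<tau>
      by (rule term_sum_standard_zero[OF z]) (use that std in auto)
    then show "\<forall>v\<in>\<phi> ` standard d. a v = \<zero>\<^bsub>class_ring\<^esub>" by auto
  qed
  moreover have "C.gen_set (\<phi> ` standard d)"
  proof -
    have "w \<in> C.span (\<phi> ` standard d)" if w: "w \<in> G d" for w
    proof -
      obtain f where f: "w = term_sum d f" using w by (rule term_sum_surj)
      obtain h where h: "term_sum d h = term_sum d f" "\<forall>\<tau>\<in>terms d. \<tau> \<notin> standard d \<longrightarrow> h \<tau> = 0"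
        using term_sum_reduce[of d f] by blast
      define a where "a v = h (the_inv_into (standard d) \<phi> v)" for v
      have "C.lincomb a (\<phi> ` standard d) = term_sum d h"
        unfolding lincomb by (rule term_sum_cong) (use h(2) inj in \<open>auto simp: a_def the_inv_into_f_f\<close>)
      then show ?thesis
        using fin f h(1) unfolding C.span_def by (intro CollectI exI[of _ a] exI[of _ "\<phi> ` standard d"]) auto
    qed
    moreover have "C.span (\<phi> ` standard d) \<subseteq> carrier C"
      using \<phi> by (intro C.span_is_subset2) (auto simp: C)
    ultimately show ?thesis by (auto simp: C)
  qed
  ultimately have "C.basis (\<phi> ` standard d)" using \<phi> by (auto simp: C.basis_def C)
  then have "C.dim = card (\<phi> ` standard d)" using fin by (intro C.dim_basis) auto
  then show ?thesis using inj by (simp add: card_image C_def)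
qed

end

context generated
begin

section \<open>The bigraded Hilbert function\<close>

definition cones :: "nat \<Rightarrow> ((nat + nat \<Rightarrow>\<^sub>0 nat) \<times> (nat + nat) set) set" where
  "cones e = (SOME C. finite C \<and> (\<forall>(u, U)\<in>C. u \<in> expos V \<and> U \<subseteq> V) \<and> disjoint_family_on cone C \<and>
    standard_expos e = (\<Union>c\<in>C. cone c))"

lemma cones:
  shows "finite (cones e)" and "(u, U) \<in> cones e \<Longrightarrow> u \<in> expos V \<and> U \<subseteq> V"
    and "disjoint_family_on cone (cones e)" and "standard_expos e = (\<Union>c\<in>cones e. cone c)"
proof -
  have "\<exists>C. finite C \<and> (\<forall>(u, U)\<in>C. u \<in> expos V \<and> U \<subseteq> V) \<and> disjoint_family_on cone C \<and>
      standard_expos e = (\<Union>c\<in>C. cone c)"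
  proof (rule cone_decomposition[OF finite_V downset_standard_expos[of e]])
    fix C assume "finite C" "\<And>u U. (u, U) \<in> C \<Longrightarrow> u \<in> expos V \<and> U \<subseteq> V"
      "disjoint_family_on cone C" "standard_expos e = (\<Union>c\<in>C. cone c)"
    then show ?thesis by (intro exI[of _ C]) auto
  qed
  from someI_ex[OF this]
  have "finite (cones e) \<and> (\<forall>(u, U)\<in>cones e. u \<in> expos V \<and> U \<subseteq> V) \<and> disjoint_family_on cone (cones e) \<and>
      standard_expos e = (\<Union>c\<in>cones e. cone c)"
    unfolding cones_def .
  then show "finite (cones e)" and "(u, U) \<in> cones e \<Longrightarrow> u \<in> expos V \<and> U \<subseteq> V"
    and "disjoint_family_on cone (cones e)" and "standard_expos e = (\<Union>c\<in>cones e. cone c)"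
    by auto
qed

text \<open>A cone together with the index of the generator that it belongs to.\<close>

definition gen_cones :: "(nat \<times> (nat + nat \<Rightarrow>\<^sub>0 nat) \<times> (nat + nat) set) set" where
  "gen_cones = (SIGMA e:{..<g}. cones e)"

definition xvars :: "nat \<times> (nat + nat \<Rightarrow>\<^sub>0 nat) \<times> (nat + nat) set \<Rightarrow> (nat + nat) set" where
  "xvars q = snd (snd q) \<inter> range Inl"

definition yvars :: "nat \<times> (nat + nat \<Rightarrow>\<^sub>0 nat) \<times> (nat + nat) set \<Rightarrow> (nat + nat) set" where
  "yvars q = snd (snd q) \<inter> range Inr"

definition corner :: "nat \<times> (nat + nat \<Rightarrow>\<^sub>0 nat) \<times> (nat + nat) set \<Rightarrow> int \<times> int" where
  "corner q = \<delta> (fst q) + bideg p (fst (snd q))"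

lemma finite_gen_cones: "finite gen_cones"
  using cones(1) by (auto simp: gen_cones_def)

lemma gen_cones_vars:
  assumes "q \<in> gen_cones"
  shows "xvars q \<subseteq> varsS n" "yvars q \<subseteq> Inr ` {..<m}" "finite (xvars q)" "finite (yvars q)"
proof -
  obtain e u U where "q = (e, u, U)" "(u, U) \<in> cones e" using assms by (auto simp: gen_cones_def)
  then have "snd (snd q) \<subseteq> V" using cones(2)[of u U e] by simp
  then show "xvars q \<subseteq> varsS n" "yvars q \<subseteq> Inr ` {..<m}" by (auto simp: xvars_def yvars_def)
  then show "finite (xvars q)" "finite (yvars q)" by (meson finite_imageI finite_lessThan finite_subset)+
qed

text \<open>As far as dimensions go, \<open>M\<^sub>k\<close> is a direct sum of shifted polynomial rings, one for each cone
and each monomial in the \<open>y\<close>-variables of the cone that moves its corner to second degree \<open>k\<close>.\<close>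

definition summands :: "int \<Rightarrow> ((nat \<times> (nat + nat \<Rightarrow>\<^sub>0 nat) \<times> (nat + nat) set) \<times> (nat + nat \<Rightarrow>\<^sub>0 nat)) set" where
  "summands k = (SIGMA q:gen_cones. if k < snd (corner q) then {} else expos_deg (yvars q) (nat (k - snd (corner q))))"

definition summand_rank where "summand_rank z = card (xvars (fst z))"

definition summand_shift where "summand_shift z = fst (corner (fst z)) + int (y_weight p (snd z))"

lemma finite_summands: "finite (summands k)"
  unfolding summands_def
  by (intro finite_SigmaI finite_gen_cones) (auto intro: finite_expos_deg gen_cones_vars)

text \<open>Each cone \<open>u + \<nat>\<^sup>U\<close> at a generator is counted by \<open>card_expos_bideg\<close>.\<close>

lemma card_standard: "card (standard (a, k)) = (\<Sum>z\<in>summands k. free_hilbert (summand_rank z) (a - summand_shift z))"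
proof -
  have fib: "card {t \<in> cone c. bideg p t = (a, k) - \<delta> e} =
      (\<Sum>b\<in>(if k < snd (corner (e, c)) then {} else expos_deg (yvars (e, c)) (nat (k - snd (corner (e, c))))).
        free_hilbert (card (xvars (e, c))) (a - fst (corner (e, c)) - int (y_weight p b)))"
    if c: "c \<in> cones e" for e c
  proof -
    obtain u U where uU: "c = (u, U)" by (cases c)
    have U: "finite U" using cones(2)[of u U e] c uU finite_V finite_subset by blast
    have "{t \<in> cone c. bideg p t = (a, k) - \<delta> e} = (+) u ` {s \<in> expos U. bideg p s = (a, k) - corner (e, c)}"
      by (auto simp: cone_def uU bideg_add corner_def algebra_simps)
    then have "card {t \<in> cone c. bideg p t = (a, k) - \<delta> e} = card {s \<in> expos U. bideg p s = (a, k) - corner (e, c)}"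
      by (simp add: card_image)
    also have "(a, k) - corner (e, c) = (a - fst (corner (e, c)), k - snd (corner (e, c)))"
      by (simp add: prod_eq_iff)
    finally show ?thesis
      by (simp add: card_expos_bideg[OF U] xvars_def yvars_def uU)
  qed
  have fin: "finite {t \<in> cone c. bideg p t = (a, k) - \<delta> e}" if "c \<in> cones e" for e c
  proof -
    have "cone c \<subseteq> expos V" using cones(4)[of e] that by (auto simp: standard_expos_def)
    then have "{t \<in> cone c. bideg p t = (a, k) - \<delta> e} \<subseteq> {t \<in> expos V. bideg p t = (a, k) - \<delta> e}" by blast
    then show ?thesis using finite_bideg_fibre[OF finite_V] finite_subset by blast
  qed
  have "card (standard (a, k)) = (\<Sum>e<g. card {t \<in> standard_expos e. bideg p t = (a, k) - \<delta> e})"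
  proof -
    have "finite {t \<in> standard_expos e. bideg p t = (a, k) - \<delta> e}" for e
      by (rule finite_subset[OF _ finite_bideg_fibre[OF finite_V, of p "(a, k) - \<delta> e"]]) (auto simp: standard_expos_def)
    then show ?thesis unfolding standard_eq by (subst card_SigmaI) auto
  qed
  also have "\<dots> = (\<Sum>e<g. \<Sum>c\<in>cones e. card {t \<in> cone c. bideg p t = (a, k) - \<delta> e})"
  proof (intro sum.cong refl)
    fix e
    have "{t \<in> standard_expos e. bideg p t = (a, k) - \<delta> e} = (\<Union>c\<in>cones e. {t \<in> cone c. bideg p t = (a, k) - \<delta> e})"
      using cones(4)[of e] by auto
    also have "card \<dots> = (\<Sum>c\<in>cones e. card {t \<in> cone c. bideg p t = (a, k) - \<delta> e})"
    proof (rule card_UN_disjoint[OF cones(1)])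
      show "\<forall>c\<in>cones e. finite {t \<in> cone c. bideg p t = (a, k) - \<delta> e}" using fin by blast
      show "\<forall>c\<in>cones e. \<forall>c'\<in>cones e. c \<noteq> c' \<longrightarrow>
          {t \<in> cone c. bideg p t = (a, k) - \<delta> e} \<inter> {t \<in> cone c'. bideg p t = (a, k) - \<delta> e} = {}"
        using cones(3)[of e] unfolding disjoint_family_on_def by blast
    qed
    finally show "card {t \<in> standard_expos e. bideg p t = (a, k) - \<delta> e} =
        (\<Sum>c\<in>cones e. card {t \<in> cone c. bideg p t = (a, k) - \<delta> e})" .
  qed
  also have "\<dots> = (\<Sum>q\<in>gen_cones. card {t \<in> cone (snd q). bideg p t = (a, k) - \<delta> (fst q)})"
    unfolding gen_cones_def by (subst sum.Sigma) (auto simp: cones(1) case_prod_unfold)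
  also have "\<dots> = (\<Sum>q\<in>gen_cones.
      \<Sum>b\<in>(if k < snd (corner q) then {} else expos_deg (yvars q) (nat (k - snd (corner q)))).
        free_hilbert (card (xvars q)) (a - fst (corner q) - int (y_weight p b)))"
  proof (intro sum.cong refl)
    fix q assume "q \<in> gen_cones"
    then obtain e c where "q = (e, c)" "c \<in> cones e" by (auto simp: gen_cones_def)
    then show "card {t \<in> cone (snd q). bideg p t = (a, k) - \<delta> (fst q)} =
      (\<Sum>b\<in>(if k < snd (corner q) then {} else expos_deg (yvars q) (nat (k - snd (corner q)))).
        free_hilbert (card (xvars q)) (a - fst (corner q) - int (y_weight p b)))"
      using fib by simp
  qed
  also have "\<dots> = (\<Sum>z\<in>summands k. free_hilbert (summand_rank z) (a - summand_shift z))"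
    unfolding summands_def
    by (subst sum.Sigma)
      (auto simp: finite_gen_cones finite_expos_deg gen_cones_vars summand_rank_def summand_shift_def algebra_simps intro!: sum.cong)
  finally show ?thesis .
qed

lemma component_space_slice: "component_space (slice M G k) U = component_space M U"
  by (simp add: component_space_def slice_def)

lemma iter_hilbert_slice:
  "iter_hilbert (slice M G k) (\<lambda>a. G (a, k)) i a = (\<Sum>z\<in>summands k. free_hilbert (summand_rank z + i) (a - summand_shift z))"
  by (rule iter_hilbert_free_sum[OF finite_summands])
    (simp add: component_space_slice dim_component card_standard)

section \<open>Annihilators of the slices\<close>

definition ann :: "int \<Rightarrow> (nat + nat, 'k) mpoly set" where
  "ann k = annihilator (ringS n) (slice M G k)"

lemma polys_S_V: "f \<in> polys (varsS n) \<Longrightarrow> f \<in> polys V"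
  using expos_mono[of "varsS n" V] by (auto simp: polys_def)

lemma ringS_sel: "carrier (ringS n) = polys (varsS n)"
  by (simp add: ringS_def poly_ring_sel)

lemma slice_sel: "a \<odot>\<^bsub>slice M G k\<^esub> w = a \<odot>\<^bsub>M\<^esub> w" "\<zero>\<^bsub>slice M G k\<^esub> = \<zero>\<^bsub>M\<^esub>"
  "carrier (slice M G k) = {finsum M c I | c I. finite I \<and> (\<forall>i\<in>I. c i \<in> G (i, k))}"
  by (simp_all add: slice_def)

lemma ann_iff: "f \<in> ann k \<longleftrightarrow> f \<in> polys (varsS n) \<and> (\<forall>a. \<forall>w\<in>G (a, k). f \<odot>\<^bsub>M\<^esub> w = \<zero>\<^bsub>M\<^esub>)"
proof (intro iffI conjI allI ballI)
  fix a w assume f: "f \<in> ann k" and w: "w \<in> G (a, k)"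
  have "w = finsum M (\<lambda>_. w) {a}"
    using G_carrier[OF w] by (simp add: M.finsum_insert)
  then have "w \<in> carrier (slice M G k)"
    unfolding slice_sel using w by (intro CollectI exI[of _ "\<lambda>_. w"] exI[of _ "{a}"]) auto
  then show "f \<odot>\<^bsub>M\<^esub> w = \<zero>\<^bsub>M\<^esub>" using f by (auto simp: ann_def annihilator_def slice_sel(1,2))
next
  assume "f \<in> ann k"
  then show "f \<in> polys (varsS n)" by (simp add: ann_def annihilator_def ringS_sel)
next
  assume f: "f \<in> polys (varsS n) \<and> (\<forall>a. \<forall>w\<in>G (a, k). f \<odot>\<^bsub>M\<^esub> w = \<zero>\<^bsub>M\<^esub>)"
  have "f \<odot>\<^bsub>M\<^esub> finsum M c I = \<zero>\<^bsub>M\<^esub>" if I: "finite I" "\<forall>i\<in>I. c i \<in> G (i, k)" for c I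
  proof -
    have "f \<odot>\<^bsub>M\<^esub> finsum M c I = (\<Oplus>\<^bsub>M\<^esub>i\<in>I. f \<odot>\<^bsub>M\<^esub> c i)"
      using f I polys_S_V by (intro finsum_smult_ldistr) (auto simp: ringA_sel intro: G_carrier)
    also have "\<dots> = \<zero>\<^bsub>M\<^esub>" using f I by (intro M.add.finprod_one_eqI) auto
    finally show ?thesis .
  qed
  then show "f \<in> ann k" using f by (auto simp: ann_def annihilator_def slice_sel ringS_sel)
qed

text \<open>If \<open>f\<close> annihilates a homogeneous element \<open>w\<close>, then the elements \<open>f\<^sub>c w\<close> have different
degrees and sum \<open>0\<close>, so each of them is zero.\<close>

lemma hideal_ann: "hideal (varsS n) (ann k)"
proof -
  have "0 \<in> ann k" by (auto simp: ann_iff intro: G_carrier)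
  moreover have "f + h \<in> ann k" if fh: "f \<in> ann k" "h \<in> ann k" for f h
  proof -
    have "(f + h) \<odot>\<^bsub>M\<^esub> w = f \<odot>\<^bsub>M\<^esub> w \<oplus>\<^bsub>M\<^esub> h \<odot>\<^bsub>M\<^esub> w" if "w \<in> G (a, k)" for a w
      using smult_l_distr[of f h w] fh polys_S_V G_carrier[OF that] by (auto simp: ringA_sel ann_iff)
    then show ?thesis using fh by (auto simp: ann_iff intro: polys_add)
  qed
  moreover have "h * f \<in> ann k" if fh: "f \<in> ann k" "h \<in> polys (varsS n)" for f h
  proof -
    have "(h * f) \<odot>\<^bsub>M\<^esub> w = \<zero>\<^bsub>M\<^esub>" if "w \<in> G (a, k)" for a w
      using smult_assoc1[of h f w] fh polys_S_V G_carrier[OF that] that by (auto simp: ringA_sel ann_iff)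
    then show ?thesis using fh by (auto simp: ann_iff intro: polys_mult)
  qed
  moreover have "hcomp c f \<in> ann k" if f: "f \<in> ann k" for f c
  proof -
    have fS: "f \<in> polys (varsS n)" using f by (simp add: ann_iff)
    obtain b where "f \<in> polys_le (varsS n) b" using polys_in_polys_le fS by blast
    then have fb: "f \<in> polys_le (varsS n) (max b c)" using polys_le_mono[of b "max b c"] by auto
    have "hcomp c f \<odot>\<^bsub>M\<^esub> w = \<zero>\<^bsub>M\<^esub>" if w: "w \<in> G (a, k)" for a w
    proof -
      have deg: "hcomp i f \<odot>\<^bsub>M\<^esub> w \<in> G (int i + a, k)" for i
      proof -
        have "bideg p t = (int i, 0)" if t: "t \<in> keys (hcomp i f)" for t
        proof -
          have "t \<in> expos (varsS n)" "tdeg t = i"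
            using hcomp_polys[OF fS, of i] homog_hcomp[of i f] t by (auto simp: polys_def homog_def)
          then show ?thesis using bideg_varsS[of t p] expos_mono[of "varsS n" "range Inl"] by auto
        qed
        from bihomogeneous_smult[OF polys_S_V[OF hcomp_polys[OF fS]] this w]
        show ?thesis by simp
      qed
      define F where "F d = hcomp (nat (fst d - a)) f \<odot>\<^bsub>M\<^esub> w" for d :: "int \<times> int"
      define D where "D = (\<lambda>i. (int i + a, k)) ` {..max b c}"
      have F: "F d \<in> G d" if "d \<in> D" for d using that deg by (auto simp: F_def D_def)
      have "finsum M F D = (\<Oplus>\<^bsub>M\<^esub>i\<in>{..max b c}. F (int i + a, k))"
        unfolding D_def
        by (rule M.finsum_reindex) (auto simp: inj_on_def D_def[symmetric] intro: G_carrier[OF F])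
      also have "\<dots> = (\<Oplus>\<^bsub>M\<^esub>i\<in>{..max b c}. hcomp i f \<odot>\<^bsub>M\<^esub> w)" by (simp add: F_def)
      also have "\<dots> = (\<Sum>i\<le>max b c. hcomp i f) \<odot>\<^bsub>M\<^esub> w"
        using G_carrier[OF w] polys_S_V[OF hcomp_polys[OF fS]] by (intro sum_smult[symmetric]) auto
      also have "\<dots> = \<zero>\<^bsub>M\<^esub>" using f w by (simp add: sum_hcomp[OF fb] ann_iff)
      also have "\<dots> = finsum M (\<lambda>_. \<zero>\<^bsub>M\<^esub>) D" by simp
      finally have "F (int c + a, k) = \<zero>\<^bsub>M\<^esub>"
        by (intro graded_unique[of D F "\<lambda>_. \<zero>\<^bsub>M\<^esub>"] F) (auto simp: D_def)
      then show ?thesis by (simp add: F_def)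
    qed
    then show ?thesis using hcomp_polys[OF fS] by (simp add: ann_iff)
  qed
  moreover have "ann k \<subseteq> polys (varsS n)" by (auto simp: ann_iff)
  ultimately show ?thesis by (simp add: hideal_def pideal_def)
qed

text \<open>Above the degrees of the generators every term of \<open>M\<^sub>k\<^sub>+\<^sub>1\<close> is divisible by some \<open>y\<^sub>j\<close>, so
\<open>M\<^sub>k\<^sub>+\<^sub>1\<close> is generated by the images of \<open>M\<^sub>k\<close> under the \<open>y\<^sub>j\<close>.\<close>

lemma ann_mono:
  assumes k: "\<And>e. e < g \<Longrightarrow> snd (\<delta> e) \<le> k"
  shows "ann k \<subseteq> ann (k + 1)"
proof
  fix f assume f: "f \<in> ann k"
  then have fS: "f \<in> polys (varsS n)" by (simp add: ann_iff)
  have tv: "f \<odot>\<^bsub>M\<^esub> term_val \<tau> c = \<zero>\<^bsub>M\<^esub>" if \<tau>: "\<tau> \<in> terms (a, k + 1)" for \<tau> a c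
  proof -
    obtain e t where et: "\<tau> = (e, t)" "e < g" "t \<in> expos V" "\<delta> e + bideg p t = (a, k + 1)"
      using \<tau> by (auto simp: terms_def)
    have "t \<in> expos (range Inl \<union> range Inr)" by (auto simp: expos_def) (metis UNIV_I image_eqI sumE)
    then obtain t1 t2 where t12: "t1 \<in> expos (range Inl)" "t2 \<in> expos (range Inr)" "t = t1 + t2" by (rule expos_Un_split)
    have "snd (bideg p t) = int (tdeg t2)"
      using bideg_varsS[OF t12(1), of p] bideg_varsY[OF t12(2), of p] by (simp add: t12(3) bideg_add)
    moreover have "snd (\<delta> e) + snd (bideg p t) = k + 1" using et(4) by (metis snd_add snd_conv)
    ultimately have "t2 \<noteq> 0" using k[OF et(2)] by auto
    then obtain v where v: "v \<in> keys t2" by (metis all_not_in_conv keys_eq_empty)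
    then obtain j where j: "v = Inr j" using t12(2) by (auto simp: expos_def)
    have "v \<in> keys t" using v by (simp add: t12(3) keys_add_nat)
    then have split: "t = single v 1 + (t - single v 1)"
      by (intro le_imp_add) (auto simp: lookup_single when_def in_keys_iff)
    define s where "s = t - single v 1"
    have s: "single v 1 \<in> expos V" "s \<in> expos V" using et(3) split unfolding s_def by (metis expos_add)+
    have ts: "t = single v 1 + s" using split by (simp add: s_def)
    have "bideg p (single v 1) = (int (p j), 1)" by (simp add: bideg_single j var_bideg_def)
    (* division by y_j leads to a term of the slice at k *)
    then have "\<delta> e + bideg p s = (a - int (p j), k)"
      using et(4) by (auto simp: ts bideg_add prod_eq_iff)
    then have es: "(e, s) \<in> terms (a - int (p j), k)" using et(2) s by (simp add: terms_def)
    have xc: "term_val (e, s) c \<in> carrier M" using es by (rule term_val_carrier)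
    have R: "single (single v 1) 1 \<in> carrier (ringA n m)" "f \<in> carrier (ringA n m)"
      using s polys_S_V[OF fS] by (simp_all add: ringA_sel)
    have "term_val \<tau> c = single (single v 1) 1 \<odot>\<^bsub>M\<^esub> term_val (e, s) c"
      using single_term_val[OF es s(1)] by (simp add: et(1) ts)
    then have "f \<odot>\<^bsub>M\<^esub> term_val \<tau> c = (f * single (single v 1) 1) \<odot>\<^bsub>M\<^esub> term_val (e, s) c"
      using smult_assoc1[OF R(2,1) xc] by (simp add: ringA_sel)
    also have "\<dots> = single (single v 1) 1 \<odot>\<^bsub>M\<^esub> (f \<odot>\<^bsub>M\<^esub> term_val (e, s) c)"
      using smult_assoc1[OF R xc] by (simp add: ringA_sel mult.commute)
    also have "f \<odot>\<^bsub>M\<^esub> term_val (e, s) c = \<zero>\<^bsub>M\<^esub>"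
      using f term_val_G[OF es] by (auto simp: ann_iff)
    also have "single (single v 1) 1 \<odot>\<^bsub>M\<^esub> \<zero>\<^bsub>M\<^esub> = \<zero>\<^bsub>M\<^esub>" by (rule smult_r_null[OF R(1)])
    finally show ?thesis .
  qed
  have "f \<odot>\<^bsub>M\<^esub> w = \<zero>\<^bsub>M\<^esub>" if w: "w \<in> G (a, k + 1)" for a w
  proof -
    obtain h where h: "w = term_sum (a, k + 1) h" using w by (rule term_sum_surj)
    have "f \<odot>\<^bsub>M\<^esub> w = (\<Oplus>\<^bsub>M\<^esub>\<tau>\<in>terms (a, k + 1). f \<odot>\<^bsub>M\<^esub> term_val \<tau> (h \<tau>))"
      unfolding h term_sum_def using polys_S_V[OF fS]
      by (intro finsum_smult_ldistr finite_terms term_val_funcset[OF order_refl]) (simp add: ringA_sel)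
    also have "\<dots> = \<zero>\<^bsub>M\<^esub>" by (intro M.add.finprod_one_eqI tv)
    finally show ?thesis .
  qed
  then show "f \<in> ann (k + 1)" using fS by (simp add: ann_iff)
qed

lemma ann_stable:
  obtains K where "\<And>k. K \<le> k \<Longrightarrow> ann k = ann K"
proof -
  obtain K0 where K0: "\<And>e. e < g \<Longrightarrow> snd (\<delta> e) \<le> K0"
  proof
    fix e assume "e < g"
    then show "snd (\<delta> e) \<le> Max (insert 0 ((\<lambda>e. snd (\<delta> e)) ` {..<g}))" by (intro Max_ge) auto
  qed
  have "ann (K0 + int i) \<subseteq> ann (K0 + int (Suc i))" for i
    using ann_mono[of "K0 + int i"] K0 by (force simp: ac_simps)
  then obtain N where N: "\<And>i. N \<le> i \<Longrightarrow> ann (K0 + int i) = ann (K0 + int N)"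
    using hideal_chain_stable[of "varsS n" "\<lambda>i. ann (K0 + int i)"] hideal_ann by blast
  show ?thesis
  proof (rule that[of "K0 + int N"])
    fix k assume "K0 + int N \<le> k"
    then show "ann k = ann (K0 + int N)" using N[of "nat (k - K0)"] by simp
  qed
qed

text \<open>The term \<open>w\<close> at the exponent \<open>u + b\<close> lies in \<open>M\<^sub>k\<close>, and all its multiples by monomials in the
\<open>x\<close>-variables of the cone are standard terms.  They are linearly independent, so no nonzero
polynomial in these variables annihilates \<open>w\<close>.\<close>

lemma ann_no_polys_in_cone_variables:
  assumes q: "q \<in> gen_cones" and b: "b \<in> expos (yvars q)" "snd (corner q) + int (tdeg b) = k"
    and f: "f \<in> ann k" "keys f \<subseteq> expos (xvars q)"
  shows "f = 0"
proof -
  obtain e u U where qe: "q = (e, u, U)" by (cases q)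
  have e: "e < g" "(u, U) \<in> cones e" using q by (auto simp: gen_cones_def qe)
  have uU: "u \<in> expos V" "U \<subseteq> V" using cones(2)[OF e(2)] by auto
  have fS: "f \<in> polys (varsS n)" using f(1) by (simp add: ann_iff)
  have std: "(e, u + b + t) \<in> standard (\<delta> e + bideg p (u + b + t))" if "t \<in> expos (xvars q)" for t
  proof -
    have "b + t \<in> expos U"
      using b(1) that expos_mono[of "xvars q" U] expos_mono[of "yvars q" U] by (auto simp: xvars_def yvars_def qe)
    then have "u + (b + t) \<in> cone (u, U)" by (auto simp: cone_def)
    then have "u + (b + t) \<in> standard_expos e" using cones(4)[of e] e(2) by blast
    then show ?thesis by (simp add: standard_expos_def add.assoc)
  qed
  have ub: "u + b \<in> expos V" using std[of 0] by (auto simp: standard_def terms_def)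
  have bd: "\<delta> e + bideg p (u + b) = (fst (corner q) + fst (bideg p b), k)"
  proof -
    have "b \<in> expos (range Inr)" using b(1) expos_mono[of "yvars q" "range Inr"] by (auto simp: yvars_def)
    then have "snd (bideg p b) = int (tdeg b)" using bideg_varsY[of b p] by simp
    then show ?thesis using b(2) by (auto simp: corner_def qe bideg_add prod_eq_iff)
  qed
  define a where "a = fst (corner q) + fst (bideg p b)"
  define w where "w = term_val (e, u + b) 1"
  have w: "w \<in> G (a, k)" unfolding w_def by (rule term_val_G) (use e ub bd in \<open>simp add: terms_def a_def\<close>)
  have "hcomp c f = 0" for c
  proof -
    define h where "h = hcomp c f"
    define d where "d = (a + int c, k)"
    (* the relation h w = 0 as a relation between the standard terms sh t *)
    define sh where "sh t = (e, u + b + t)" for t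
    have h: "h \<in> ann k" using hideal_ann[of k] f(1) by (auto simp: hideal_def h_def)
    have hV: "h \<in> polys V" using polys_S_V[OF hcomp_polys[OF fS]] by (simp add: h_def)
    have kh: "t \<in> expos (xvars q)" "tdeg t = c" if "t \<in> keys h" for t
      using that f(2) homog_hcomp[of c f] by (auto simp: h_def homog_def in_keys_iff lookup_hcomp)
    have sh_terms: "sh ` keys h \<subseteq> standard d"
    proof
      fix \<tau> assume "\<tau> \<in> sh ` keys h"
      then obtain t where t: "t \<in> keys h" "\<tau> = sh t" by blast
      have "t \<in> expos (range Inl)" using kh[OF t(1)] expos_mono[of "xvars q" "range Inl"] by (auto simp: xvars_def)
      then have "bideg p t = (int c, 0)" using bideg_varsS kh[OF t(1)] by metis
      moreover have "\<delta> e + bideg p (u + b + t) = (\<delta> e + bideg p (u + b)) + bideg p t"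
        by (simp only: bideg_add add.assoc)
      ultimately have "\<delta> e + bideg p (u + b + t) = d" by (simp add: bd d_def a_def)
      then show "\<tau> \<in> standard d" using std[OF kh(1)[OF t(1)]] t(2) by (simp add: sh_def)
    qed
    have sub: "sh ` keys h \<subseteq> terms d" using sh_terms by (auto simp: standard_def)
    have inj: "inj_on sh (keys h)" by (auto simp: inj_on_def sh_def)
    define F where "F \<tau> = (if \<tau> \<in> sh ` keys h then lookup h (snd \<tau> - (u + b)) else 0)" for \<tau>
    have F: "F (sh t) = lookup h t" if "t \<in> keys h" for t
      using that by (simp add: F_def) (simp add: sh_def)
    have "term_sum d F = (\<Oplus>\<^bsub>M\<^esub>\<tau>\<in>sh ` keys h. term_val \<tau> (F \<tau>))"
      unfolding term_sum_def
      by (rule M.add.finprod_mono_neutral_cong_right[OF finite_terms sub, simplified])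
        (auto simp: F_def term_val_zero term_val_carrier)
    also have "\<dots> = (\<Oplus>\<^bsub>M\<^esub>t\<in>keys h. term_val (sh t) (F (sh t)))"
      by (rule M.finsum_reindex[OF term_val_funcset[OF sub] inj])
    also have "\<dots> = (\<Oplus>\<^bsub>M\<^esub>t\<in>keys h. single t (lookup h t) \<odot>\<^bsub>M\<^esub> w)"
    proof (intro M.finsum_cong' refl)
      have tV: "t \<in> expos V" if "t \<in> keys h" for t using that hV by (auto simp: polys_def)
      show "(\<lambda>t. single t (lookup h t) \<odot>\<^bsub>M\<^esub> w) \<in> keys h \<rightarrow> carrier M"
        using tV G_carrier[OF w] by (auto intro!: smult_closed)
      show "term_val (sh t) (F (sh t)) = single t (lookup h t) \<odot>\<^bsub>M\<^esub> w" if "t \<in> keys h" for t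
        unfolding F[OF that] w_def using tV[OF that] ub gens_carrier[OF e(1)]
        by (simp add: sh_def term_val_def single_single_smult add.commute)
    qed
    also have "\<dots> = h \<odot>\<^bsub>M\<^esub> w" using smult_keys[OF hV G_carrier[OF w]] by simp
    also have "\<dots> = \<zero>\<^bsub>M\<^esub>" using h w by (auto simp: ann_iff)
    finally have z: "term_sum d F = \<zero>\<^bsub>M\<^esub>" .
    have "lookup h t = 0" if t: "t \<in> keys h" for t
    proof -
      have "F (sh t) = 0"
        by (rule term_sum_standard_zero[OF z]) (use sh_terms sub t in \<open>auto simp: F_def\<close>)
      then show ?thesis using F[OF t] by simp
    qed
    then have "h = 0" by (metis in_keys_iff keys_eq_empty all_not_in_conv)
    then show ?thesis by (simp add: h_def)
  qed
  then show ?thesis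
    using polys_in_polys_le[OF fS] sum_hcomp[of f] by (metis sum.neutral)
qed

end

section \<open>Higher iterated Hilbert coefficients of the slices\<close>

lemma deg_le_iff: "- 1 \<le> D \<Longrightarrow> deg P \<le> D \<longleftrightarrow> P = 0 \<or> int (degree P) \<le> D"
  by (auto simp: deg_def)

lemma deg_sum_le:
  assumes "- 1 \<le> D" "\<And>i. i \<in> A \<Longrightarrow> deg (f i) \<le> D"
  shows "deg (sum f A) \<le> D"
proof -
  have add: "deg (P + Q) \<le> D" if "deg P \<le> D" "deg Q \<le> D" for P Q
    using that degree_add_le_max[of P Q] by (auto simp: deg_le_iff[OF assms(1)])
  have "deg (0 :: rat poly) \<le> D" using assms(1) by (simp add: deg_def)
  then show ?thesis using assms(2)
    by (induction A rule: infinite_finite_induct) (simp_all add: add)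
qed

lemma deg_smult_le: "deg (Polynomial.smult c P) \<le> deg P"
  by (auto simp: deg_def)

context generated
begin

lemma krull_dim_slice: "krull_dim (ringS n) (slice M G k) = krull_dim_ring (poly_ring (varsS n) Quot ann k)"
  by (simp add: krull_dim_def ann_def ringS_def)

lemma ldim_eq:
  assumes "\<And>k. K \<le> k \<Longrightarrow> krull_dim (ringS n) (slice M G k) = d"
  shows "ldim n M G = d"
proof -
  have "\<forall>\<^sub>F k in at_top. krull_dim (ringS n) (slice M G k) = d"
    using assms by (auto simp: eventually_at_top_linorder)
  then have "((\<lambda>k. krull_dim (ringS n) (slice M G k)) \<longlongrightarrow> d) at_top"
    by (rule tendsto_eventually)
  then show ?thesis unfolding ldim_def by (rule tendsto_Lim[OF trivial_limit_at_top_linorder])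
qed

lemma corner_bound:
  obtains K where "\<And>q. q \<in> gen_cones \<Longrightarrow> snd (corner q) \<le> K"
proof
  fix q assume "q \<in> gen_cones"
  then show "snd (corner q) \<le> Max (insert 0 ((\<lambda>q. snd (corner q)) ` gen_cones))"
    using finite_gen_cones by (intro Max_ge) auto
qed

lemma summands_large:
  assumes "\<And>q. q \<in> gen_cones \<Longrightarrow> snd (corner q) \<le> K" "K < k"
  shows "summands k = (SIGMA q:{q \<in> gen_cones. yvars q \<noteq> {}}. expos_deg (yvars q) (nat (k - snd (corner q))))"
proof -
  have "snd (corner q) < k" if "q \<in> gen_cones" for q using assms(1)[OF that] assms(2) by simp
  then show ?thesis
    by (fastforce simp: summands_def expos_deg_empty split: if_splits)
qed

lemma card_yvars:
  assumes "q \<in> gen_cones"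
  shows "card (yvars q) \<le> m"
proof -
  have "card (yvars q) \<le> card (Inr ` {..<m} :: (nat + nat) set)"
    using gen_cones_vars(2)[OF assms] by (intro card_mono) auto
  also have "\<dots> = m" by (simp add: card_image)
  finally show ?thesis .
qed

text \<open>If no cone contains a direction \<open>y\<^sub>j\<close>, there are no standard terms left for large \<open>k\<close>.\<close>

lemma vanishing_slices:
  assumes empty: "\<And>q. q \<in> gen_cones \<Longrightarrow> yvars q = {}"
  shows "ldim n M G = - \<infinity>"
    and "\<forall>\<^sub>F k in at_top. \<forall>j. hilbert_coeff n (slice M G k) (\<lambda>a. G (a, k)) i j = 0"
proof -
  obtain K where K: "\<And>q. q \<in> gen_cones \<Longrightarrow> snd (corner q) \<le> K" using corner_bound by blast
  have summands: "summands k = {}" if "K < k" for k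
    using summands_large[OF K that] empty by auto
  have dim: "krull_dim (ringS n) (slice M G k) = - \<infinity>" if k: "K < k" for k
  proof -
    have "w = \<zero>\<^bsub>M\<^esub>" if w: "w \<in> G (a, k)" for a w
    proof -
      have "card (standard (a, k)) = 0" by (simp add: card_standard summands[OF k])
      moreover have "finite (standard (a, k))" using finite_terms[of "(a, k)"] by (simp add: standard_def)
      ultimately have "standard (a, k) = {}" by simp
      obtain f where f: "w = term_sum (a, k) f" using w by (rule term_sum_surj)
      obtain h where h: "term_sum (a, k) h = term_sum (a, k) f" "\<forall>\<tau>\<in>terms (a, k). \<tau> \<notin> standard (a, k) \<longrightarrow> h \<tau> = 0"
        using term_sum_reduce[of "(a, k)" f] by blast
      have "term_sum (a, k) h = term_sum (a, k) (\<lambda>_. 0)"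
        using h(2) \<open>standard (a, k) = {}\<close> by (intro term_sum_cong) auto
      then show ?thesis using f h(1) by (simp add: term_sum_zero)
    qed
    then have "1 \<in> ann k" using zero_smult smult_one by (auto simp: ann_iff ringA_sel)
    then show ?thesis
      unfolding krull_dim_slice by (rule krull_dim_ring_quot_UNIV[OF hideal_pideal[OF hideal_ann]])
  qed
  show "ldim n M G = - \<infinity>" by (rule ldim_eq[of "K + 1"]) (simp add: dim)
  have "hilbert_coeff n (slice M G k) (\<lambda>a. G (a, k)) i j = 0" if k: "K < k" for k j
  proof -
    have "num_coeffs n (slice M G k) i = 0" by (simp add: num_coeffs_def dim[OF k])
    from hilbert_coeff_free_sum[OF finite_summands iter_hilbert_slice this, of j]
    show ?thesis by (simp add: summands[OF k] coeff_sum_def)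
  qed
  then show "\<forall>\<^sub>F k in at_top. \<forall>j. hilbert_coeff n (slice M G k) (\<lambda>a. G (a, k)) i j = 0"
    unfolding eventually_at_top_linorder by (intro exI[of _ "K + 1"]) auto
qed

text \<open>The Krull dimension of \<open>M\<^sub>k\<close> depends only on the annihilator, which is stationary.  The
\<open>x\<close>-variables of a cone are algebraically independent modulo the annihilator, so their number
bounds the growth, and with it the dimension, from below.\<close>

lemma stable_dimension:
  assumes q: "q \<in> gen_cones" "yvars q \<noteq> {}"
  shows "\<exists>(d :: nat) K. (\<forall>k\<ge>K. krull_dim (ringS n) (slice M G k) = ereal (real d)) \<and>
    (\<forall>q\<in>gen_cones. yvars q \<noteq> {} \<longrightarrow> card (xvars q) \<le> d)"
proof -
  obtain K0 where K0: "\<And>k. K0 \<le> k \<Longrightarrow> ann k = ann K0" using ann_stable by blast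
  obtain K1 where K1: "\<And>q. q \<in> gen_cones \<Longrightarrow> snd (corner q) \<le> K1" using corner_bound by blast
  (* any slice far enough out serves, since the annihilator is the same *)
  define k where "k = max K0 K1"
  have k: "ann k = ann K0" using K0[of k] by (simp add: k_def)
  have zero: "f = 0" if q: "q \<in> gen_cones" "yvars q \<noteq> {}" and f: "f \<in> ann k" "keys f \<subseteq> expos (xvars q)" for q f
  proof -
    obtain v where v: "v \<in> yvars q" using q(2) by blast
    show ?thesis
      by (rule ann_no_polys_in_cone_variables[OF q(1) _ _ f, of "single v (nat (k - snd (corner q)))"])
        (use v K1[OF q(1)] in \<open>auto simp: k_def\<close>)
  qed
  have "1 \<notin> ann k" using zero[OF q, of 1] by auto
  then obtain d where d: "krull_dim_ring (poly_ring (varsS n) Quot ann k) = ereal (real d)"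
    "\<And>e. \<not> growth_less (varsS n) e (ann k) \<Longrightarrow> e \<le> d"
    using krull_dim_ring_graded_quot[OF _ hideal_ann, of k] by auto
  show ?thesis
  proof (intro exI[of _ d] exI[of _ K0] conjI allI ballI impI)
    fix k' assume "K0 \<le> k'"
    then show "krull_dim (ringS n) (slice M G k') = ereal (real d)"
      using K0[of k'] k d(1) by (simp add: krull_dim_slice)
  next
    fix q assume q: "q \<in> gen_cones" "yvars q \<noteq> {}"
    obtain as where as: "length as = card (xvars q)" "set as \<subseteq> polys (xvars q)" "alg_indep (ann k) as"
      using alg_indep_variables[OF gen_cones_vars(3)[OF q(1)] zero[OF q]] by blast
    have "set as \<subseteq> polys (varsS n)"
      using as(2) expos_mono[OF gen_cones_vars(1)[OF q(1)]] by (auto simp: polys_def)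
    from alg_indep_growth[OF hideal_pideal[OF hideal_ann] this as(3)]
    show "card (xvars q) \<le> d" using d(2) as(1) by simp
  qed
qed

text \<open>Every cone contributes a sum over a simplex with \<open>|Y| \<le> m\<close> vertices of a polynomial of degree
\<open>l = j - (d - r) \<le> j\<close>.\<close>

lemma coefficient_polynomial:
  assumes d: "\<And>q. q \<in> gen_cones \<Longrightarrow> yvars q \<noteq> {} \<Longrightarrow> card (xvars q) \<le> d"
    and K: "\<And>q. q \<in> gen_cones \<Longrightarrow> snd (corner q) \<le> K" and m: "0 < m" and j: "j < d + i"
  shows "\<exists>P. (\<forall>k>K. of_int (coeff_sum (summands k) (\<lambda>z. summand_rank z + i) summand_shift (d + i) j) = poly P (of_int k)) \<and>
    deg P \<le> int m + int j - 1"
proof -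
  define Q where "Q = {q \<in> gen_cones. yvars q \<noteq> {}}"
  have fin: "finite Q" using finite_gen_cones by (simp add: Q_def)
  define l where "l q = card (xvars q) + j - d" for q
  have "\<exists>P. (\<forall>k\<ge>snd (corner q). (\<Sum>b\<in>expos_deg (yvars q) (nat (k - snd (corner q))).
        of_int (int_choose (fst (corner q) + int (y_weight p b)) (l q))) = poly P (of_int k)) \<and>
      deg P \<le> int m + int j - 1" if q: "q \<in> Q" for q
  proof -
    have q': "q \<in> gen_cones" "yvars q \<noteq> {}" using q by (auto simp: Q_def)
    have w: "y_weight p (single v b) = (case v of Inl _ \<Rightarrow> 0 | Inr r \<Rightarrow> p r) * b" if "v \<in> yvars q" for v b
      using that by (auto simp: yvars_def y_weight_single)
    have "is_poly_fun (l q + card (yvars q)) (\<lambda>k. \<Sum>b\<in>expos_deg (yvars q) k.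
        of_int (int_choose (fst (corner q) + int (y_weight p b)) (l q)))"
      by (rule is_poly_fun_shifted_simplex_sum[OF y_weight_add w gen_cones_vars(4)[OF q'(1)] q'(2)])
    from is_poly_fun_shift_poly[OF this, where b = "snd (corner q)"]
    obtain P where P: "\<And>k. snd (corner q) \<le> k \<Longrightarrow> (\<Sum>b\<in>expos_deg (yvars q) (nat (k - snd (corner q))).
        of_int (int_choose (fst (corner q) + int (y_weight p b)) (l q))) = poly P (of_int k)"
      "deg P \<le> int (l q + card (yvars q)) - 1"
      by blast
    have "l q \<le> j" using d[OF q'] by (simp add: l_def)
    then have "deg P \<le> int m + int j - 1" using P(2) card_yvars[OF q'(1)] by simp
    then show ?thesis using P(1) by blast
  qed
  then obtain P where P: "\<And>q k. q \<in> Q \<Longrightarrow> snd (corner q) \<le> k \<Longrightarrow> (\<Sum>b\<in>expos_deg (yvars q) (nat (k - snd (corner q))).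
        of_int (int_choose (fst (corner q) + int (y_weight p b)) (l q))) = poly (P q) (of_int k)"
      "\<And>q. q \<in> Q \<Longrightarrow> deg (P q) \<le> int m + int j - 1"
    by metis
  define R where "R = (\<Sum>q\<in>Q. if d \<le> card (xvars q) + j then Polynomial.smult ((- 1) ^ (d - card (xvars q))) (P q) else 0)"
  have "of_int (coeff_sum (summands k) (\<lambda>z. summand_rank z + i) summand_shift (d + i) j) = poly R (of_int k)" if k: "K < k" for k
  proof -
    define F :: "_ \<Rightarrow> _ \<Rightarrow> rat" where "F q b = (if d \<le> card (xvars q) + j then (- 1) ^ (d - card (xvars q)) *
        of_int (int_choose (fst (corner q) + int (y_weight p b)) (l q)) else 0)" for q b
    have sl: "summands k = (SIGMA q:Q. expos_deg (yvars q) (nat (k - snd (corner q))))"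
      using summands_large[OF K k] by (simp add: Q_def)
    have "of_int (coeff_sum (summands k) (\<lambda>z. summand_rank z + i) summand_shift (d + i) j) = (\<Sum>z\<in>summands k. F (fst z) (snd z))"
    proof -
      have "of_int (if d + i \<le> summand_rank z + i + j then (- 1) ^ (d + i - (summand_rank z + i)) *
          int_choose (summand_shift z) (summand_rank z + i + j - (d + i)) else 0) = F (fst z) (snd z)" for z
      proof -
        have "summand_rank z + i + j - (d + i) = l (fst z)" "d + i - (summand_rank z + i) = d - card (xvars (fst z))"
          "d + i \<le> summand_rank z + i + j \<longleftrightarrow> d \<le> card (xvars (fst z)) + j"
          by (simp_all add: summand_rank_def l_def)
        then show ?thesis by (simp add: F_def summand_shift_def)
      qed
      then show ?thesis using j by (simp only: coeff_sum_def of_int_sum if_True)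
    qed
    also have "\<dots> = (\<Sum>q\<in>Q. \<Sum>b\<in>expos_deg (yvars q) (nat (k - snd (corner q))). F q b)"
      unfolding sl using fin gen_cones_vars(4)
      by (subst sum.Sigma) (auto simp: finite_expos_deg Q_def case_prod_unfold)
    also have "\<dots> =
        (\<Sum>q\<in>Q. \<Sum>b\<in>expos_deg (yvars q) (nat (k - snd (corner q))).
          if d \<le> card (xvars q) + j then (- 1) ^ (d - card (xvars q)) *
            of_int (int_choose (fst (corner q) + int (y_weight p b)) (l q)) else (0 :: rat))"
      by (simp only: F_def)
    also have "\<dots> = (\<Sum>q\<in>Q. if d \<le> card (xvars q) + j then (- 1) ^ (d - card (xvars q)) *
        (\<Sum>b\<in>expos_deg (yvars q) (nat (k - snd (corner q))).
          of_int (int_choose (fst (corner q) + int (y_weight p b)) (l q))) else 0)"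
      by (intro sum.cong refl) (simp add: sum_distrib_left)
    also have "\<dots> = (\<Sum>q\<in>Q. if d \<le> card (xvars q) + j then (- 1) ^ (d - card (xvars q)) * poly (P q) (of_int k) else 0)"
    proof (intro sum.cong refl)
      fix q assume q: "q \<in> Q"
      then have "snd (corner q) \<le> k" using K[of q] k by (simp add: Q_def)
      then show "(if d \<le> card (xvars q) + j then (- 1) ^ (d - card (xvars q)) *
          (\<Sum>b\<in>expos_deg (yvars q) (nat (k - snd (corner q))).
            of_int (int_choose (fst (corner q) + int (y_weight p b)) (l q))) else 0) =
          (if d \<le> card (xvars q) + j then (- 1) ^ (d - card (xvars q)) * poly (P q) (of_int k) else 0)"
        using P(1)[OF q] by simp
    qed
    also have "\<dots> = poly R (of_int k)" unfolding R_def poly_sum by (intro sum.cong) auto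
    finally show ?thesis .
  qed
  moreover have "deg R \<le> int m + int j - 1"
    unfolding R_def
  proof (rule deg_sum_le)
    fix q assume "q \<in> Q"
    then have "deg (Polynomial.smult c (P q)) \<le> int m + int j - 1" for c
      by (rule order_trans[OF deg_smult_le P(2)])
    then show "deg (if d \<le> card (xvars q) + j then Polynomial.smult ((- 1) ^ (d - card (xvars q))) (P q) else 0)
        \<le> int m + int j - 1"
      using m by (simp add: deg_def[of 0])
  qed (use m in simp)
  ultimately show ?thesis by blast
qed

lemma hilbert_coefficients_polynomial:
  shows "\<exists>q :: nat \<Rightarrow> rat poly.
    (\<forall>\<^sub>F k::int in at_top. \<forall>j.
      of_int (hilbert_coeff n (slice M G k) (\<lambda>a. G (a, k)) i j) = poly (q j) (of_int k)) \<and>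
    (\<forall>j. ereal (real j) \<le> ldim n M G + ereal (real i) - 1 \<longrightarrow> deg (q j) \<le> int m + int j - 1) \<and>
    (\<forall>j. ereal (real j) > ldim n M G + ereal (real i) - 1 \<longrightarrow> q j = 0)"
proof (cases "\<exists>q\<in>gen_cones. yvars q \<noteq> {}")
  case False
  then have "ldim n M G = - \<infinity>" "\<forall>\<^sub>F k in at_top. \<forall>j. hilbert_coeff n (slice M G k) (\<lambda>a. G (a, k)) i j = 0"
    using vanishing_slices by blast+
  then show ?thesis by (intro exI[of _ "\<lambda>_. 0"]) (simp add: one_ereal_def)
next
  case True
  then obtain q0 where q0: "q0 \<in> gen_cones" "yvars q0 \<noteq> {}" by blast
  then have m: "0 < m" using gen_cones_vars(2)[OF q0(1)] by auto
  obtain d K where d: "\<And>k. K \<le> k \<Longrightarrow> krull_dim (ringS n) (slice M G k) = ereal (real d)"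
    "\<And>q. q \<in> gen_cones \<Longrightarrow> yvars q \<noteq> {} \<Longrightarrow> card (xvars q) \<le> d"
    using stable_dimension[OF q0] by blast
  obtain L where L: "\<And>q. q \<in> gen_cones \<Longrightarrow> snd (corner q) \<le> L" using corner_bound by blast
  have ldim: "ldim n M G = ereal (real d)" using ldim_eq d(1) by blast
  have coeff: "hilbert_coeff n (slice M G k) (\<lambda>a. G (a, k)) i j =
      coeff_sum (summands k) (\<lambda>z. summand_rank z + i) summand_shift (d + i) j" if k: "max K L < k" for k j
  proof (rule hilbert_coeff_free_sum[OF finite_summands iter_hilbert_slice])
    show "num_coeffs n (slice M G k) i = d + i" using d(1)[of k] k by (simp add: num_coeffs_def)
    show "summand_rank z + i \<le> d + i" if "z \<in> summands k" for z
    proof -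
      have "fst z \<in> gen_cones" "yvars (fst z) \<noteq> {}" using that k summands_large[OF L, of k] by auto
      then show ?thesis using d(2)[of "fst z"] by (simp add: summand_rank_def)
    qed
  qed
  have "\<exists>P. (\<forall>k>L. of_int (coeff_sum (summands k) (\<lambda>z. summand_rank z + i) summand_shift (d + i) j) = poly P (of_int k)) \<and>
      (j < d + i \<longrightarrow> deg P \<le> int m + int j - 1) \<and> (d + i \<le> j \<longrightarrow> P = 0)" for j
  proof (cases "j < d + i")
    case True
    then show ?thesis using coefficient_polynomial[OF d(2) L m True] by (auto simp: not_le[symmetric])
  next
    case False
    then show ?thesis by (intro exI[of _ 0]) (simp add: coeff_sum_def)
  qed
  then obtain P where P: "\<And>j k. L < k \<Longrightarrow> of_int (coeff_sum (summands k) (\<lambda>z. summand_rank z + i) summand_shift (d + i) j) = poly (P j) (of_int k)"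
    "\<And>j. j < d + i \<Longrightarrow> deg (P j) \<le> int m + int j - 1" "\<And>j. d + i \<le> j \<Longrightarrow> P j = 0"
    by metis
  have bound: "ereal (real j) \<le> ldim n M G + ereal (real i) - 1 \<longleftrightarrow> j < d + i" for j
    by (auto simp: ldim one_ereal_def)
  show ?thesis
  proof (intro exI[of _ P] conjI allI impI)
    show "\<forall>\<^sub>F k in at_top. \<forall>j. of_int (hilbert_coeff n (slice M G k) (\<lambda>a. G (a, k)) i j) = poly (P j) (of_int k)"
      unfolding eventually_at_top_linorder
    proof (intro exI[of _ "max K L + 1"] allI impI)
      fix k j assume "max K L + 1 \<le> k"
      then have k: "max K L < k" "L < k" by linarith+
      show "of_int (hilbert_coeff n (slice M G k) (\<lambda>a. G (a, k)) i j) = poly (P j) (of_int k)"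
        unfolding coeff[OF k(1)] by (rule P(1)[OF k(2)])
    qed
    show "deg (P j) \<le> int m + int j - 1" if "ereal (real j) \<le> ldim n M G + ereal (real i) - 1" for j
      using that P(2) bound by blast
    show "P j = 0" if "ereal (real j) > ldim n M G + ereal (real i) - 1" for j
      using that P(3)[of j] bound[of j] by (simp add: not_less[symmetric])
  qed
qed

end

theorem theorem2p2:
  fixes n m :: nat
    and p :: "nat \<Rightarrow> nat"
    and M :: "((nat + nat, 'k::field) mpoly, 'b) module"
    and G :: "int \<times> int \<Rightarrow> 'b set"
  assumes "bigraded_module n m p M G"
    and "finitely_generated (ringA n m) M"
  shows "\<forall>i::nat. \<exists>q :: nat \<Rightarrow> rat poly.
    (\<forall>\<^sub>F k::int in at_top. \<forall>j.
      of_int (hilbert_coeff n (slice M G k) (\<lambda>a. G (a, k)) i j) = poly (q j) (of_int k)) \<and>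
    (\<forall>j. ereal (real j) \<le> ldim n M G + ereal (real i) - 1 \<longrightarrow> deg (q j) \<le> int m + int j - 1) \<and>
    (\<forall>j. ereal (real j) > ldim n M G + ereal (real i) - 1 \<longrightarrow> q j = 0)"
proof
  fix i :: nat
  have "Module.module (ringA n m) M" using assms(1) by (simp add: bigraded_module_def)
  then interpret bigraded n m M p G
    by (intro bigraded.intro bigraded_axioms.intro assms(1))
  obtain g x \<delta> where "\<And>e. e < g \<Longrightarrow> x e \<in> G (\<delta> e)" "\<And>d. G d = hspan g x \<delta> d"
    using homogeneous_generators[OF assms(2)] by metis
  then interpret generated n m M p G g x \<delta>
    by unfold_locales
  show "\<exists>q :: nat \<Rightarrow> rat poly.
    (\<forall>\<^sub>F k::int in at_top. \<forall>j.
      of_int (hilbert_coeff n (slice M G k) (\<lambda>a. G (a, k)) i j) = poly (q j) (of_int k)) \<and>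
    (\<forall>j. ereal (real j) \<le> ldim n M G + ereal (real i) - 1 \<longrightarrow> deg (q j) \<le> int m + int j - 1) \<and>
    (\<forall>j. ereal (real j) > ldim n M G + ereal (real i) - 1 \<longrightarrow> q j = 0)"
    by (rule hilbert_coefficients_polynomial)
qed

end
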